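(* Let $\lambda,\mu\in C^1([-1,1])$ be positive with $\lambda(w)=\mu(-w)$ for all $w\in[-1,1]$, and $b,c\in C([-1,1])$. Consider $$u_t(w,t)+\lambda(w)u_w(w,t)=b(w)v(w,t),\qquad v_t(w,t)-\mu(w)v_w(w,t)=c(w)u(w,t),\qquad w\in[-1,1],\ t\ge0,$$ $$u(-1,t)=U_1(t),\qquad v(1,t)=U_2(t),$$ with initial data $(u_0,v_0)\in L^2([-1,1])^2$, under the feedback laws $$U_1(t)=-\int_{-1}^1 u(z,t)L^{11}(z,-1)\,dz-\int_{-1}^1 v(z,t)L^{12}(z,-1)\,dz,\qquad U_2(t)=\int_{-1}^1 u(z,t)L^{21}(z,1)\,dz+\int_{-1}^1 v(z,t)L^{22}(z,1)\,dz,$$ where $L^{11},L^{12},L^{21},L^{22}\in C(E)$ are the unique solutions of the kernel equations below. Then the closed-loop state $(u,v)$ reaches the zero equilibrium in finite time.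
   Context: $E=\{(z,w)\in[-1,1]^2:|z|\le|w|\}$. The kernels satisfy on $E$: $\lambda(w)L^{11}_w+\lambda(z)L^{11}_z=-\lambda'(z)L^{11}-c(z)L^{12}$, $\lambda(w)L^{12}_w-\mu(z)L^{12}_z=-b(z)L^{11}+\mu'(z)L^{12}$, $L^{11}(-w,w)=0$, $L^{12}(w,w)=b(w)/(\lambda(w)+\mu(w))$; and $\mu(w)L^{22}_w+\mu(z)L^{22}_z=b(z)L^{21}-\mu'(z)L^{22}$, $\mu(w)L^{21}_w-\lambda(z)L^{21}_z=\lambda'(z)L^{21}+c(z)L^{22}$, $L^{22}(-w,w)=0$, $L^{21}(w,w)=-c(w)/(\lambda(w)+\mu(w))$ (all functions evaluated at $(z,w)$). These kernels define the Volterra-type transformation $\alpha(w,t)=u(w,t)-\int_{-w}^{w}[u(z,t)L^{11}(z,w)+v(z,t)L^{12}(z,w)]dz$, $\beta(w,t)=v(w,t)-\int_{-w}^{w}[u(z,t)L^{21}(z,w)+v(z,t)L^{22}(z,w)]dz$, mapping the closed loop to $\alpha_t+\lambda\alpha_w=0$, $\beta_t-\mu\beta_w=0$, $\alpha(-1,t)=\beta(1,t)=0$. *)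

theory Defs
  imports "HOL-Analysis.Analysis"
begin

definition kernE :: "(real \<times> real) set" where
  "kernE = {(z, w). -1 \<le> z \<and> z \<le> 1 \<and> -1 \<le> w \<and> w \<le> 1 \<and> \<bar>z\<bar> \<le> \<bar>w\<bar>}"

definition L2_on_I :: "(real \<Rightarrow> real) \<Rightarrow> bool" where
  "L2_on_I f \<longleftrightarrow> f measurable_on {-1..1} \<and> (\<lambda>x. (f x)\<^sup>2) integrable_on {-1..1}"

text \<open>Solution of the first order equation  fw(w) L_w + fz(z) L_z = F(z,w)  on E in the
  sense of characteristics: along every curve (z(s),w(s)) in E with z' = fz(z), w' = fw(w)
  the function s |-> L(z(s),w(s)) is differentiable with derivative F(z(s),w(s)).\<close>
definition char_sol ::
  "(real \<Rightarrow> real) \<Rightarrow> (real \<Rightarrow> real) \<Rightarrow> (real \<Rightarrow> real \<Rightarrow> real) \<Rightarrow> (real \<Rightarrow> real \<Rightarrow> real) \<Rightarrow> bool" where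
  "char_sol fz fw F L \<longleftrightarrow>
     (\<forall>a b (gz::real \<Rightarrow> real) (gw::real \<Rightarrow> real). a < b \<longrightarrow>
        (\<forall>s\<in>{a..b}. (gz s, gw s) \<in> kernE \<and>
            (gz has_real_derivative fz (gz s)) (at s within {a..b}) \<and>
            (gw has_real_derivative fw (gw s)) (at s within {a..b})) \<longrightarrow>
        (\<forall>s\<in>{a..b}. ((\<lambda>s. L (gz s) (gw s)) has_real_derivative F (gz s) (gw s)) (at s within {a..b})))"

definition kernel_eqs ::
  "(real \<Rightarrow> real) \<Rightarrow> (real \<Rightarrow> real) \<Rightarrow> (real \<Rightarrow> real) \<Rightarrow> (real \<Rightarrow> real) \<Rightarrow>
   (real \<Rightarrow> real) \<Rightarrow> (real \<Rightarrow> real) \<Rightarrow>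
   (real \<Rightarrow> real \<Rightarrow> real) \<Rightarrow> (real \<Rightarrow> real \<Rightarrow> real) \<Rightarrow>
   (real \<Rightarrow> real \<Rightarrow> real) \<Rightarrow> (real \<Rightarrow> real \<Rightarrow> real) \<Rightarrow> bool" where
  "kernel_eqs lam lam' mu mu' b c L11 L12 L21 L22 \<longleftrightarrow>
     continuous_on kernE (\<lambda>(z, w). L11 z w) \<and> continuous_on kernE (\<lambda>(z, w). L12 z w) \<and>
     continuous_on kernE (\<lambda>(z, w). L21 z w) \<and> continuous_on kernE (\<lambda>(z, w). L22 z w) \<and>
     char_sol lam lam (\<lambda>z w. - lam' z * L11 z w - c z * L12 z w) L11 \<and>
     char_sol (\<lambda>z. - mu z) lam (\<lambda>z w. - b z * L11 z w + mu' z * L12 z w) L12 \<and>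
     (\<forall>w\<in>{-1..1}. L11 (-w) w = 0) \<and>
     (\<forall>w\<in>{-1..1}. L12 w w = b w / (lam w + mu w)) \<and>
     char_sol mu mu (\<lambda>z w. b z * L21 z w - mu' z * L22 z w) L22 \<and>
     char_sol (\<lambda>z. - lam z) mu (\<lambda>z w. lam' z * L21 z w + c z * L22 z w) L21 \<and>
     (\<forall>w\<in>{-1..1}. L22 (-w) w = 0) \<and>
     (\<forall>w\<in>{-1..1}. L21 w w = - c w / (lam w + mu w))"

definition test_fun ::
  "(real \<Rightarrow> real \<Rightarrow> real) \<Rightarrow> (real \<Rightarrow> real \<Rightarrow> real) \<Rightarrow> (real \<Rightarrow> real \<Rightarrow> real) \<Rightarrow> bool" where
  "test_fun phi phiw phit \<longleftrightarrow>
     (\<forall>w t. ((\<lambda>w. phi w t) has_real_derivative phiw w t) (at w) \<and>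
            ((\<lambda>t. phi w t) has_real_derivative phit w t) (at t)) \<and>
     continuous_on UNIV (\<lambda>(w, t). phiw w t) \<and> continuous_on UNIV (\<lambda>(w, t). phit w t) \<and>
     (\<exists>a b. 0 < a \<and> a < b \<and> (\<forall>w t. t \<notin> {a..b} \<longrightarrow> phi w t = 0))"

definition U1_fb :: "(real \<Rightarrow> real \<Rightarrow> real) \<Rightarrow> (real \<Rightarrow> real \<Rightarrow> real) \<Rightarrow>
    (real \<Rightarrow> real \<Rightarrow> real) \<Rightarrow> (real \<Rightarrow> real \<Rightarrow> real) \<Rightarrow> real \<Rightarrow> real" where
  "U1_fb L11 L12 u v t =
     - integral {-1..1} (\<lambda>z. u z t * L11 z (-1)) - integral {-1..1} (\<lambda>z. v z t * L12 z (-1))"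

definition U2_fb :: "(real \<Rightarrow> real \<Rightarrow> real) \<Rightarrow> (real \<Rightarrow> real \<Rightarrow> real) \<Rightarrow>
    (real \<Rightarrow> real \<Rightarrow> real) \<Rightarrow> (real \<Rightarrow> real \<Rightarrow> real) \<Rightarrow> real \<Rightarrow> real" where
  "U2_fb L21 L22 u v t =
     integral {-1..1} (\<lambda>z. u z t * L21 z 1) + integral {-1..1} (\<lambda>z. v z t * L22 z 1)"

text \<open>Weak solution (u,v) in C([0,\<infinity>); L^2(-1,1)^2) of the closed-loop system
   u_t + lam u_w = b v, v_t - mu v_w = c u, u(-1,t) = U1(t), v(1,t) = U2(t),
   (u,v)(.,0) = (u0,v0); u(w,t) is written  u w t.\<close>
definition closed_loop_sol ::
  "(real \<Rightarrow> real) \<Rightarrow> (real \<Rightarrow> real) \<Rightarrow> (real \<Rightarrow> real) \<Rightarrow> (real \<Rightarrow> real) \<Rightarrow>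
   (real \<Rightarrow> real) \<Rightarrow> (real \<Rightarrow> real) \<Rightarrow> (real \<Rightarrow> real \<Rightarrow> real) \<Rightarrow> (real \<Rightarrow> real \<Rightarrow> real) \<Rightarrow>
   (real \<Rightarrow> real \<Rightarrow> real) \<Rightarrow> (real \<Rightarrow> real \<Rightarrow> real) \<Rightarrow> (real \<Rightarrow> real) \<Rightarrow> (real \<Rightarrow> real) \<Rightarrow>
   (real \<Rightarrow> real \<Rightarrow> real) \<Rightarrow> (real \<Rightarrow> real \<Rightarrow> real) \<Rightarrow> bool" where
  "closed_loop_sol lam lam' mu mu' b c L11 L12 L21 L22 u0 v0 u v \<longleftrightarrow>
     (\<forall>t\<ge>0. L2_on_I (\<lambda>w. u w t) \<and> L2_on_I (\<lambda>w. v w t)) \<and>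
     (\<forall>t\<ge>0. ((\<lambda>s. integral {-1..1} (\<lambda>w. (u w s - u w t)\<^sup>2)) \<longlongrightarrow> 0) (at t within {0..}) \<and>
             ((\<lambda>s. integral {-1..1} (\<lambda>w. (v w s - v w t)\<^sup>2)) \<longlongrightarrow> 0) (at t within {0..})) \<and>
     integral {-1..1} (\<lambda>w. (u w 0 - u0 w)\<^sup>2) = 0 \<and>
     integral {-1..1} (\<lambda>w. (v w 0 - v0 w)\<^sup>2) = 0 \<and>
     (\<forall>phi phiw phit. test_fun phi phiw phit \<longrightarrow> (\<forall>t. phi 1 t = 0) \<longrightarrow>
        integral {0..} (\<lambda>t. integral {-1..1} (\<lambda>w.
            u w t * (phit w t + lam' w * phi w t + lam w * phiw w t) + b w * v w t * phi w t))
        + integral {0..} (\<lambda>t. lam (-1) * U1_fb L11 L12 u v t * phi (-1) t) = 0) \<and>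
     (\<forall>psi psiw psit. test_fun psi psiw psit \<longrightarrow> (\<forall>t. psi (-1) t = 0) \<longrightarrow>
        integral {0..} (\<lambda>t. integral {-1..1} (\<lambda>w.
            v w t * (psit w t - mu' w * psi w t - mu w * psiw w t) + c w * u w t * psi w t))
        + integral {0..} (\<lambda>t. mu 1 * U2_fb L21 L22 u v t * psi 1 t) = 0)"

end

theory Submission
  imports Defs
begin

text \<open>
  The transformed state \<open>\<alpha>\<close> is transported with zero inflow, so it vanishes after the travel time, and
  the Volterra relation \<open>\<bar>u w\<bar> \<le> C * \<integral> (\<bar>u\<bar> + \<bar>v\<bar>)\<close> over \<open>{-\<bar>w\<bar>..\<bar>w\<bar>}\<close> (and likewise for \<open>v\<close>) then forces
  \<open>u = v = 0\<close>. Since the state is only a weak solution, the transport equation is proved by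
  duality: a test function \<open>h\<close> for \<open>\<alpha>\<close> corresponds to the test pair
  \<open>(h - ktrans L11 h, - ktrans L12 h)\<close> for \<open>(u, v)\<close>. This pair is continuously differentiable although
  the kernels are differentiable only along characteristics, because in characteristic coordinates
  the adjoint transform is an integral over a moving interval of a function differentiable in the
  parameter; the boundary values of the kernels cancel the endpoint terms, except for the one at
  \<open>w = -1\<close>, which is compensated by the feedback law. The statement for \<open>\<beta>\<close> follows by the
  reflection \<open>w \<mapsto> -w\<close>.
\<close>

section \<open>Integrals over moving intervals\<close>

text \<open>The obstacle is that the state is only square integrable in \<open>w\<close>, so
  \<alpha> cannot be differentiated. What evolves are its scalar pairings \<open>M h t\<close>,
  which a du Bois-Reymond argument makes differentiable in \<open>t\<close>. Pairing with test
  functions that move with the flow keeps the value constant until they vanish on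
  \<open>{-1..1}\<close>; this is why the travel time \<open>rb - ra\<close> governs the extinction
  time. The symmetry \<open>lam w = mu (-w)\<close> enters twice. It makes one edge of
  \<open>kernE\<close> characteristic for each kernel, \<open>z = w\<close> for \<open>L11\<close>
  and \<open>z = -w\<close> for \<open>L12\<close>; in characteristic coordinates that edge stands
  still, and the edge that moves is the one on which \<open>kernel_eqs\<close> prescribes the
  kernel. It also gives the reflected system the same speed, so that one flow and one locale serve
  both halves. The Volterra part of the test pair vanishes at both ends of \<open>{-1..1}\<close>.
  Hence the equation for \<open>v\<close> is tested only with functions vanishing at both ends, and
  \<open>U2\<close> does not enter the half that concerns \<alpha>.\<close>

lemma continuous_on_Icc_bounded:
  fixes g :: "real \<Rightarrow> real"
  assumes "continuous_on {a..b} g"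
  obtains B where "B \<ge> 0" "\<And>x. x \<in> {a..b} \<Longrightarrow> \<bar>g x\<bar> \<le> B"
proof -
  obtain B where "\<forall>x\<in>{a..b}. norm (g x) \<le> B"
    using compact_imp_bounded[OF compact_continuous_image[OF assms compact_Icc]]
    by (auto simp: bounded_iff)
  then show ?thesis using that[of "max B 0"] by fastforce
qed

text \<open>The substitution \<open>y = e s + th * (f s - e s)\<close> moves all integrals to the
  fixed interval \<open>{0..1}\<close>, where continuity of parameter integrals applies.\<close>

lemma moving_integral_continuous_on:
  fixes e f :: "real \<Rightarrow> real" and D :: "real \<Rightarrow> real \<Rightarrow> real"
  assumes e: "continuous_on U e" and f: "continuous_on U f"
    and le: "\<And>s. s \<in> U \<Longrightarrow> e s \<le> f s"
    and D: "continuous_on {(s, y). s \<in> U \<and> e s \<le> y \<and> y \<le> f s} (\<lambda>(s, y). D s y)"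
  shows "continuous_on U (\<lambda>s. integral {e s..f s} (D s))"
proof -
  let ?g = "\<lambda>s th. e s + th * (f s - e s)"
  have rng: "e s \<le> ?g s th \<and> ?g s th \<le> f s" if "s \<in> U" "th \<in> {0..1}" for s th
  proof -
    have "th * (f s - e s) \<le> 1 * (f s - e s)" "0 \<le> th * (f s - e s)"
      using that le[of s] by (intro mult_right_mono mult_nonneg_nonneg; simp)+
    then show ?thesis by simp
  qed
  have eq: "integral {e s..f s} (D s) = (f s - e s) * integral (cbox 0 1) (\<lambda>th. D s (?g s th))"
    if "s \<in> U" for s
  proof -
    have "continuous_on {e s..f s} (\<lambda>y. (\<lambda>(s, y). D s y) (s, y))"
      using that by (intro continuous_on_compose2[OF D]) (auto intro!: continuous_intros)
    then have c: "continuous_on {e s..f s} (D s)" by simp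
    have *: "((\<lambda>th. (f s - e s) *\<^sub>R D s (?g s th)) has_integral
        integral {?g s 0..?g s 1} (D s)) {0..1}"
      using rng[OF that] le[OF that] c
      by (intro has_integral_substitution[where c = "e s" and d = "f s"])
         (auto intro!: derivative_eq_intros)
    from integral_unique[OF this] show ?thesis by simp
  qed
  have "continuous_on (U \<times> cbox 0 1) (\<lambda>x. (\<lambda>(s, y). D s y) (fst x, ?g (fst x) (snd x)))"
  proof (rule continuous_on_compose2[OF D])
    show "continuous_on (U \<times> cbox 0 1) (\<lambda>x. (fst x, ?g (fst x) (snd x)))"
      by (intro continuous_intros continuous_on_compose2[OF e] continuous_on_compose2[OF f]) auto
    show "(\<lambda>x. (fst x, ?g (fst x) (snd x))) ` (U \<times> cbox 0 1) \<subseteq> {(s, y). s \<in> U \<and> e s \<le> y \<and> y \<le> f s}"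
      using rng by auto
  qed
  then have "continuous_on (U \<times> cbox 0 1) (\<lambda>(s, th). D s (?g s th))"
    by (simp add: case_prod_unfold)
  then have "continuous_on U (\<lambda>s. integral (cbox 0 1) (\<lambda>th. D s (?g s th)))"
    by (rule integral_continuous_on_param)
  then have "continuous_on U (\<lambda>s. (f s - e s) * integral (cbox 0 1) (\<lambda>th. D s (?g s th)))"
    by (intro continuous_intros e f)
  then show ?thesis
    by (rule continuous_on_eq) (simp add: eq)
qed

lemma integral_near_constant:
  fixes g :: "real \<Rightarrow> real"
  assumes "p \<le> q" "continuous_on {p..q} g" "\<And>y. y \<in> {p..q} \<Longrightarrow> \<bar>g y - c\<bar> \<le> r"
  shows "\<bar>integral {p..q} g - (q - p) * c\<bar> \<le> r * (q - p)"
proof -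
  have gi: "g integrable_on {p..q}" using assms(2) by (rule integrable_continuous_real)
  have "integral {p..q} g - (q - p) * c = integral {p..q} (\<lambda>y. g y - c)"
    using assms(1) gi by (subst Henstock_Kurzweil_Integration.integral_diff) auto
  also have "norm \<dots> \<le> r * (q - p)"
    using assms by (intro integral_bound) (auto intro!: continuous_intros)
  finally show ?thesis by simp
qed

text \<open>A Leibniz rule for an integrand that is differentiable in \<open>s\<close> only along
  segments inside the region between the graphs of \<open>e\<close> and \<open>f\<close>, so
  \<open>N\<close> cannot be differentiated across the moving ends. Since both ends decrease, for
  \<open>s1 < s2\<close> the interval \<open>{e s1..f s2}\<close> stays inside the region for all
  intermediate parameters; the mean value theorem applies there, and the two remaining strips
  \<open>{e s2..e s1}\<close> and \<open>{f s2..f s1}\<close> give the endpoint terms.\<close>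

lemma moving_integral_has_derivative:
  fixes N D :: "real \<Rightarrow> real \<Rightarrow> real" and e f :: "real \<Rightarrow> real"
  assumes s0: "a < s0" "s0 < b" "e s0 < f s0"
    and anti: "\<And>s s'. a \<le> s \<Longrightarrow> s \<le> s' \<Longrightarrow> s' \<le> b \<Longrightarrow> e s' \<le> e s \<and> f s' \<le> f s"
    and e: "continuous_on {a..b} e" "(e has_real_derivative e') (at s0)"
    and f: "continuous_on {a..b} f" "(f has_real_derivative f') (at s0)"
    and N: "continuous_on {(s, y). s \<in> {a..b} \<and> e s \<le> y \<and> y \<le> f s} (\<lambda>(s, y). N s y)"
    and D: "continuous_on {(s, y). s \<in> {a..b} \<and> e s \<le> y \<and> y \<le> f s} (\<lambda>(s, y). D s y)"
    and deriv: "\<And>s s' y x. a \<le> s \<Longrightarrow> s < s' \<Longrightarrow> s' \<le> b \<Longrightarrow> e s \<le> y \<Longrightarrow> y \<le> f s' \<Longrightarrow> x \<in> {s..s'} \<Longrightarrow>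
       ((\<lambda>x. N x y) has_real_derivative D x y) (at x within {s..s'})"
  shows "((\<lambda>s. integral {e s..f s} (N s)) has_real_derivative
     integral {e s0..f s0} (D s0) + f' * N s0 (f s0) - e' * N s0 (e s0)) (at s0)"
proof -
  define R where "R = {(s, y). s \<in> {a..b} \<and> e s \<le> y \<and> y \<le> f s}"
  define I where "I s = integral {e s..f s} (N s)" for s
  \<comment> \<open>The smaller and the larger of \<open>s\<close> and \<open>s0\<close>: ordering
    the two points treats left and right difference quotients at once. \<open>J\<close> below is the
    claimed derivative with difference quotients in place of \<open>e'\<close> and \<open>f'\<close>
    and with the common interval in place of \<open>{e s0..f s0}\<close>.\<close>
  define mn where "mn s = min s s0" for s
  define mx where "mx s = max s s0" for s
  define De where "De s = (e s - e s0) / (s - s0)" for s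
  define Df where "Df s = (f s - f s0) / (s - s0)" for s
  define J where "J s = integral {e (mn s)..f (mx s)} (D s0) - De s * N s0 (e s0) + Df s * N s0 (f s0)" for s
  have "compact R"
  proof -
    have c1: "closed {x \<in> {a..b} \<times> UNIV. e (fst x) \<le> snd x}"
      by (intro continuous_on_closed_Collect_le continuous_intros continuous_on_compose2[OF e(1)])
         (auto intro!: closed_Times)
    have c2: "closed {x \<in> {a..b} \<times> UNIV. snd x \<le> f (fst x)}"
      by (intro continuous_on_closed_Collect_le continuous_intros continuous_on_compose2[OF f(1)])
         (auto intro!: closed_Times)
    have "R = {x \<in> {a..b} \<times> UNIV. e (fst x) \<le> snd x} \<inter> {x \<in> {a..b} \<times> UNIV. snd x \<le> f (fst x)}"
      by (auto simp: R_def)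
    then have "closed R" using c1 c2 by (simp add: closed_Int)
    moreover have "R \<subseteq> {a..b} \<times> {e b..f a}"
    proof
      fix x assume "x \<in> R"
      then have "fst x \<in> {a..b}" "e (fst x) \<le> snd x" "snd x \<le> f (fst x)" by (auto simp: R_def)
      then show "x \<in> {a..b} \<times> {e b..f a}"
        using anti[of a "fst x"] anti[of "fst x" b] by (cases x) auto
    qed
    ultimately show ?thesis
      by (metis compact_Icc compact_Times compact_Int_closed inf.absorb_iff2)
  qed
  have uN: "uniformly_continuous_on R (\<lambda>(s, y). N s y)" and uD: "uniformly_continuous_on R (\<lambda>(s, y). D s y)"
    using \<open>compact R\<close> N D by (auto intro!: compact_uniformly_continuous simp: R_def)
  have cN: "continuous_on {e s..f s} (N s)" and cD: "continuous_on {e s..f s} (D s)"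
    if "s \<in> {a..b}" for s
  proof -
    have "continuous_on {e s..f s} (\<lambda>y. (\<lambda>(s, y). N s y) (s, y))"
      using that by (intro continuous_on_compose2[OF N]) (auto intro!: continuous_intros)
    then show "continuous_on {e s..f s} (N s)" by simp
    have "continuous_on {e s..f s} (\<lambda>y. (\<lambda>(s, y). D s y) (s, y))"
      using that by (intro continuous_on_compose2[OF D]) (auto intro!: continuous_intros)
    then show "continuous_on {e s..f s} (D s)" by simp
  qed
  have split: "I s' - I s = integral {e s..f s'} (\<lambda>y. N s' y - N s y)
      + integral {e s'..e s} (N s') - integral {f s'..f s} (N s)"
    if "a \<le> s" "s \<le> s'" "s' \<le> b" "e s \<le> f s'" for s s'
  proof -
    have an: "e s' \<le> e s" "f s' \<le> f s" using anti[of s s'] that by auto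
    have c: "N s integrable_on {e s..f s}" "N s' integrable_on {e s'..f s'}"
      using cN that by (auto intro!: integrable_continuous_real)
    have "I s = integral {e s..f s'} (N s) + integral {f s'..f s} (N s)"
      unfolding I_def using an that c by (simp add: Henstock_Kurzweil_Integration.integral_combine)
    moreover have "I s' = integral {e s'..e s} (N s') + integral {e s..f s'} (N s')"
      unfolding I_def using an that c by (simp add: Henstock_Kurzweil_Integration.integral_combine)
    moreover have "integral {e s..f s'} (\<lambda>y. N s' y - N s y) =
        integral {e s..f s'} (N s') - integral {e s..f s'} (N s)"
      by (rule Henstock_Kurzweil_Integration.integral_diff)
        (rule integrable_on_subinterval[OF c(2)] integrable_on_subinterval[OF c(1)]; use an in auto)+
    ultimately show ?thesis by simp
  qed
  have isc: "isCont e s0" "isCont f s0" using e(2) f(2) DERIV_isCont by blast+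
  have mm: "(mn \<longlongrightarrow> s0) (at s0)" "(mx \<longlongrightarrow> s0) (at s0)"
    unfolding mn_def mx_def
    by (rule tendsto_eq_intros | simp)+
  have lim_e: "((\<lambda>s. e (mn s)) \<longlongrightarrow> e s0) (at s0)" and lim_f: "((\<lambda>s. f (mx s)) \<longlongrightarrow> f s0) (at s0)"
    using isCont_tendsto_compose[OF isc(1) mm(1)] isCont_tendsto_compose[OF isc(2) mm(2)] by auto
  have De: "(De \<longlongrightarrow> e') (at s0)" and Df: "(Df \<longlongrightarrow> f') (at s0)"
    using e(2) f(2) unfolding has_field_derivative_iff De_def Df_def by auto
  have near: "\<forall>\<^sub>F s in at s0. a < s \<and> s < b"
    using s0 by (intro eventually_conj order_tendstoD[OF tendsto_ident_at]) auto
  \<comment> \<open>A point strictly between the two ends at \<open>s0\<close>; it keeps the common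
    interval nondegenerate for \<open>s\<close> near \<open>s0\<close>.\<close>
  define m where "m = (e s0 + f s0) / 2"
  have m: "e s0 < m" "m < f s0" using s0 by (auto simp: m_def)
  have near2: "\<forall>\<^sub>F s in at s0. e (mn s) < m \<and> m < f (mx s)"
    using m by (intro eventually_conj order_tendstoD[OF lim_e] order_tendstoD[OF lim_f]) auto
  have J: "(J \<longlongrightarrow> integral {e s0..f s0} (D s0) + f' * N s0 (f s0) - e' * N s0 (e s0)) (at s0)"
  proof -
    have cDs: "continuous_on {e s0..f s0} (D s0)" using cD s0 by auto
    have i: "D s0 integrable_on {e s0..f s0}" using cDs by (rule integrable_continuous_real)
    define G where "G x = integral {e s0..x} (D s0)" for x
    have G: "continuous_on {e s0..f s0} G"
      unfolding G_def using i by (rule indefinite_integral_continuous_1)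
    have an: "\<forall>\<^sub>F s in at s0. e (mn s) \<in> {e s0..f s0} \<and> f (mx s) \<in> {e s0..f s0} \<and> e (mn s) \<le> f (mx s)"
      using near near2
      by eventually_elim (use anti s0 in \<open>auto simp: mn_def mx_def min_def max_def\<close>)
    have "((\<lambda>s. G (f (mx s)) - G (e (mn s))) \<longlongrightarrow> G (f s0) - G (e s0)) (at s0)"
      by (intro tendsto_diff continuous_on_tendsto_compose[OF G lim_f] continuous_on_tendsto_compose[OF G lim_e])
        (use an s0 in \<open>auto elim: eventually_mono\<close>)
    moreover have "\<forall>\<^sub>F s in at s0. G (f (mx s)) - G (e (mn s)) = integral {e (mn s)..f (mx s)} (D s0)"
      using an
    proof eventually_elim
      case (elim s)
      then have "G (e (mn s)) + integral {e (mn s)..f (mx s)} (D s0) = G (f (mx s))"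
        unfolding G_def
        by (intro Henstock_Kurzweil_Integration.integral_combine integrable_on_subinterval[OF i]) auto
      then show ?case by simp
    qed
    moreover have "G (e s0) = 0"
      by (simp add: G_def integral_unique[OF has_integral_null_real] content_real_eq_0)
    ultimately have w: "((\<lambda>s. integral {e (mn s)..f (mx s)} (D s0)) \<longlongrightarrow> integral {e s0..f s0} (D s0)) (at s0)"
      by (auto simp: G_def elim: Lim_transform_eventually)
    have "((\<lambda>s. integral {e (mn s)..f (mx s)} (D s0) - De s * N s0 (e s0) + Df s * N s0 (f s0)) \<longlongrightarrow>
       integral {e s0..f s0} (D s0) - e' * N s0 (e s0) + f' * N s0 (f s0)) (at s0)"
      by (intro tendsto_intros w De Df)
    then show ?thesis unfolding J_def by (simp add: algebra_simps)
  qed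
  \<comment> \<open>Bounds \<open>(f s2 - e s1) - De s - Df s\<close> near \<open>s0\<close>: the
    length is at most \<open>f a - e b\<close>, and each difference quotient is within 1 of its
    limit.\<close>
  define K where "K = f a - e b + \<bar>e'\<bar> + \<bar>f'\<bar> + 2"
  have K: "K > 0" using anti[of a s0] anti[of s0 b] s0 unfolding K_def by auto
  have "((\<lambda>s. (I s - I s0) / (s - s0) - J s) \<longlongrightarrow> 0) (at s0)"
  proof (rule tendstoI)
    fix eps :: real assume "eps > 0"
    define r where "r = eps / (2 * K)"
    have r: "r > 0" using \<open>eps > 0\<close> K by (simp add: r_def)
    obtain d1 where d1: "d1 > 0" "\<And>x x'. x \<in> R \<Longrightarrow> x' \<in> R \<Longrightarrow> dist x' x < d1 \<Longrightarrow>
        dist ((\<lambda>(s, y). N s y) x') ((\<lambda>(s, y). N s y) x) < r"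
      using uN r unfolding uniformly_continuous_on_def by metis
    obtain d2 where d2: "d2 > 0" "\<And>x x'. x \<in> R \<Longrightarrow> x' \<in> R \<Longrightarrow> dist x' x < d2 \<Longrightarrow>
        dist ((\<lambda>(s, y). D s y) x') ((\<lambda>(s, y). D s y) x) < r"
      using uD r unfolding uniformly_continuous_on_def by metis
    have E1: "\<forall>\<^sub>F s in at s0. \<bar>s - s0\<bar> < d2"
      using d2(1) by (auto simp: eventually_at dist_real_def)
    have E2: "\<forall>\<^sub>F s in at s0. \<bar>s - s0\<bar> < d1 / 2"
      using d1(1) by (auto simp: eventually_at dist_real_def intro!: exI[of _ "d1/2"])
    have E3: "\<forall>\<^sub>F s in at s0. \<bar>e s - e s0\<bar> < d1 / 2" "\<forall>\<^sub>F s in at s0. \<bar>f s - f s0\<bar> < d1 / 2"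
      using tendstoD[OF isCont_tendsto_compose[OF isc(1) tendsto_ident_at], of "d1/2"]
        tendstoD[OF isCont_tendsto_compose[OF isc(2) tendsto_ident_at], of "d1/2"] d1(1)
      by (auto simp: dist_real_def)
    have E4: "\<forall>\<^sub>F s in at s0. \<bar>De s - e'\<bar> < 1" "\<forall>\<^sub>F s in at s0. \<bar>Df s - f'\<bar> < 1"
      using tendstoD[OF De, of 1] tendstoD[OF Df, of 1] by (auto simp: dist_real_def)
    have E5: "\<forall>\<^sub>F s in at s0. s \<noteq> s0" by (simp add: eventually_at_filter)
    show "\<forall>\<^sub>F s in at s0. dist ((I s - I s0) / (s - s0) - J s) 0 < eps"
      using near near2 E1 E2 E3 E4 E5
    proof eventually_elim
      case (elim s)
      define s1 where "s1 = mn s"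
      define s2 where "s2 = mx s"
      have o: "a < s1" "s1 \<le> s0" "s0 \<le> s2" "s2 < b" "s1 < s2" "s1 \<le> s2" "a \<le> s1" "s2 \<le> b" and sd: "s2 - s1 = \<bar>s - s0\<bar>"
        using elim s0 by (auto simp: s1_def s2_def mn_def mx_def)
      have ef: "e s1 \<le> f s2" using elim by (auto simp: s1_def s2_def)
      have an: "e s2 \<le> e s0" "e s0 \<le> e s1" "f s2 \<le> f s0" "f s0 \<le> f s1"
        "e b \<le> e s2" "e s1 \<le> e a" "f s1 \<le> f a" "e s2 \<le> e s1" "f s2 \<le> f s1"
        using anti[of s0 s2] anti[of s1 s0] anti[of s2 b] anti[of a s1] anti[of s1 s2] o by auto
      have quot: "(I s - I s0) / (s - s0) = (I s2 - I s1) / (s2 - s1)"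
        by (auto simp: s1_def s2_def mn_def mx_def min_def max_def) (metis minus_diff_eq minus_divide_divide)
      have De: "De s = - ((e s1 - e s2) / (s2 - s1))"
        and Df: "Df s = - ((f s1 - f s2) / (s2 - s1))"
        unfolding De_def Df_def s1_def s2_def mn_def mx_def min_def max_def using elim
        by (auto simp: field_simps)
      have A: "\<bar>integral {e s1..f s2} (\<lambda>y. N s2 y - N s1 y) - (s2 - s1) * integral {e s1..f s2} (D s0)\<bar>
         \<le> (r * (s2 - s1)) * (f s2 - e s1)"
      proof -
        have sub1: "continuous_on {e s1..f s2} (N s1)" using cN[of s1] o an by (auto intro: continuous_on_subset)
        have sub2: "continuous_on {e s1..f s2} (N s2)" using cN[of s2] o an by (auto intro: continuous_on_subset)
        have sub3: "continuous_on {e s1..f s2} (D s0)" using cD[of s0] o an s0 by (auto intro: continuous_on_subset)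
        have "integral {e s1..f s2} (\<lambda>y. N s2 y - N s1 y) - (s2 - s1) * integral {e s1..f s2} (D s0) =
           integral {e s1..f s2} (\<lambda>y. (N s2 y - N s1 y) - (s2 - s1) * D s0 y)"
          using sub1 sub2 sub3
          by (subst Henstock_Kurzweil_Integration.integral_diff)
             (auto intro!: integrable_continuous_real continuous_intros)
        also have "norm \<dots> \<le> (r * (s2 - s1)) * (f s2 - e s1)"
        proof (rule integral_bound[OF ef])
          show "continuous_on {e s1..f s2} (\<lambda>y. (N s2 y - N s1 y) - (s2 - s1) * D s0 y)"
            by (intro continuous_intros sub1 sub2 sub3)
          fix y assume y: "y \<in> {e s1..f s2}"
          have "\<exists>x\<in>{s1<..<s2}. N s2 y - N s1 y = (s2 - s1) * D x y"
          proof -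
            have "\<exists>x\<in>{s1<..<s2}. N s2 y - N s1 y = (\<lambda>h. D x y * h) (s2 - s1)"
              using deriv[of s1 s2 y] y o
              by (intro mvt_simple) (auto simp: has_field_derivative_def)
            then show ?thesis by (auto simp: mult.commute)
          qed
          then obtain x where x: "s1 < x" "x < s2" "N s2 y - N s1 y = (s2 - s1) * D x y" by auto
          have "(x, y) \<in> R" "(s0, y) \<in> R"
            unfolding R_def using x y o an s0 anti[of s1 x] anti[of x s2] by auto
          moreover have "dist (x, y) (s0, y) < d2"
            using x sd elim o by (auto simp: dist_prod_def dist_real_def)
          ultimately have "\<bar>D x y - D s0 y\<bar> < r" using d2(2)[of "(s0,y)" "(x,y)"] by (simp add: dist_real_def)
          then have "\<bar>(s2 - s1) * (D x y - D s0 y)\<bar> \<le> (s2 - s1) * r"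
            using o by (simp add: abs_mult)
          then show "norm ((N s2 y - N s1 y) - (s2 - s1) * D s0 y) \<le> r * (s2 - s1)"
            unfolding x(3) by (simp add: algebra_simps)
        qed
        finally show ?thesis by simp
      qed
      have near_pt: "\<bar>N x y - N s0 y0\<bar> \<le> r" if "(x, y) \<in> R" "(s0, y0) \<in> R" "\<bar>x - s0\<bar> < d1/2" "\<bar>y - y0\<bar> < d1/2" for x y y0
      proof -
        have "dist (x, y) (s0, y0) \<le> \<bar>x - s0\<bar> + \<bar>y - y0\<bar>"
          unfolding dist_prod_def using sqrt_sum_squares_le_sum_abs by (auto simp: dist_real_def)
        then show ?thesis using that d1(2)[of "(s0,y0)" "(x,y)"] by (simp add: dist_real_def)
      qed
      have xs: "\<bar>s1 - s0\<bar> < d1/2" "\<bar>s2 - s0\<bar> < d1/2" "\<bar>e s1 - e s0\<bar> < d1/2" "\<bar>e s2 - e s0\<bar> < d1/2"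
        "\<bar>f s1 - f s0\<bar> < d1/2" "\<bar>f s2 - f s0\<bar> < d1/2"
        using elim d1(1) by (auto simp: s1_def s2_def mn_def mx_def min_def max_def)
      have B: "\<bar>integral {e s2..e s1} (N s2) - (e s1 - e s2) * N s0 (e s0)\<bar> \<le> r * (e s1 - e s2)"
      proof (rule integral_near_constant)
        show "continuous_on {e s2..e s1} (N s2)"
          using cN[of s2] o an ef by (auto intro: continuous_on_subset)
        fix y assume "y \<in> {e s2..e s1}"
        then show "\<bar>N s2 y - N s0 (e s0)\<bar> \<le> r"
          using o an xs ef s0 by (intro near_pt) (auto simp: R_def abs_if)
      qed (use an in auto)
      have C: "\<bar>integral {f s2..f s1} (N s1) - (f s1 - f s2) * N s0 (f s0)\<bar> \<le> r * (f s1 - f s2)"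
      proof (rule integral_near_constant)
        show "continuous_on {f s2..f s1} (N s1)"
          using cN[of s1] o an ef by (auto intro: continuous_on_subset)
        fix y assume "y \<in> {f s2..f s1}"
        then show "\<bar>N s1 y - N s0 (f s0)\<bar> \<le> r"
          using o an xs ef s0 by (intro near_pt) (auto simp: R_def abs_if)
      qed (use an in auto)
      let ?h = "s2 - s1"
      have hp: "?h > 0" using o by simp
      have hDe: "?h * De s = - (e s1 - e s2)" and hDf: "?h * Df s = - (f s1 - f s2)"
        unfolding De Df using hp by (simp_all add: field_simps)
      have "\<bar>(I s2 - I s1) - ?h * J s\<bar> \<le> r * (?h * (f s2 - e s1) + (e s1 - e s2) + (f s1 - f s2))"
      proof -
        have "?h * J s = ?h * integral {e s1..f s2} (D s0) + (e s1 - e s2) * N s0 (e s0) - (f s1 - f s2) * N s0 (f s0)"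
        proof -
          have "?h * J s = ?h * integral {e s1..f s2} (D s0) - (?h * De s) * N s0 (e s0) + (?h * Df s) * N s0 (f s0)"
            unfolding J_def s1_def[symmetric] s2_def[symmetric] by (simp only: ring_distribs mult.assoc)
          then show ?thesis unfolding hDe hDf by (simp add: algebra_simps)
        qed
        then show ?thesis using A B C split[OF o(7,6,8) ef] by (simp add: algebra_simps abs_le_iff)
      qed
      also have "\<dots> = r * ?h * ((f s2 - e s1) - De s - Df s)"
      proof -
        have "?h * ((f s2 - e s1) - De s - Df s) = ?h * (f s2 - e s1) - ?h * De s - ?h * Df s"
          by (simp only: right_diff_distrib)
        then show ?thesis unfolding hDe hDf by (simp add: mult.assoc)
      qed
      also have "\<dots> \<le> r * ?h * K"
        using r hp elim an by (intro mult_left_mono) (auto simp: K_def)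
      finally have "\<bar>(I s2 - I s1) - ?h * J s\<bar> \<le> r * ?h * K" .
      then have "\<bar>(I s2 - I s1) / ?h - J s\<bar> \<le> r * K"
      proof -
        have "(I s2 - I s1) / ?h - J s = ((I s2 - I s1) - ?h * J s) / ?h" using hp by (simp add: field_simps)
        moreover assume "\<bar>(I s2 - I s1) - ?h * J s\<bar> \<le> r * ?h * K"
        ultimately show ?thesis using hp by (simp add: abs_divide field_simps)
      qed
      moreover have "r * K < eps" using K \<open>eps > 0\<close> by (simp add: r_def)
      ultimately show ?case unfolding quot by (simp add: dist_real_def)
    qed
  qed
  from tendsto_add[OF this J] show ?thesis
    unfolding has_field_derivative_iff I_def[symmetric] by simp
qed

text \<open>By the fundamental theorem of calculus with finitely many exceptional points,
  \<open>I\<close> is up to a constant the integral of the continuous \<open>g\<close>, so the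
  formula extends to the exceptional points and to the ends. It carries the derivative across the
  kink of the moving bounds at \<open>X s = 0\<close>.\<close>

lemma has_real_derivative_within_closed:
  fixes I g :: "real \<Rightarrow> real"
  assumes "finite S" "a < b" "continuous_on {a..b} I" "continuous_on {a..b} g"
    and d: "\<And>s. s \<in> {a<..<b} - S \<Longrightarrow> (I has_real_derivative g s) (at s)"
    and s: "s \<in> {a..b}"
  shows "(I has_real_derivative g s) (at s within {a..b})"
proof -
  have eq: "I x = I a + integral {a..x} g" if "x \<in> {a..b}" for x
  proof -
    have "(g has_integral (I x - I a)) {a..x}"
      using that assms(1,3) d
      by (intro fundamental_theorem_of_calculus_interior_strong[of S])
         (auto simp: has_real_derivative_iff_has_vector_derivative[symmetric] intro: continuous_on_subset)
    then show ?thesis by (simp add: integral_unique)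
  qed
  have "((\<lambda>x. I a + integral {a..x} g) has_real_derivative (0 + g s)) (at s within {a..b})"
    by (intro derivative_intros integral_has_real_derivative assms)
  moreover have "I a + integral {a..x} g = I x" if "x \<in> {a..b}" "dist x s < 1" for x
    by (rule eq[symmetric, OF that(1)])
  ultimately have "(I has_real_derivative 0 + g s) (at s within {a..b})"
    by (rule has_field_derivative_transform_within[OF _ zero_less_one s])
  then show ?thesis by simp
qed

section \<open>Weak derivatives and square integrable states\<close>

lemma integral_zero_on:
  fixes f :: "real \<Rightarrow> real"
  assumes "\<And>x. x \<in> S \<Longrightarrow> f x = 0"
  shows "integral S f = 0"
  using assms by (metis has_integral_is_0 integral_unique)

lemma absolutely_integrable_imp_abs_integrable:
  fixes f :: "real \<Rightarrow> real"
  assumes "f absolutely_integrable_on S"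
  shows "(\<lambda>x. \<bar>f x\<bar>) integrable_on S"
  using assms by (simp add: absolutely_integrable_on_def)

lemma weak_derivative_imp_derivative:
  fixes m n :: "real \<Rightarrow> real"
  assumes m: "continuous_on {0<..} m" and n: "continuous_on {0<..} n"
    and weak: "\<And>k k' a b. 0 < a \<Longrightarrow> a < b \<Longrightarrow> (\<And>t. (k has_real_derivative k' t) (at t)) \<Longrightarrow>
       continuous_on UNIV k' \<Longrightarrow> (\<And>t. t \<notin> {a..b} \<Longrightarrow> k t = 0) \<Longrightarrow>
       integral {a..b} (\<lambda>t. k' t * m t + k t * n t) = 0"
    and t: "0 < t"
  shows "(m has_real_derivative n t) (at t)"
proof -
  define a where "a = t / 2"
  define b where "b = 2 * t"
  have ab: "0 < a" "a < t" "t < b" "a < b" "a \<le> b" using t by (auto simp: a_def b_def)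
  have cm: "continuous_on {a..b} m" and cn: "continuous_on {a..b} n"
    using ab by (auto intro!: continuous_on_subset[OF m] continuous_on_subset[OF n])
  define N where "N x = integral {a..x} n" for x
  have N': "(N has_real_derivative n x) (at x within {a..b})" if "x \<in> {a..b}" for x
    unfolding N_def by (rule integral_has_real_derivative[OF cn that])
  have cN: "continuous_on {a..b} N"
    using N' by (rule DERIV_continuous_on)
  \<comment> \<open>It suffices to show that \<open>g = m - \<integral> n\<close> is constant. If \<open>c\<close> is its mean with respect to the weight \<open>w\<close>,
    then \<open>w * (g - c)\<close> has mean zero, hence is the derivative of an admissible test function, and
    testing with it gives \<open>\<integral> w * (g - c)\<^sup>2 = 0\<close>.\<close>
  define w where "w x = max 0 ((x - a) * (b - x))" for x
  have cw: "continuous_on S w" for S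
    unfolding w_def by (intro continuous_intros)
  have w0: "w x = 0" if "x \<notin> {a<..<b}" for x
    using that ab unfolding w_def by (auto simp: max_def mult_le_0_iff zero_le_mult_iff not_less)
  have wpos: "w x > 0" if "x \<in> {a<..<b}" for x
    using that unfolding w_def by simp
  have wnn: "w x \<ge> 0" for x by (simp add: w_def)
  \<comment> \<open>Clamping makes \<open>g\<close> continuous on the whole line, as
    \<open>kap\<close> must be for its antiderivative \<open>k\<close> to be a test function;
    outside \<open>{a..b}\<close> the weight \<open>w\<close> removes the clamped values.\<close>
  define g where "g x = m (max a (min b x)) - N (max a (min b x))" for x
  have cg: "continuous_on S g" for S
    unfolding g_def using ab
    by (intro continuous_intros continuous_on_compose2[OF cm] continuous_on_compose2[OF cN]) auto
  have g: "g x = m x - N x" if "x \<in> {a..b}" for x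
    using that by (simp add: g_def)
  define W where "W = integral {a..b} w"
  have W: "W \<noteq> 0"
  proof
    assume "W = 0"
    then have "w t = 0"
      using integral_eq_0_iff[of a b w] ab cw wnn by (auto simp: W_def)
    with wpos[of t] ab show False by simp
  qed
  define c where "c = integral {a..b} (\<lambda>x. w x * g x) / W"
  define kap where "kap x = w x * (g x - c)" for x
  have ck: "continuous_on S kap" for S
    unfolding kap_def by (intro continuous_intros cw cg)
  have k0: "kap x = 0" if "x \<notin> {a<..<b}" for x using w0[OF that] by (simp add: kap_def)
  have int_k: "integral {a..b} kap = 0"
  proof -
    have "integral {a..b} kap = integral {a..b} (\<lambda>x. w x * g x - w x * c)"
      by (simp add: kap_def[abs_def] algebra_simps)
    also have "\<dots> = integral {a..b} (\<lambda>x. w x * g x) - integral {a..b} (\<lambda>x. w x * c)"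
      by (intro Henstock_Kurzweil_Integration.integral_diff integrable_continuous_real continuous_intros cw cg)
    also have "\<dots> = 0" using W by (simp add: c_def W_def)
    finally show ?thesis .
  qed
  define k where "k x = integral {a - 1..x} kap" for x
  have kz1: "k x = 0" if "x \<le> a" for x
    unfolding k_def using that k0 by (intro integral_zero_on) auto
  have kz2: "k x = 0" if "x \<ge> b" for x
  proof -
    have "integral {a - 1..x} kap = integral {a - 1..a} kap + (integral {a..b} kap + integral {b..x} kap)"
      using that ab by (simp add: Henstock_Kurzweil_Integration.integral_combine integrable_continuous_real ck)
    moreover have "integral {a - 1..a} kap = 0" "integral {b..x} kap = 0"
      using k0 by (intro integral_zero_on; auto)+
    ultimately show ?thesis using int_k by (simp add: k_def)
  qed
  have k': "(k has_real_derivative kap x) (at x)" for x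
  proof (cases "x < a")
    case True
    have "((\<lambda>_. 0) has_real_derivative 0) (at x)" by simp
    then have "(k has_real_derivative 0) (at x)"
      using True kz1
      by (rule_tac has_field_derivative_transform_within_open[of _ _ _ "{..<a}"]) auto
    then show ?thesis using k0[of x] True by simp
  next
    case False
    have "(k has_real_derivative kap x) (at x within {a - 1..x + 1})"
      unfolding k_def using False by (intro integral_has_real_derivative ck) auto
    then show ?thesis using False by (subst (asm) at_within_Icc_at) auto
  qed
  have i1: "integral {a..b} (\<lambda>t. kap t * m t + k t * n t) = 0"
    using ab kz1 kz2 by (intro weak k' ck) auto
  have ckk: "continuous_on {a..b} k"
    using k' by (meson DERIV_continuous_on has_field_derivative_at_within)
  have "((\<lambda>t. kap t * N t + k t * n t) has_integral (k b * N b - k a * N a)) {a..b}"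
    using ab
    by (intro fundamental_theorem_of_calculus)
       (auto simp: has_real_derivative_iff_has_vector_derivative[symmetric]
          intro!: derivative_eq_intros has_field_derivative_at_within[OF k'] N')
  then have i2: "integral {a..b} (\<lambda>t. kap t * N t + k t * n t) = 0"
    using kz1[of a] kz2[of b] by (simp add: integral_unique)
  have "integral {a..b} (\<lambda>t. kap t * m t + k t * n t) - integral {a..b} (\<lambda>t. kap t * N t + k t * n t)
     = integral {a..b} (\<lambda>t. (kap t * m t + k t * n t) - (kap t * N t + k t * n t))"
    by (intro Henstock_Kurzweil_Integration.integral_diff[symmetric] integrable_continuous_real
       continuous_intros ck ckk cm cn cN)
  also have "\<dots> = integral {a..b} (\<lambda>t. kap t * g t)"
    by (rule integral_cong) (simp add: g algebra_simps)
  finally have i3: "integral {a..b} (\<lambda>t. kap t * g t) = 0" using i1 i2 by simp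
  have "integral {a..b} (\<lambda>t. w t * (g t - c)\<^sup>2) = integral {a..b} (\<lambda>t. kap t * g t - kap t * c)"
    by (rule integral_cong) (simp add: kap_def power2_eq_square algebra_simps)
  also have "\<dots> = integral {a..b} (\<lambda>t. kap t * g t) - integral {a..b} (\<lambda>t. kap t * c)"
    by (intro Henstock_Kurzweil_Integration.integral_diff integrable_continuous_real continuous_intros ck cg)
  also have "\<dots> = 0" using i3 int_k by simp
  finally have "\<forall>x\<in>{a..b}. w x * (g x - c)\<^sup>2 = 0"
    using ab wnn by (subst (asm) integral_eq_0_iff) (auto intro!: continuous_intros cw cg)
  then have gc: "g x = c" if "x \<in> {a<..<b}" for x
    using wpos[OF that] that by force
  have "((\<lambda>x. c + N x) has_real_derivative (0 + n t)) (at t)"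
    using N'[of t] ab by (intro derivative_intros) (simp add: at_within_Icc_at)
  then have "(m has_real_derivative (0 + n t)) (at t)"
  proof (rule has_field_derivative_transform_within_open[of _ _ _ "{a<..<b}"])
    fix x assume x: "x \<in> {a<..<b}"
    then show "c + N x = m x" using gc[OF x] g[of x] by auto
  qed (use ab in auto)
  then show ?thesis by simp
qed

section \<open>Square integrable states: integrability, comparison with the L1 norm, continuity of
  pairings in time\<close>

lemma L2_on_I_absolutely_integrable:
  assumes "L2_on_I f"
  shows "f absolutely_integrable_on {-1..1}"
proof (rule measurable_bounded_by_integrable_imp_absolutely_integrable)
  show "f \<in> borel_measurable (lebesgue_on {-1..1})"
    using assms by (simp add: L2_on_I_def measurable_on_iff_borel_measurable)
  show "(\<lambda>x. 1 + (f x)\<^sup>2) integrable_on {-1..1}"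
    using assms by (intro integrable_add) (auto simp: L2_on_I_def)
  show "norm (f x) \<le> 1 + (f x)\<^sup>2" for x
  proof -
    have "0 \<le> (\<bar>f x\<bar> - 1)\<^sup>2" by simp
    then have "2 * \<bar>f x\<bar> \<le> 1 + (f x)\<^sup>2" by (simp add: power2_diff)
    then show ?thesis by simp
  qed
qed auto

lemma L2_on_I_diff:
  assumes f: "L2_on_I f" and g: "L2_on_I g"
  shows "L2_on_I (\<lambda>x. f x - g x)"
proof -
  have mf: "f \<in> borel_measurable (lebesgue_on {-1..1})" "g \<in> borel_measurable (lebesgue_on {-1..1})"
    using assms by (auto simp: L2_on_I_def measurable_on_iff_borel_measurable)
  have "(\<lambda>x. (f x - g x)\<^sup>2) absolutely_integrable_on {-1..1}"
  proof (rule measurable_bounded_by_integrable_imp_absolutely_integrable)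
    show "(\<lambda>x. (f x - g x)\<^sup>2) \<in> borel_measurable (lebesgue_on {-1..1})"
      using mf by measurable
    show "(\<lambda>x. 2 * (f x)\<^sup>2 + 2 * (g x)\<^sup>2) integrable_on {-1..1}"
      using assms by (intro integrable_add integrable_on_cmult_left) (auto simp: L2_on_I_def)
    show "norm ((f x - g x)\<^sup>2) \<le> 2 * (f x)\<^sup>2 + 2 * (g x)\<^sup>2" for x
      using zero_le_power2[of "f x + g x"] by (simp only: real_norm_def abs_power2) (simp add: power2_diff power2_sum)
  qed auto
  moreover have "(\<lambda>x. f x - g x) measurable_on {-1..1}"
    using mf by (simp add: measurable_on_iff_borel_measurable)
  ultimately show ?thesis
    by (simp add: L2_on_I_def set_lebesgue_integral_eq_integral(1))
qed

text \<open>Young's inequality \<open>\<bar>x\<bar> \<le> r / 2 + x^2 / (2 * r)\<close>, integrated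
  over an interval of length 2. The free parameter \<open>r\<close> lets small L2 norms imply small
  L1 norms without square roots.\<close>

lemma L1_le_L2_on_I:
  assumes f: "L2_on_I f" and "r > 0"
  shows "integral {-1..1} (\<lambda>x. \<bar>f x\<bar>) \<le> r + integral {-1..1} (\<lambda>x. (f x)\<^sup>2) / (2 * r)"
proof -
  have f2: "(\<lambda>x. (f x)\<^sup>2) integrable_on {-1..1}" using f by (simp add: L2_on_I_def)
  have "integral {-1..1} (\<lambda>x. \<bar>f x\<bar>) \<le> integral {-1..1} (\<lambda>x. r / 2 + (f x)\<^sup>2 / (2 * r))"
  proof (rule integral_le)
    show "(\<lambda>x. \<bar>f x\<bar>) integrable_on {-1..1}"
      by (intro absolutely_integrable_imp_abs_integrable L2_on_I_absolutely_integrable f)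
    show "(\<lambda>x. r / 2 + (f x)\<^sup>2 / (2 * r)) integrable_on {-1..1}"
      using f2 by (intro integrable_add integrable_on_divide) auto
    show "\<bar>f x\<bar> \<le> r / 2 + (f x)\<^sup>2 / (2 * r)" for x
    proof -
      have "0 \<le> (\<bar>f x\<bar> - r)\<^sup>2 / (2 * r)" using \<open>r > 0\<close> by simp
      also have "\<dots> = r / 2 + (f x)\<^sup>2 / (2 * r) - \<bar>f x\<bar>"
        using \<open>r > 0\<close> by (simp add: power2_eq_square field_simps)
      finally show ?thesis by simp
    qed
  qed
  also have "\<dots> = r + integral {-1..1} (\<lambda>x. (f x)\<^sup>2) / (2 * r)"
    using f2 by (subst Henstock_Kurzweil_Integration.integral_add) (auto intro!: integrable_on_divide)
  finally show ?thesis .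
qed

lemma L1_tendsto_of_L2:
  fixes u :: "real \<Rightarrow> real \<Rightarrow> real"
  assumes u: "\<And>s. s \<ge> 0 \<Longrightarrow> L2_on_I (\<lambda>w. u w s)" and t: "t \<ge> 0"
    and lim: "((\<lambda>s. integral {-1..1} (\<lambda>w. (u w s - u w t)\<^sup>2)) \<longlongrightarrow> 0) (at t within {0..})"
  shows "((\<lambda>s. integral {-1..1} (\<lambda>w. \<bar>u w s - u w t\<bar>)) \<longlongrightarrow> 0) (at t within {0..})"
proof (rule tendstoI)
  fix e :: real assume e: "e > 0"
  have ev: "\<forall>\<^sub>F s in at t within {0..}. s \<ge> 0" by (simp add: eventually_at_filter)
  \<comment> \<open>With this threshold the second term of the L1 estimate, taken with
    \<open>r = e / 2\<close>, stays below \<open>e / 2\<close>.\<close>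
  have "\<forall>\<^sub>F s in at t within {0..}. integral {-1..1} (\<lambda>w. (u w s - u w t)\<^sup>2) < e\<^sup>2 / 2"
    using e by (intro order_tendstoD[OF lim]) auto
  with ev show "\<forall>\<^sub>F s in at t within {0..}. dist (integral {-1..1} (\<lambda>w. \<bar>u w s - u w t\<bar>)) 0 < e"
  proof eventually_elim
    case (elim s)
    let ?I = "integral {-1..1} (\<lambda>w. (u w s - u w t)\<^sup>2)"
    have d: "L2_on_I (\<lambda>w. u w s - u w t)" using u t elim by (intro L2_on_I_diff) auto
    have "integral {-1..1} (\<lambda>w. \<bar>u w s - u w t\<bar>) \<le> e / 2 + ?I / (2 * (e / 2))"
      using e by (intro L1_le_L2_on_I d) auto
    also have "?I / (2 * (e / 2)) < e / 2" using elim e by (simp add: field_simps power2_eq_square)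
    finally have "integral {-1..1} (\<lambda>w. \<bar>u w s - u w t\<bar>) < e" by simp
    moreover have "integral {-1..1} (\<lambda>w. \<bar>u w s - u w t\<bar>) \<ge> 0"
      by (rule Henstock_Kurzweil_Integration.integral_nonneg)
        (auto intro!: absolutely_integrable_imp_abs_integrable L2_on_I_absolutely_integrable d)
    ultimately show ?case by (simp add: dist_real_def)
  qed
qed

lemma absolutely_integrable_mult_continuous:
  fixes f g :: "real \<Rightarrow> real"
  assumes "f absolutely_integrable_on {a..b}" "continuous_on {a..b} g"
  shows "(\<lambda>x. f x * g x) absolutely_integrable_on {a..b}"
proof -
  have "(\<lambda>x. g x * f x) absolutely_integrable_on {a..b}"
    using assms
    by (intro absolutely_integrable_bounded_measurable_product_real continuous_imp_measurable_on_sets_lebesgue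
         compact_imp_bounded compact_continuous_image) auto
  then show ?thesis by (simp add: mult.commute)
qed

lemma integrable_mult_continuous:
  fixes f g :: "real \<Rightarrow> real"
  assumes "f absolutely_integrable_on {a..b}" "continuous_on {a..b} g"
  shows "(\<lambda>x. f x * g x) integrable_on {a..b}"
  using absolutely_integrable_mult_continuous[OF assms] by (simp add: set_lebesgue_integral_eq_integral(1))

lemma abs_integral_mult_le:
  fixes f g :: "real \<Rightarrow> real"
  assumes f: "f absolutely_integrable_on {a..b}" and g: "continuous_on {a..b} g"
    and r: "\<And>x. x \<in> {a..b} \<Longrightarrow> \<bar>g x\<bar> \<le> r"
  shows "\<bar>integral {a..b} (\<lambda>x. f x * g x)\<bar> \<le> r * integral {a..b} (\<lambda>x. \<bar>f x\<bar>)"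
proof -
  have "norm (integral {a..b} (\<lambda>x. f x * g x)) \<le> integral {a..b} (\<lambda>x. r * \<bar>f x\<bar>)"
  proof (rule integral_norm_bound_integral)
    show "(\<lambda>x. r * \<bar>f x\<bar>) integrable_on {a..b}"
      by (intro integrable_on_mult_right absolutely_integrable_imp_abs_integrable f)
    show "norm (f x * g x) \<le> r * \<bar>f x\<bar>" if "x \<in> {a..b}" for x
      using mult_left_mono[OF r[OF that], of "\<bar>f x\<bar>"] by (simp add: abs_mult mult.commute)
  qed (rule integrable_mult_continuous[OF f g])
  then show ?thesis by simp
qed

lemma continuous_on_pairing:
  fixes u :: "real \<Rightarrow> real \<Rightarrow> real"
  assumes u: "\<And>s. s \<ge> 0 \<Longrightarrow> L2_on_I (\<lambda>w. u w s)"
    and lim: "\<And>t. t \<ge> 0 \<Longrightarrow> ((\<lambda>s. integral {-1..1} (\<lambda>w. (u w s - u w t)\<^sup>2)) \<longlongrightarrow> 0) (at t within {0..})"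
    and g: "continuous_on {-1..1} g"
  shows "continuous_on {0..} (\<lambda>t. integral {-1..1} (\<lambda>w. u w t * g w))"
  unfolding continuous_on_def
proof
  fix t :: real assume t: "t \<in> {0..}"
  obtain r where r: "\<And>x. x \<in> {-1..1} \<Longrightarrow> \<bar>g x\<bar> \<le> r"
    using continuous_on_Icc_bounded[OF g] by blast
  have "((\<lambda>s. integral {-1..1} (\<lambda>w. u w s * g w) - integral {-1..1} (\<lambda>w. u w t * g w)) \<longlongrightarrow> 0) (at t within {0..})"
  proof (rule Lim_null_comparison)
    show "\<forall>\<^sub>F s in at t within {0..}. norm (integral {-1..1} (\<lambda>w. u w s * g w) - integral {-1..1} (\<lambda>w. u w t * g w))
       \<le> r * integral {-1..1} (\<lambda>w. \<bar>u w s - u w t\<bar>)"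
    proof -
      have "norm (integral {-1..1} (\<lambda>w. u w s * g w) - integral {-1..1} (\<lambda>w. u w t * g w))
       \<le> r * integral {-1..1} (\<lambda>w. \<bar>u w s - u w t\<bar>)" if "s \<ge> 0" for s
      proof -
        have "integral {-1..1} (\<lambda>w. u w s * g w) - integral {-1..1} (\<lambda>w. u w t * g w) =
          integral {-1..1} (\<lambda>w. u w s * g w - u w t * g w)"
          using t that by (intro Henstock_Kurzweil_Integration.integral_diff[symmetric]
            integrable_mult_continuous L2_on_I_absolutely_integrable u g) auto
        also have "\<dots> = integral {-1..1} (\<lambda>w. (u w s - u w t) * g w)" by (simp add: algebra_simps)
        finally show ?thesis
          using abs_integral_mult_le[OF L2_on_I_absolutely_integrable[OF L2_on_I_diff[OF u u]] g r] t that
          by simp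
      qed
      then show ?thesis by (simp add: eventually_at_filter)
    qed
    show "((\<lambda>s. r * integral {-1..1} (\<lambda>w. \<bar>u w s - u w t\<bar>)) \<longlongrightarrow> 0) (at t within {0..})"
      using t by (intro tendsto_mult_right_zero L1_tendsto_of_L2 u lim) auto
  qed
  then show "((\<lambda>s. integral {-1..1} (\<lambda>w. u w s * g w)) \<longlongrightarrow> integral {-1..1} (\<lambda>w. u w t * g w)) (at t within {0..})"
    by (simp add: LIM_zero_iff)
qed

text \<open>Convergence in L1 gives a bound valid for all times near \<open>t\<close>; it is used
  when pairings are estimated at moving times.\<close>

lemma L1_eventually_bounded:
  fixes u :: "real \<Rightarrow> real \<Rightarrow> real"
  assumes u: "\<And>s. s \<ge> 0 \<Longrightarrow> L2_on_I (\<lambda>w. u w s)" and t: "t \<ge> 0"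
    and lim: "((\<lambda>s. integral {-1..1} (\<lambda>w. (u w s - u w t)\<^sup>2)) \<longlongrightarrow> 0) (at t within {0..})"
  shows "\<forall>\<^sub>F s in at t within {0..}. integral {-1..1} (\<lambda>w. \<bar>u w s\<bar>) \<le> integral {-1..1} (\<lambda>w. \<bar>u w t\<bar>) + 1"
proof -
  have ev: "\<forall>\<^sub>F s in at t within {0..}. s \<ge> 0" by (simp add: eventually_at_filter)
  have "\<forall>\<^sub>F s in at t within {0..}. integral {-1..1} (\<lambda>w. \<bar>u w s - u w t\<bar>) < 1"
    by (intro order_tendstoD[OF L1_tendsto_of_L2[OF u t lim]]) auto
  with ev show ?thesis
  proof eventually_elim
    case (elim s)
    have a: "(\<lambda>w. \<bar>u w s\<bar>) integrable_on {-1..1}" "(\<lambda>w. \<bar>u w t\<bar>) integrable_on {-1..1}"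
       "(\<lambda>w. \<bar>u w s - u w t\<bar>) integrable_on {-1..1}"
      using elim t
      by (auto intro!: absolutely_integrable_imp_abs_integrable L2_on_I_absolutely_integrable L2_on_I_diff u)
    have "integral {-1..1} (\<lambda>w. \<bar>u w s\<bar>) \<le> integral {-1..1} (\<lambda>w. \<bar>u w s - u w t\<bar> + \<bar>u w t\<bar>)"
      using a by (intro integral_le integrable_add) auto
    also have "\<dots> = integral {-1..1} (\<lambda>w. \<bar>u w s - u w t\<bar>) + integral {-1..1} (\<lambda>w. \<bar>u w t\<bar>)"
      using a by (intro Henstock_Kurzweil_Integration.integral_add)
    finally show ?case using elim by simp
  qed
qed

section \<open>The adjoint kernel transform along characteristics\<close>

text \<open>Adjoint of the Volterra part of the transformation:
  \<open>\<integral> (\<integral> f z * K z w, z = -w..w) * h w = \<integral> f z * ktrans K h z\<close>,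
  the minus sign coming from the orientation of the inner integral for \<open>w < 0\<close>.\<close>

definition ktrans :: "(real \<Rightarrow> real \<Rightarrow> real) \<Rightarrow> (real \<Rightarrow> real) \<Rightarrow> real \<Rightarrow> real" where
  "ktrans K h z = integral {\<bar>z\<bar>..1} (\<lambda>w. K z w * h w) - integral {-1..-\<bar>z\<bar>} (\<lambda>w. K z w * h w)"

lemma kernE_iff: "(z, w) \<in> kernE \<longleftrightarrow> \<bar>z\<bar> \<le> \<bar>w\<bar> \<and> \<bar>w\<bar> \<le> 1"
  by (auto simp: kernE_def)

lemma kernel_section_continuous:
  fixes K :: "real \<Rightarrow> real \<Rightarrow> real"
  assumes "continuous_on kernE (\<lambda>(z, w). K z w)" "S \<subseteq> {w. \<bar>z\<bar> \<le> \<bar>w\<bar> \<and> \<bar>w\<bar> \<le> 1}"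
  shows "continuous_on S (K z)"
proof -
  have "continuous_on S (\<lambda>w. (\<lambda>(z, w). K z w) (z, w))"
    using assms(2) by (intro continuous_on_compose2[OF assms(1)]) (auto simp: kernE_iff intro!: continuous_intros)
  then show ?thesis by simp
qed

lemma ktrans_integrable:
  fixes K :: "real \<Rightarrow> real \<Rightarrow> real" and h :: "real \<Rightarrow> real"
  assumes "continuous_on kernE (\<lambda>(z, w). K z w)" "continuous_on {-1..1} h"
  shows "(\<lambda>w. K z w * h w) integrable_on {\<bar>z\<bar>..1}" "(\<lambda>w. K z w * h w) integrable_on {-1..-\<bar>z\<bar>}"
proof -
  show "(\<lambda>w. K z w * h w) integrable_on {\<bar>z\<bar>..1}"
    by (intro integrable_continuous_real continuous_intros kernel_section_continuous[OF assms(1)]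
        continuous_on_subset[OF assms(2)]) auto
  show "(\<lambda>w. K z w * h w) integrable_on {-1..-\<bar>z\<bar>}"
    by (intro integrable_continuous_real continuous_intros kernel_section_continuous[OF assms(1)]
        continuous_on_subset[OF assms(2)]) auto
qed

lemma ktrans_continuous:
  assumes K: "continuous_on kernE (\<lambda>(z, w). K z w)" and h: "continuous_on {-1..1} h"
  shows "continuous_on {-1..1} (ktrans K h)"
proof -
  have "continuous_on {(z, w). z \<in> {-1..1} \<and> \<bar>z\<bar> \<le> w \<and> w \<le> 1} (\<lambda>x. (\<lambda>(z, w). K z w) x * h (snd x))"
    by (intro continuous_intros continuous_on_subset[OF K] continuous_on_compose2[OF h])
      (auto simp: kernE_def)
  then have 1: "continuous_on {-1..1} (\<lambda>z. integral {\<bar>z\<bar>..1} ((\<lambda>z w. K z w * h w) z))"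
    by (intro moving_integral_continuous_on) (auto intro!: continuous_intros simp: case_prod_unfold)
  have "continuous_on {(z, w). z \<in> {-1..1} \<and> -1 \<le> w \<and> w \<le> -\<bar>z\<bar>} (\<lambda>x. (\<lambda>(z, w). K z w) x * h (snd x))"
    by (intro continuous_intros continuous_on_subset[OF K] continuous_on_compose2[OF h])
      (auto simp: kernE_def)
  then have 2: "continuous_on {-1..1} (\<lambda>z. integral {-1..-\<bar>z\<bar>} ((\<lambda>z w. K z w * h w) z))"
    by (intro moving_integral_continuous_on) (auto intro!: continuous_intros simp: case_prod_unfold)
  show ?thesis
    unfolding ktrans_def[abs_def] using 1 2 by (intro continuous_intros)
qed

text \<open>Both intervals of integration degenerate to points. Consequently the second component of
  the test pair vanishes at both ends, and the first one has the boundary value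
  \<open>h (-1)\<close> at the inflow end.\<close>

lemma ktrans_end: "\<bar>z\<bar> = 1 \<Longrightarrow> ktrans K h z = 0"
  by (simp add: ktrans_def)

text \<open>The flow is a parameter rather than a construction, so that the original and the
  reflected system can be given the same \<open>sig\<close> and \<open>X\<close>; by
  \<open>mu_eq\<close> the characteristics of \<open>mu\<close> are those of \<open>lam\<close> seen
  through \<open>z \<mapsto> - z\<close>.\<close>

locale kernel_flow =
  fixes lam lam' mu mu' b c :: "real \<Rightarrow> real" and L11 L12 :: "real \<Rightarrow> real \<Rightarrow> real"
    and sig X :: "real \<Rightarrow> real"
  assumes lam_C1: "\<And>x. x \<in> {-1..1} \<Longrightarrow> (lam has_real_derivative lam' x) (at x within {-1..1})"
    and lam'_cont: "continuous_on {-1..1} lam'"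
    and mu_C1: "\<And>x. x \<in> {-1..1} \<Longrightarrow> (mu has_real_derivative mu' x) (at x within {-1..1})"
    and mu'_cont: "continuous_on {-1..1} mu'"
    and lam_pos: "\<And>x. x \<in> {-1..1} \<Longrightarrow> lam x > 0"
    and mu_eq: "\<And>x. x \<in> {-1..1} \<Longrightarrow> mu x = lam (-x)"
    and b_cont: "continuous_on {-1..1} b"
    and c_cont: "continuous_on {-1..1} c"
    and L11_cont: "continuous_on kernE (\<lambda>(z, w). L11 z w)"
    and L12_cont: "continuous_on kernE (\<lambda>(z, w). L12 z w)"
    and L11_char: "char_sol lam lam (\<lambda>z w. - lam' z * L11 z w - c z * L12 z w) L11"
    and L12_char: "char_sol (\<lambda>z. - mu z) lam (\<lambda>z w. - b z * L11 z w + mu' z * L12 z w) L12"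
    and L11_diag: "\<And>w. w \<in> {-1..1} \<Longrightarrow> L11 (-w) w = 0"
    and L12_diag: "\<And>w. w \<in> {-1..1} \<Longrightarrow> L12 w w = b w / (lam w + mu w)"
    and sig': "\<And>x. (sig has_real_derivative 1 / lam (max (-1) (min 1 x))) (at x)"
    and X': "\<And>s. (X has_real_derivative lam (max (-1) (min 1 (X s)))) (at s)"
    and sig_X [simp]: "\<And>s. sig (X s) = s" and X_sig [simp]: "\<And>x. X (sig x) = x"
begin

lemma lam_cont: "continuous_on {-1..1} lam"
  using lam_C1 by (rule DERIV_continuous_on)

lemma mu_cont: "continuous_on {-1..1} mu"
  using mu_C1 by (rule DERIV_continuous_on)

lemma mu_pos: "x \<in> {-1..1} \<Longrightarrow> mu x > 0"
  using mu_eq[of x] lam_pos[of "-x"] by auto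

lemma sig_less: "x < y \<Longrightarrow> sig x < sig y"
  by (rule DERIV_pos_imp_increasing) (use sig' lam_pos in \<open>auto intro!: exI\<close>)

lemma sig_less_iff [simp]: "sig x < sig y \<longleftrightarrow> x < y"
  using sig_less by (metis less_asym linorder_neqE)

lemma sig_le_iff [simp]: "sig x \<le> sig y \<longleftrightarrow> x \<le> y"
  using sig_less_iff[of y x] by linarith

lemma X_less_iff [simp]: "X s < X t \<longleftrightarrow> s < t"
  using sig_less_iff[of "X s" "X t"] by simp

lemma X_le_iff [simp]: "X s \<le> X t \<longleftrightarrow> s \<le> t"
  using sig_le_iff[of "X s" "X t"] by simp

lemma X_le_conv: "X s \<le> x \<longleftrightarrow> s \<le> sig x"
  using sig_le_iff[of "X s" x] by simp

lemma X_ge_conv: "x \<le> X s \<longleftrightarrow> sig x \<le> s"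
  using sig_le_iff[of x "X s"] by simp

lemma X_pos_iff: "0 < X s \<longleftrightarrow> sig 0 < s" and X_neg_iff: "X s < 0 \<longleftrightarrow> s < sig 0"
  using sig_less_iff[of 0 "X s"] sig_less_iff[of "X s" 0] by simp_all

lemma X_cont: "continuous_on S X"
  using X' by (meson DERIV_continuous_on has_field_derivative_at_within)

lemma sig_cont: "continuous_on S sig"
  using sig' by (meson DERIV_continuous_on has_field_derivative_at_within)

text \<open>\<open>sig\<close> is the travel time along the characteristics and \<open>X\<close> its inverse; \<open>lam\<close> is extended to
  the whole line by its boundary values so that both are defined everywhere.\<close>

definition ra where "ra = sig (-1)"
definition rb where "rb = sig 1"

lemma ra_less_rb: "ra < rb" by (simp add: ra_def rb_def)

lemma X_mem_iff: "X s \<in> {-1..1} \<longleftrightarrow> s \<in> {ra..rb}"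
  by (auto simp: ra_def rb_def X_le_conv X_ge_conv)

lemma X_bounds [simp]: "s \<in> {ra..rb} \<Longrightarrow> -1 \<le> X s" "s \<in> {ra..rb} \<Longrightarrow> X s \<le> 1"
  using X_mem_iff[of s] by auto

lemma sig_mem: "z \<in> {-1..1} \<Longrightarrow> sig z \<in> {ra..rb}"
  by (auto simp: ra_def rb_def)

lemma X'_in: "X s \<in> {-1..1} \<Longrightarrow> (X has_real_derivative lam (X s)) (at s)"
proof -
  assume "X s \<in> {-1..1}"
  then have "max (-1) (min 1 (X s)) = X s" by auto
  with X'[of s] show ?thesis by simp
qed

text \<open>For \<open>z = X s\<close> and \<open>w = X (s + y)\<close> the triangle \<open>\<bar>z\<bar> \<le> w\<close> of the kernel domain is \<open>ue s \<le> y\<close>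
  and the triangle \<open>w \<le> - \<bar>z\<bar>\<close> is \<open>y \<le> lf s\<close>. Both bounds decrease in \<open>s\<close>, so every
  characteristic \<open>y = const\<close> meets each triangle in an interval.\<close>

definition ue where "ue s = sig \<bar>X s\<bar> - s"
definition lf where "lf s = sig (- \<bar>X s\<bar>) - s"

lemma ue_le_iff: "ue s \<le> y \<longleftrightarrow> \<bar>X s\<bar> \<le> X (s + y)"
  using sig_le_iff[of "\<bar>X s\<bar>" "X (s + y)"] by (auto simp: ue_def)

lemma le_lf_iff: "y \<le> lf s \<longleftrightarrow> X (s + y) \<le> - \<bar>X s\<bar>"
  using sig_le_iff[of "X (s + y)" "- \<bar>X s\<bar>"] by (auto simp: lf_def)

lemma ue_antimono: "s \<le> s' \<Longrightarrow> ue s' \<le> ue s"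
proof -
  assume le: "s \<le> s'"
  then have X: "X s \<le> X s'" by simp
  have *: "sig (-X s') \<le> sig (-X s)" using X by (subst sig_le_iff) auto
  show ?thesis
    using le X * sig_le_iff[of "X s" "-X s"] unfolding ue_def
    by (auto simp: abs_if simp del: X_le_iff sig_le_iff X_less_iff sig_less_iff)
qed

lemma lf_antimono: "s \<le> s' \<Longrightarrow> lf s' \<le> lf s"
proof -
  assume le: "s \<le> s'"
  then have X: "X s \<le> X s'" by simp
  have *: "sig (-X s') \<le> sig (-X s)" using X by (subst sig_le_iff) auto
  show ?thesis
    using le X * sig_le_iff[of "-X s'" "X s'"] unfolding lf_def
    by (auto simp: abs_if simp del: X_le_iff sig_le_iff X_less_iff sig_less_iff)
qed

lemma ue_lf_cont: "continuous_on S ue" "continuous_on S lf"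
  unfolding ue_def lf_def
  by (intro continuous_intros continuous_on_compose2[OF sig_cont[of UNIV]] X_cont; simp)+

text \<open>The speed at which the reflected end \<open>w = - X s\<close> moves relative to the
  flow. It equals \<open>(lam (- X s) + lam (X s)) / lam (- X s)\<close>; the numerator is
  \<open>lam + mu\<close> at \<open>- X s\<close>, which is the denominator prescribed for
  \<open>L12\<close> on the diagonal.\<close>

definition refl' where "refl' s = 1 + lam (X s) / lam (- X s)"

lemma sig_refl':
  assumes "s \<in> {ra..rb}"
  shows "((\<lambda>s. sig (- X s) - s) has_real_derivative - refl' s) (at s)"
proof -
  have "X s \<in> {-1..1}" using assms X_mem_iff by blast
  then have e: "max (-1) (min 1 (- X s)) = - X s" "max (-1) (min 1 (X s)) = X s" by auto
  show ?thesis
    by (rule derivative_eq_intros DERIV_chain2[OF sig'] X' refl)+ (simp add: e[simplified] refl'_def)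
qed

text \<open>For \<open>X s > 0\<close> the bound is constantly 0, because the edge
  \<open>w = X s\<close> moves with the flow. For \<open>X s < 0\<close> the edge is the reflected
  point \<open>w = - X s\<close>, which moves against the flow. At \<open>X s = 0\<close> the two
  branches meet in a kink. For \<open>lf\<close> the roles of the branches are exchanged.\<close>

lemma ue':
  assumes s: "s \<in> {ra..rb}" "X s \<noteq> 0"
  shows "(ue has_real_derivative (if X s > 0 then 0 else - refl' s)) (at s)"
proof (cases "X s > 0")
  case True
  have "((\<lambda>_. 0) has_real_derivative 0) (at s)" by simp
  then have "(ue has_real_derivative 0) (at s)"
    by (rule has_field_derivative_transform_within_open[of _ _ _ "{sig 0<..}"])
      (use True in \<open>auto simp: ue_def abs_if X_pos_iff X_neg_iff\<close>)
  then show ?thesis using True by simp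
next
  case False
  with s have "X s < 0" by simp
  have "(ue has_real_derivative - refl' s) (at s)"
    by (rule has_field_derivative_transform_within_open[OF sig_refl'[OF s(1)], of "{..<sig 0}"])
      (use \<open>X s < 0\<close> in \<open>auto simp: ue_def abs_if X_pos_iff X_neg_iff\<close>)
  then show ?thesis using False by simp
qed

lemma lf':
  assumes s: "s \<in> {ra..rb}" "X s \<noteq> 0"
  shows "(lf has_real_derivative (if X s < 0 then 0 else - refl' s)) (at s)"
proof (cases "X s < 0")
  case True
  have "((\<lambda>_. 0) has_real_derivative 0) (at s)" by simp
  then have "(lf has_real_derivative 0) (at s)"
    by (rule has_field_derivative_transform_within_open[of _ _ _ "{..<sig 0}"])
      (use True in \<open>auto simp: lf_def abs_if X_pos_iff X_neg_iff\<close>)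
  then show ?thesis using True by simp
next
  case False
  with s have "X s > 0" by simp
  have "(lf has_real_derivative - refl' s) (at s)"
    by (rule has_field_derivative_transform_within_open[OF sig_refl'[OF s(1)], of "{sig 0<..}"])
      (use \<open>X s > 0\<close> in \<open>auto simp: lf_def abs_if X_pos_iff X_neg_iff\<close>)
  then show ?thesis using False by simp
qed

lemma integral_flow_subst:
  assumes s: "s \<in> {ra..rb}" and pq: "p \<le> q" "-1 \<le> X (s + p)" "X (s + q) \<le> 1"
    and g: "continuous_on {X (s + p)..X (s + q)} g"
  shows "integral {p..q} (\<lambda>y. lam (X (s + y)) * g (X (s + y))) = integral {X (s + p)..X (s + q)} g"
proof -
  have "((\<lambda>y. lam (X (s + y)) *\<^sub>R g (X (s + y))) has_integral integral {X (s + p)..X (s + q)} g) {p..q}"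
  proof (rule has_integral_substitution[OF pq(1) _ _ g])
    fix y assume y: "y \<in> {p..q}"
    then have "X (s + p) \<le> X (s + y)" "X (s + y) \<le> X (s + q)" by auto
    with pq(2,3) have "X (s + y) \<in> {-1..1}" unfolding atLeastAtMost_iff by (meson order_trans)
    then have "(X has_real_derivative lam (X (s + y))) (at (s + y))" by (rule X'_in)
    then have "((\<lambda>y. X (s + y)) has_real_derivative lam (X (s + y)) * 1) (at y)"
      by (rule DERIV_chain2) (auto intro!: derivative_eq_intros)
    then show "((\<lambda>y. X (s + y)) has_real_derivative lam (X (s + y))) (at y within {p..q})"
      by (simp add: has_field_derivative_at_within)
  qed (use pq in auto)
  then show ?thesis by (simp add: integral_unique)
qed

end

text \<open>The coordinate \<open>zeta s\<close> is \<open>X s\<close> for the first kernel and \<open>- X s\<close> for the second one;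
  in both cases the characteristics become the lines \<open>y = const\<close> when \<open>w = X (s + y)\<close>.\<close>

locale kernel_chart = kernel_flow +
  fixes L F :: "real \<Rightarrow> real \<Rightarrow> real" and fz zeta h p' :: "real \<Rightarrow> real"
  assumes L: "continuous_on kernE (\<lambda>(z, w). L z w)" and F: "continuous_on kernE (\<lambda>(z, w). F z w)"
    and char: "char_sol fz lam F L"
    and zeta': "\<And>s. s \<in> {ra..rb} \<Longrightarrow> (zeta has_real_derivative fz (zeta s)) (at s)"
    and zeta_abs: "\<And>s. \<bar>zeta s\<bar> = \<bar>X s\<bar>"
    and h: "continuous_on {-1..1} h" and p'_cont: "continuous_on {-1..1} p'"
    and p': "\<And>w. w \<in> {-1..1} \<Longrightarrow> ((\<lambda>w. lam w * h w) has_real_derivative p' w) (at w within {-1..1})"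
    and h1: "h 1 = 0"
begin

text \<open>The factor \<open>lam\<close> is the Jacobian of \<open>y \<mapsto> X (s + y)\<close>,
  so integrating \<open>N s\<close> over \<open>y\<close> gives the integral of
  \<open>L z w * h w\<close> over \<open>w\<close>. This is why differentiability is asked of the
  product of \<open>lam\<close> and \<open>h\<close>.\<close>

definition N where "N s y = L (zeta s) (X (s + y)) * (lam (X (s + y)) * h (X (s + y)))"
definition D where "D s y = F (zeta s) (X (s + y)) * (lam (X (s + y)) * h (X (s + y)))
    + L (zeta s) (X (s + y)) * (p' (X (s + y)) * lam (X (s + y)))"

lemma zeta_cont: "continuous_on {ra..rb} zeta"
  using zeta' by (meson DERIV_continuous_on has_field_derivative_at_within)

lemma chart_mem:
  assumes "\<bar>X s\<bar> \<le> \<bar>X (s + y)\<bar>" "X (s + y) \<in> {-1..1}"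
  shows "(zeta s, X (s + y)) \<in> kernE" "s \<in> {ra..rb}"
proof -
  show "(zeta s, X (s + y)) \<in> kernE" using assms by (auto simp: kernE_iff zeta_abs)
  show "s \<in> {ra..rb}" using assms by (subst X_mem_iff[symmetric]) auto
qed

lemma ND_cont:
  assumes R: "\<And>s y. (s, y) \<in> R \<Longrightarrow> \<bar>X s\<bar> \<le> \<bar>X (s + y)\<bar> \<and> X (s + y) \<in> {-1..1}"
  shows "continuous_on R (\<lambda>(s, y). N s y)" "continuous_on R (\<lambda>(s, y). D s y)"
proof -
  have R1: "fst x \<in> {ra..rb}" "(zeta (fst x), X (fst x + snd x)) \<in> kernE"
     "X (fst x + snd x) \<in> {-1..1}" if "x \<in> R" for x
    using chart_mem[of "fst x" "snd x"] R[of "fst x" "snd x"] that by auto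
  have cz: "continuous_on R (\<lambda>x. (zeta (fst x), X (fst x + snd x)))"
    using R1(1) by (intro continuous_intros continuous_on_compose2[OF zeta_cont] continuous_on_compose2[OF X_cont[of UNIV]]) auto
  have cX: "continuous_on R (\<lambda>x. X (fst x + snd x))"
    by (intro continuous_intros continuous_on_compose2[OF X_cont[of UNIV]]) auto
  have k: "continuous_on R (\<lambda>x. L (zeta (fst x)) (X (fst x + snd x)))"
     "continuous_on R (\<lambda>x. F (zeta (fst x)) (X (fst x + snd x)))"
    using continuous_on_compose2[OF L cz] continuous_on_compose2[OF F cz] R1(2)
    by (simp_all add: image_subset_iff)
  have l: "continuous_on R (\<lambda>x. lam (X (fst x + snd x)))" "continuous_on R (\<lambda>x. h (X (fst x + snd x)))"
     "continuous_on R (\<lambda>x. p' (X (fst x + snd x)))"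
    using R1(3) by (auto intro!: continuous_on_compose2[OF lam_cont cX] continuous_on_compose2[OF h cX]
       continuous_on_compose2[OF p'_cont cX])
  show "continuous_on R (\<lambda>(s, y). N s y)" "continuous_on R (\<lambda>(s, y). D s y)"
    unfolding N_def D_def case_prod_unfold by (intro continuous_intros k l)+
qed

text \<open>For fixed \<open>y\<close> the point \<open>(zeta x, X (x + y))\<close> runs along a
  characteristic of \<open>L\<close>, so \<open>char_sol\<close> supplies the derivative although
  \<open>L\<close> need not have partial derivatives.\<close>

lemma N_deriv:
  assumes ss: "s < s'" and R: "\<And>x. x \<in> {s..s'} \<Longrightarrow> \<bar>X x\<bar> \<le> \<bar>X (x + y)\<bar> \<and> X (x + y) \<in> {-1..1}"
    and x: "x \<in> {s..s'}"
  shows "((\<lambda>x. N x y) has_real_derivative D x y) (at x within {s..s'})"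
proof -
  have mem: "x \<in> {ra..rb}" "(zeta x, X (x + y)) \<in> kernE" if "x \<in> {s..s'}" for x
    using chart_mem[of x y] R[OF that] by auto
  have Xy: "((\<lambda>x. X (x + y)) has_real_derivative lam (X (x + y))) (at x within {s..s'})"
    if "x \<in> {s..s'}" for x
  proof -
    have "((\<lambda>x. X (x + y)) has_real_derivative lam (X (x + y)) * 1) (at x)"
      by (rule DERIV_chain2[OF X'_in]) (use R[OF that] in \<open>auto intro!: derivative_eq_intros\<close>)
    then show ?thesis by (simp add: has_field_derivative_at_within)
  qed
  have "\<forall>x\<in>{s..s'}. (zeta x, X (x + y)) \<in> kernE \<and>
     (zeta has_real_derivative fz (zeta x)) (at x within {s..s'}) \<and>
     ((\<lambda>x. X (x + y)) has_real_derivative lam (X (x + y))) (at x within {s..s'})"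
    using mem Xy zeta' by (auto intro: has_field_derivative_at_within)
  then have "\<forall>x\<in>{s..s'}. ((\<lambda>x. L (zeta x) (X (x + y))) has_real_derivative F (zeta x) (X (x + y))) (at x within {s..s'})"
    using char[unfolded char_sol_def, THEN spec, of s, THEN spec, of s', THEN spec, of zeta, THEN spec,
      of "\<lambda>x. X (x + y)"] ss by (elim mp[rotated]) simp
  then have 1: "((\<lambda>x. L (zeta x) (X (x + y))) has_real_derivative F (zeta x) (X (x + y))) (at x within {s..s'})"
    using x by blast
  have "((\<lambda>w. lam w * h w) has_real_derivative p' (X (x + y))) (at (X (x + y)) within (\<lambda>x. X (x + y)) ` {s..s'})"
    using R x by (intro has_field_derivative_subset[OF p']) auto
  from DERIV_image_chain[OF this Xy[OF x]]
  have 2: "((\<lambda>x. lam (X (x + y)) * h (X (x + y))) has_real_derivative p' (X (x + y)) * lam (X (x + y))) (at x within {s..s'})"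
    by (simp add: o_def)
  show ?thesis
    unfolding N_def D_def by (rule DERIV_cong[OF DERIV_mult[OF 1 2]]) (simp add: algebra_simps)
qed

text \<open>The integrand \<open>D\<close> expressed in the variable \<open>w\<close>, with the
  Jacobian \<open>lam\<close> split off.\<close>

definition FL where "FL z w = F z w * h w + L z w * p' w"

lemma section_cont:
  assumes "S \<subseteq> {w. \<bar>z\<bar> \<le> \<bar>w\<bar> \<and> \<bar>w\<bar> \<le> 1}"
  shows "continuous_on S (\<lambda>w. L z w * h w)" "continuous_on S (FL z)"
proof -
  have "S \<subseteq> {-1..1}" using assms by (force simp: abs_le_iff)
  then show "continuous_on S (\<lambda>w. L z w * h w)" "continuous_on S (FL z)"
    unfolding FL_def
    by (intro continuous_intros kernel_section_continuous[OF L assms] kernel_section_continuous[OF F assms]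
      continuous_on_subset[OF h] continuous_on_subset[OF p'_cont]; assumption)+
qed

lemma upper_subst:
  assumes s: "s \<in> {ra..rb}"
  shows "integral {ue s..rb - s} (N s) = integral {\<bar>zeta s\<bar>..1} (\<lambda>w. L (zeta s) w * h w)"
    "integral {ue s..rb - s} (D s) = integral {\<bar>zeta s\<bar>..1} (FL (zeta s))"
proof -
  have e: "X (s + ue s) = \<bar>zeta s\<bar>" "X (s + (rb - s)) = 1"
    by (simp_all add: ue_def zeta_abs rb_def)
  have le: "ue s \<le> rb - s" using s by (simp add: ue_le_iff e[simplified] zeta_abs[symmetric])
     (simp add: zeta_abs rb_def abs_le_iff X_bounds minus_le_iff)
  have c: "continuous_on {X (s + ue s)..X (s + (rb - s))} (\<lambda>w. L (zeta s) w * h w)"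
    "continuous_on {X (s + ue s)..X (s + (rb - s))} (FL (zeta s))"
    unfolding e by (intro section_cont; auto)+
  note * = integral_flow_subst[OF s le _ _ c(1)] integral_flow_subst[OF s le _ _ c(2)]
  have "N s = (\<lambda>y. lam (X (s + y)) * (L (zeta s) (X (s + y)) * h (X (s + y))))"
    "D s = (\<lambda>y. lam (X (s + y)) * FL (zeta s) (X (s + y)))"
    by (auto simp: N_def D_def FL_def fun_eq_iff algebra_simps)
  then show "integral {ue s..rb - s} (N s) = integral {\<bar>zeta s\<bar>..1} (\<lambda>w. L (zeta s) w * h w)"
    "integral {ue s..rb - s} (D s) = integral {\<bar>zeta s\<bar>..1} (FL (zeta s))"
    using * unfolding e by simp_all
qed

lemma lower_subst:
  assumes s: "s \<in> {ra..rb}"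
  shows "integral {ra - s..lf s} (N s) = integral {-1..-\<bar>zeta s\<bar>} (\<lambda>w. L (zeta s) w * h w)"
    "integral {ra - s..lf s} (D s) = integral {-1..-\<bar>zeta s\<bar>} (FL (zeta s))"
proof -
  have e: "X (s + lf s) = -\<bar>zeta s\<bar>" "X (s + (ra - s)) = -1"
    by (simp_all add: lf_def zeta_abs ra_def)
  have le: "ra - s \<le> lf s" using s by (simp add: le_lf_iff e[simplified] zeta_abs[symmetric])
     (simp add: zeta_abs ra_def abs_le_iff X_bounds minus_le_iff)
  have c: "continuous_on {X (s + (ra - s))..X (s + lf s)} (\<lambda>w. L (zeta s) w * h w)"
    "continuous_on {X (s + (ra - s))..X (s + lf s)} (FL (zeta s))"
    unfolding e by (intro section_cont; auto)+
  note * = integral_flow_subst[OF s le _ _ c(1)] integral_flow_subst[OF s le _ _ c(2)]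
  have "N s = (\<lambda>y. lam (X (s + y)) * (L (zeta s) (X (s + y)) * h (X (s + y))))"
    "D s = (\<lambda>y. lam (X (s + y)) * FL (zeta s) (X (s + y)))"
    by (auto simp: N_def D_def FL_def fun_eq_iff algebra_simps)
  then show "integral {ra - s..lf s} (N s) = integral {-1..-\<bar>zeta s\<bar>} (\<lambda>w. L (zeta s) w * h w)"
    "integral {ra - s..lf s} (D s) = integral {-1..-\<bar>zeta s\<bar>} (FL (zeta s))"
    using * unfolding e by simp_all
qed

lemma upper_deriv:
  assumes s: "s \<in> {ra<..<rb}" "X s \<noteq> 0"
  shows "((\<lambda>s. integral {\<bar>zeta s\<bar>..1} (\<lambda>w. L (zeta s) w * h w)) has_real_derivative
      integral {\<bar>zeta s\<bar>..1} (FL (zeta s))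
        + (if X s > 0 then 0 else refl' s * (L (zeta s) (- X s) * (lam (- X s) * h (- X s))))) (at s)"
proof -
  have s': "s \<in> {ra..rb}" using s by auto
  have mem: "\<bar>X x\<bar> \<le> \<bar>X (x + y)\<bar> \<and> X (x + y) \<in> {-1..1}" if "ue x \<le> y" "y \<le> rb - x" for x y
  proof -
    have "X (x + y) \<le> X rb" using that by simp
    then show ?thesis using that by (auto simp: ue_le_iff rb_def)
  qed
  have "((\<lambda>s. integral {ue s..rb - s} (N s)) has_real_derivative
     integral {ue s..rb - s} (D s) + (-1) * N s (rb - s) - (if X s > 0 then 0 else - refl' s) * N s (ue s)) (at s)"
  proof (rule moving_integral_has_derivative[where a = ra and b = rb])
    show "ue s < rb - s" using s
      by (simp add: ue_def rb_def abs_less_iff) (simp add: ra_def not_le[symmetric] X_le_conv X_ge_conv minus_le_iff)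
    show "continuous_on {(s, y). s \<in> {ra..rb} \<and> ue s \<le> y \<and> y \<le> rb - s} (\<lambda>(s, y). N s y)"
      "continuous_on {(s, y). s \<in> {ra..rb} \<and> ue s \<le> y \<and> y \<le> rb - s} (\<lambda>(s, y). D s y)"
      using mem by (intro ND_cont; auto)+
    show "((\<lambda>x. N x y) has_real_derivative D x y) (at x within {t..t'})"
      if "ra \<le> t" "t < t'" "t' \<le> rb" "ue t \<le> y" "y \<le> rb - t'" "x \<in> {t..t'}" for t t' y x
    proof (rule N_deriv[OF that(2) _ that(6)])
      fix x assume "x \<in> {t..t'}"
      then show "\<bar>X x\<bar> \<le> \<bar>X (x + y)\<bar> \<and> X (x + y) \<in> {-1..1}"
        using that ue_antimono[of t x] by (intro mem) auto
    qed
    show "ue t' \<le> ue t \<and> rb - t' \<le> rb - t" if "t \<le> t'" for t t' using that ue_antimono by auto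
    show "(ue has_real_derivative (if 0 < X s then 0 else - refl' s)) (at s)"
      by (rule ue'[OF s' s(2)])
  qed (use s in \<open>auto intro!: continuous_intros ue_lf_cont derivative_eq_intros\<close>)
  \<comment> \<open>The outflow end \<open>w = 1\<close> contributes nothing, because
    \<open>h 1 = 0\<close>.\<close>
  moreover have "N s (rb - s) = 0" by (simp add: N_def rb_def h1)
  moreover have "N s (ue s) = L (zeta s) (- X s) * (lam (- X s) * h (- X s))" if "\<not> X s > 0"
    using that by (simp add: N_def ue_def)
  ultimately have "((\<lambda>s. integral {ue s..rb - s} (N s)) has_real_derivative
      integral {\<bar>zeta s\<bar>..1} (FL (zeta s))
        + (if X s > 0 then 0 else refl' s * (L (zeta s) (- X s) * (lam (- X s) * h (- X s))))) (at s)"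
    unfolding upper_subst(2)[OF s'] by (auto split: if_splits)
  then show ?thesis
    by (rule has_field_derivative_transform_within_open[of _ _ _ "{ra<..<rb}"])
      (use s in \<open>auto simp: upper_subst\<close>)
qed

lemma lower_deriv:
  assumes s: "s \<in> {ra<..<rb}" "X s \<noteq> 0"
  shows "((\<lambda>s. integral {-1..-\<bar>zeta s\<bar>} (\<lambda>w. L (zeta s) w * h w)) has_real_derivative
      integral {-1..-\<bar>zeta s\<bar>} (FL (zeta s)) + L (zeta s) (-1) * (lam (-1) * h (-1))
        - (if X s < 0 then 0 else refl' s * (L (zeta s) (- X s) * (lam (- X s) * h (- X s))))) (at s)"
proof -
  have s': "s \<in> {ra..rb}" using s by auto
  have mem: "\<bar>X x\<bar> \<le> \<bar>X (x + y)\<bar> \<and> X (x + y) \<in> {-1..1}" if "ra - x \<le> y" "y \<le> lf x" for x y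
  proof -
    have "X ra \<le> X (x + y)" using that by simp
    then show ?thesis using that by (auto simp: le_lf_iff ra_def)
  qed
  have "((\<lambda>s. integral {ra - s..lf s} (N s)) has_real_derivative
     integral {ra - s..lf s} (D s) + (if X s < 0 then 0 else - refl' s) * N s (lf s) - (-1) * N s (ra - s)) (at s)"
  proof (rule moving_integral_has_derivative[where a = ra and b = rb])
    show "ra - s < lf s" using s
      by (simp add: lf_def ra_def abs_less_iff) (simp add: rb_def not_le[symmetric] X_le_conv X_ge_conv minus_le_iff)
    show "continuous_on {(s, y). s \<in> {ra..rb} \<and> ra - s \<le> y \<and> y \<le> lf s} (\<lambda>(s, y). N s y)"
      "continuous_on {(s, y). s \<in> {ra..rb} \<and> ra - s \<le> y \<and> y \<le> lf s} (\<lambda>(s, y). D s y)"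
      using mem by (intro ND_cont; auto)+
    show "((\<lambda>x. N x y) has_real_derivative D x y) (at x within {t..t'})"
      if "ra \<le> t" "t < t'" "t' \<le> rb" "ra - t \<le> y" "y \<le> lf t'" "x \<in> {t..t'}" for t t' y x
    proof (rule N_deriv[OF that(2) _ that(6)])
      fix x assume "x \<in> {t..t'}"
      then show "\<bar>X x\<bar> \<le> \<bar>X (x + y)\<bar> \<and> X (x + y) \<in> {-1..1}"
        using that lf_antimono[of x t'] by (intro mem) auto
    qed
    show "ra - t' \<le> ra - t \<and> lf t' \<le> lf t" if "t \<le> t'" for t t' using that lf_antimono by auto
    show "(lf has_real_derivative (if X s < 0 then 0 else - refl' s)) (at s)"
      by (rule lf'[OF s' s(2)])
  qed (use s in \<open>auto intro!: continuous_intros ue_lf_cont derivative_eq_intros\<close>)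
  \<comment> \<open>The inflow end \<open>w = -1\<close> does contribute; this is the term that the
    feedback law compensates later.\<close>
  moreover have "N s (ra - s) = L (zeta s) (-1) * (lam (-1) * h (-1))" by (simp add: N_def ra_def)
  moreover have "N s (lf s) = L (zeta s) (- X s) * (lam (- X s) * h (- X s))" if "\<not> X s < 0"
    using that by (simp add: N_def lf_def)
  ultimately have "((\<lambda>s. integral {ra - s..lf s} (N s)) has_real_derivative
      integral {-1..-\<bar>zeta s\<bar>} (FL (zeta s)) + L (zeta s) (-1) * (lam (-1) * h (-1))
        - (if X s < 0 then 0 else refl' s * (L (zeta s) (- X s) * (lam (- X s) * h (- X s))))) (at s)"
    unfolding lower_subst(2)[OF s'] by (auto split: if_splits simp: algebra_simps)
  then show ?thesis
    by (rule has_field_derivative_transform_within_open[of _ _ _ "{ra<..<rb}"])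
      (use s in \<open>auto simp: lower_subst\<close>)
qed

lemma FL_split: "integral {\<bar>z\<bar>..1} (FL z) - integral {-1..-\<bar>z\<bar>} (FL z) = ktrans F h z + ktrans L p' z"
proof -
  note i = ktrans_integrable[OF F h, of z] ktrans_integrable[OF L p'_cont, of z]
  show ?thesis
    unfolding FL_def[abs_def] ktrans_def
    using i by (simp add: Henstock_Kurzweil_Integration.integral_add)
qed

text \<open>The endpoint term at \<open>w = - X s\<close> comes from the upper triangle for
  \<open>X s < 0\<close> and from the lower one for \<open>X s > 0\<close>. The minus signs in
  \<open>ktrans\<close> and in the motion of the lower end make it the same expression on both
  sides. So the derivative has a continuous continuation as soon as this term has one, namely
  \<open>bd\<close>, and the kink at \<open>sig 0\<close> does no harm.\<close>

lemma ktrans_chart_deriv: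
  assumes bd: "continuous_on {ra..rb} bd"
    and bd_eq: "\<And>s. s \<in> {ra..rb} \<Longrightarrow> refl' s * (L (zeta s) (- X s) * (lam (- X s) * h (- X s))) = bd s"
    and s: "s \<in> {ra..rb}"
  shows "((\<lambda>s. ktrans L h (zeta s)) has_real_derivative
     ktrans F h (zeta s) + ktrans L p' (zeta s) - L (zeta s) (-1) * (lam (-1) * h (-1)) + bd s) (at s within {ra..rb})"
proof (rule has_real_derivative_within_closed[of "{sig 0}"])
  have zm: "zeta ` {ra..rb} \<subseteq> {-1..1}"
  proof
    fix z assume "z \<in> zeta ` {ra..rb}"
    then obtain t where "t \<in> {ra..rb}" "z = zeta t" by auto
    then have "\<bar>X t\<bar> \<le> 1" using X_mem_iff[of t] by (auto simp: abs_le_iff)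
    then show "z \<in> {-1..1}" using zeta_abs[of t] \<open>z = zeta t\<close> by (auto simp: abs_le_iff)
  qed
  show "continuous_on {ra..rb} (\<lambda>s. ktrans L h (zeta s))"
    using zm by (intro continuous_on_compose2[OF ktrans_continuous[OF L h] zeta_cont])
  have "continuous_on {-1..1} (\<lambda>z. (\<lambda>(z, w). L z w) (z, -1))"
    by (intro continuous_on_compose2[OF L]) (auto intro!: continuous_intros simp: kernE_def)
  then have cL: "continuous_on {-1..1} (\<lambda>z. L z (-1))" by simp
  show "continuous_on {ra..rb} (\<lambda>s. ktrans F h (zeta s) + ktrans L p' (zeta s) - L (zeta s) (-1) * (lam (-1) * h (-1)) + bd s)"
    using zm by (intro continuous_intros bd continuous_on_compose2[OF ktrans_continuous[OF F h] zeta_cont]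
       continuous_on_compose2[OF ktrans_continuous[OF L p'_cont] zeta_cont] continuous_on_compose2[OF cL zeta_cont])
  show "((\<lambda>s. ktrans L h (zeta s)) has_real_derivative
     ktrans F h (zeta s) + ktrans L p' (zeta s) - L (zeta s) (-1) * (lam (-1) * h (-1)) + bd s) (at s)"
    if "s \<in> {ra<..<rb} - {sig 0}" for s
  proof -
    have s: "s \<in> {ra<..<rb}" "X s \<noteq> 0" using that by auto (metis sig_X)
    show ?thesis
      unfolding ktrans_def[of L h]
      by (rule DERIV_cong[OF DERIV_diff[OF upper_deriv[OF s] lower_deriv[OF s]]])
        (use FL_split[of "zeta s"] bd_eq[of s] s in \<open>auto simp: algebra_simps\<close>)
  qed
qed (use s ra_less_rb in auto)

end

section \<open>The weak formulation tested with adjoint data\<close>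

lemma real_antiderivative_exists:
  fixes g :: "real \<Rightarrow> real"
  assumes "continuous_on UNIV g"
  obtains G where "\<And>x. (G has_real_derivative g x) (at x)"
proof -
  have "\<exists>F. \<forall>x::real. - \<infinity> < ereal x \<longrightarrow> ereal x < \<infinity> \<longrightarrow> (F has_vector_derivative g x) (at x)"
    using assms by (intro einterval_antiderivative) (auto simp: continuous_on_eq_continuous_at)
  then show ?thesis
    using that by (auto simp: has_real_derivative_iff_has_vector_derivative)
qed

text \<open>\<open>sig\<close> is an antiderivative of \<open>1 / lam\<close>, with
  \<open>lam\<close> held constant beyond the ends. Since \<open>lam\<close> is bounded, the slope
  of \<open>sig\<close> stays away from zero, so \<open>sig\<close> is onto and has a differentiable
  inverse \<open>X\<close>.\<close>

lemma flow_exists: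
  fixes lam :: "real \<Rightarrow> real"
  assumes lam: "continuous_on {-1..1} lam" and pos: "\<And>x. x \<in> {-1..1} \<Longrightarrow> lam x > 0"
  obtains sig X where "\<And>x. (sig has_real_derivative 1 / lam (max (-1) (min 1 x))) (at x)"
    "\<And>s. (X has_real_derivative lam (max (-1) (min 1 (X s)))) (at s)"
    "\<And>s. sig (X s) = s" "\<And>x. X (sig x) = x"
proof -
  define g where "g x = lam (max (-1) (min 1 x))" for x
  have gpos: "g x > 0" for x using pos by (simp add: g_def)
  have cg: "continuous_on UNIV g"
    unfolding g_def by (intro continuous_on_compose2[OF lam] continuous_intros) auto
  obtain M where M: "\<And>x. g x \<le> M"
  proof -
    obtain M where "\<And>x. x \<in> {-1..1} \<Longrightarrow> \<bar>lam x\<bar> \<le> M"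
      using continuous_on_Icc_bounded[OF lam] by blast
    then have "g x \<le> M" for x unfolding g_def by (rule order_trans[OF abs_ge_self]) auto
    with that show ?thesis by blast
  qed
  have Mpos: "M > 0" using gpos[of 0] M[of 0] by simp
  obtain sig where sig: "\<And>x. (sig has_real_derivative 1 / g x) (at x)"
  proof (rule real_antiderivative_exists)
    show "continuous_on UNIV (\<lambda>x. 1 / g x)"
      using cg gpos by (intro continuous_intros) (auto simp: less_imp_neq[THEN not_sym])
  qed blast
  have less: "sig x < sig y" if "x < y" for x y
    by (rule DERIV_pos_imp_increasing[OF that]) (use sig gpos in \<open>auto intro!: exI\<close>)
  have inj: "inj sig" using less by (intro injI) (metis less_irrefl linorder_neqE)
  have csig: "continuous_on S sig" for S
    using sig by (meson DERIV_continuous_on has_field_derivative_at_within)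
  have grow: "sig y - sig x \<ge> (y - x) / M" if xy: "x < y" for x y
  proof -
    obtain z where "sig y - sig x = (y - x) * (1 / g z)"
      using MVT2[OF xy, of sig "\<lambda>x. 1 / g x"] sig by blast
    moreover have "(y - x) * (1 / g z) \<ge> (y - x) * (1 / M)"
      using xy gpos M Mpos by (intro mult_left_mono divide_left_mono) auto
    ultimately show ?thesis by simp
  qed
  have "surj sig"
  proof (rule surjI[where f = "\<lambda>y. SOME x. sig x = y"])
    fix y
    \<comment> \<open>With slope at least \<open>1 / M\<close>, \<open>sig\<close> changes by at
      least \<open>\<bar>y - sig 0\<bar> + 1\<close> over a distance \<open>r\<close> on either side
      of 0, so \<open>y\<close> lies between \<open>sig (-r)\<close> and
      \<open>sig r\<close>.\<close>
    define r where "r = M * (\<bar>y - sig 0\<bar> + 1)"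
    have r: "r > 0" using Mpos by (simp add: r_def)
    have "sig r \<ge> y" "sig (-r) \<le> y"
      using grow[of 0 r] grow[of "-r" 0] r Mpos by (auto simp: r_def abs_if split: if_splits)
    then have "\<exists>x. -r \<le> x \<and> x \<le> r \<and> sig x = y"
      using r by (intro IVT' csig) auto
    then show "sig (SOME x. sig x = y) = y" by (metis (mono_tags) someI)
  qed
  define X where "X = inv sig"
  have sX: "sig (X s) = s" for s using \<open>surj sig\<close> by (simp add: X_def surj_f_inv_f)
  have Xs: "X (sig x) = x" for x using inj by (simp add: X_def)
  have X: "(X has_real_derivative g (X s)) (at s)" for s
  proof -
    have "isCont X (sig (X s))"
      using csig[of UNIV] by (rule_tac isCont_inverse_function[where f = sig and d = 1]) (auto simp: Xs continuous_on_eq_continuous_at)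
    then have "(X has_real_derivative inverse (1 / g (X s))) (at s)"
      using sig[of "X s"] gpos[of "X s"] by (rule_tac DERIV_inverse_function[where f = sig and a = "s - 1" and b = "s + 1"]) (auto simp: sX)
    then show ?thesis by simp
  qed
  show ?thesis
    by (rule that[of sig X]) (use sig X sX Xs in \<open>auto simp: g_def\<close>)
qed

text \<open>Test functions live on the whole plane, adjoint data only on \<open>{-1..1}\<close>.
  Integrating the derivative, continued by its boundary values, extends the data with a continuous
  derivative.\<close>

lemma C1_extension:
  fixes f f' :: "real \<Rightarrow> real"
  assumes ab: "a \<le> b" and f: "\<And>x. x \<in> {a..b} \<Longrightarrow> (f has_real_derivative f' x) (at x within {a..b})"
    and f': "continuous_on {a..b} f'"
  obtains F where "\<And>x. (F has_real_derivative f' (max a (min b x))) (at x)" "\<And>x. x \<in> {a..b} \<Longrightarrow> F x = f x"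
proof -
  obtain G where G: "\<And>x. (G has_real_derivative f' (max a (min b x))) (at x)"
  proof (rule real_antiderivative_exists)
    show "continuous_on UNIV (\<lambda>x. f' (max a (min b x)))"
      using ab by (intro continuous_on_compose2[OF f'] continuous_intros) auto
  qed blast
  have "((\<lambda>x. G x - f x) has_real_derivative 0) (at x within {a..b})" if "x \<in> {a..b}" for x
  proof -
    have "max a (min b x) = x" using that by auto
    then show ?thesis
      using DERIV_diff[OF has_field_derivative_at_within[OF G[of x]] f[OF that]] by simp
  qed
  then obtain k where k: "\<And>x. x \<in> {a..b} \<Longrightarrow> G x - f x = k"
    using has_field_derivative_zero_constant[of "{a..b}" "\<lambda>x. G x - f x"] by auto
  show ?thesis
  proof (rule that[of "\<lambda>x. G x - k"])
    show "((\<lambda>x. G x - k) has_real_derivative f' (max a (min b x))) (at x)" for x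
      by (auto intro!: derivative_eq_intros G)
    show "G x - k = f x" if "x \<in> {a..b}" for x using k[OF that] by simp
  qed
qed

lemma integral_eq_on_support:
  fixes f :: "real \<Rightarrow> real"
  assumes "{a..b} \<subseteq> S" "\<And>t. t \<notin> {a..b} \<Longrightarrow> f t = 0"
  shows "integral S f = integral {a..b} f"
proof -
  have "(if x \<in> S then f x else 0) = (if x \<in> {a..b} then f x else 0)" for x
    using assms(1) assms(2)[of x] by (cases "x \<in> {a..b}") auto
  then show ?thesis
    using Henstock_Kurzweil_Integration.integral_restrict_UNIV[of S f]
      Henstock_Kurzweil_Integration.integral_restrict_UNIV[of "{a..b}" f] by simp
qed

text \<open>With separated test functions the weak formulation turns into weak differential
  equations in time for the pairings.\<close>

lemma product_test_fun:
  fixes phi phi' k k' :: "real \<Rightarrow> real"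
  assumes phi: "\<And>w. w \<in> {-1..1} \<Longrightarrow> (phi has_real_derivative phi' w) (at w within {-1..1})"
    and phi': "continuous_on {-1..1} phi'"
    and k: "\<And>t. (k has_real_derivative k' t) (at t)" "continuous_on UNIV k'"
    and ab: "0 < a" "a < b" and k0: "\<And>t. t \<notin> {a..b} \<Longrightarrow> k t = 0"
  obtains Phi where "\<And>w. w \<in> {-1..1} \<Longrightarrow> Phi w = phi w"
    "test_fun (\<lambda>w t. Phi w * k t) (\<lambda>w t. phi' (max (-1) (min 1 w)) * k t) (\<lambda>w t. Phi w * k' t)"
proof -
  obtain Phi where Phi: "\<And>w. (Phi has_real_derivative phi' (max (-1) (min 1 w))) (at w)"
     "\<And>w. w \<in> {-1..1} \<Longrightarrow> Phi w = phi w"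
    using C1_extension[OF _ phi phi'] by auto
  have cP: "continuous_on UNIV Phi" "continuous_on UNIV k"
    using Phi(1) k(1) by (meson DERIV_continuous_on has_field_derivative_at_within)+
  have cP': "continuous_on UNIV (\<lambda>w. phi' (max (-1) (min 1 w)))"
    by (intro continuous_on_compose2[OF phi'] continuous_intros) auto
  have "test_fun (\<lambda>w t. Phi w * k t) (\<lambda>w t. phi' (max (-1) (min 1 w)) * k t) (\<lambda>w t. Phi w * k' t)"
    unfolding test_fun_def
  proof (intro conjI allI)
    show "((\<lambda>w. Phi w * k t) has_real_derivative phi' (max (-1) (min 1 w)) * k t) (at w)" for w t
      by (rule DERIV_cmult_right[OF Phi(1)])
    show "((\<lambda>t. Phi w * k t) has_real_derivative Phi w * k' t) (at t)" for w t
      by (rule DERIV_cmult[OF k(1)])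
    show "continuous_on UNIV (\<lambda>(w, t). phi' (max (-1) (min 1 w)) * k t)"
      unfolding case_prod_unfold
      by (intro continuous_intros continuous_on_compose2[OF cP'] continuous_on_compose2[OF cP(2)]) auto
    show "continuous_on UNIV (\<lambda>(w, t). Phi w * k' t)"
      unfolding case_prod_unfold
      by (intro continuous_intros continuous_on_compose2[OF cP(1)] continuous_on_compose2[OF k(2)]) auto
    show "\<exists>a b. 0 < a \<and> a < b \<and> (\<forall>w t. t \<notin> {a..b} \<longrightarrow> Phi w * k t = 0)"
      using ab k0 by (intro exI[of _ a] exI[of _ b]) auto
  qed
  from that[OF Phi(2) this] show ?thesis .
qed

lemma deriv_zero_outside:
  fixes k k' :: "real \<Rightarrow> real"
  assumes "\<And>t. (k has_real_derivative k' t) (at t)" "\<And>t. t \<notin> {a..b} \<Longrightarrow> k t = 0" "t \<notin> {a..b}"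
  shows "k' t = 0"
proof -
  have "((\<lambda>_. 0) has_real_derivative k' t) (at t)"
    by (rule has_field_derivative_transform_within_open[OF assms(1)[of t], of "- {a..b}"])
      (use assms(2,3) in auto)
  then show ?thesis using DERIV_unique DERIV_const by blast
qed

lemma ktrans_lin:
  assumes K1: "continuous_on kernE (\<lambda>(z, w). K1 z w)" and K2: "continuous_on kernE (\<lambda>(z, w). K2 z w)"
    and h: "continuous_on {-1..1} h"
  shows "ktrans (\<lambda>z w. f z * K1 z w + g z * K2 z w) h z = f z * ktrans K1 h z + g z * ktrans K2 h z"
proof -
  note i = ktrans_integrable[OF K1 h, of z] ktrans_integrable[OF K2 h, of z]
  have "integral S (\<lambda>w. (f z * K1 z w + g z * K2 z w) * h w) =
     f z * integral S (\<lambda>w. K1 z w * h w) + g z * integral S (\<lambda>w. K2 z w * h w)"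
    if "(\<lambda>w. K1 z w * h w) integrable_on S" "(\<lambda>w. K2 z w * h w) integrable_on S" for S
  proof -
    have "integral S (\<lambda>w. (f z * K1 z w + g z * K2 z w) * h w) =
      integral S (\<lambda>w. f z * (K1 z w * h w) + g z * (K2 z w * h w))"
      by (simp add: algebra_simps)
    also have "\<dots> = integral S (\<lambda>w. f z * (K1 z w * h w)) + integral S (\<lambda>w. g z * (K2 z w * h w))"
      using that by (intro Henstock_Kurzweil_Integration.integral_add integrable_on_mult_right)
    finally show ?thesis by simp
  qed
  then show ?thesis unfolding ktrans_def using i by (simp add: algebra_simps)
qed

lemma continuous_on_kernE_coeff:
  assumes "continuous_on {-1..1} f"
  shows "continuous_on kernE (\<lambda>(z, w). f z)"
  unfolding case_prod_unfold
  by (intro continuous_on_compose2[OF assms] continuous_intros) (auto simp: kernE_def)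

section \<open>Differentiability of the adjoint transform\<close>

context kernel_flow
begin

text \<open>The chart is \<open>z = X s\<close>. The moving edge is \<open>z = - w\<close>, on which
  \<open>L11\<close> vanishes, so \<open>bd\<close> is zero; dividing by \<open>lam z\<close> passes
  from \<open>s\<close> back to \<open>z\<close>.\<close>

lemma ktrans_L11_deriv:
  assumes h: "continuous_on {-1..1} h" and p'_cont: "continuous_on {-1..1} p'"
    and p': "\<And>w. w \<in> {-1..1} \<Longrightarrow> ((\<lambda>w. lam w * h w) has_real_derivative p' w) (at w within {-1..1})"
    and h1: "h 1 = 0" and z: "z \<in> {-1..1}"
  shows "(ktrans L11 h has_real_derivative
     (- lam' z * ktrans L11 h z - c z * ktrans L12 h z + ktrans L11 p' z - L11 z (-1) * (lam (-1) * h (-1))) / lam z)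
       (at z within {-1..1})"
proof -
  let ?F = "\<lambda>z w. - lam' z * L11 z w - c z * L12 z w"
  have Fc: "continuous_on kernE (\<lambda>(z, w). ?F z w)"
    using continuous_on_kernE_coeff[OF lam'_cont] continuous_on_kernE_coeff[OF c_cont] L11_cont L12_cont
    unfolding case_prod_unfold by (intro continuous_intros)
  interpret K: kernel_chart lam lam' mu mu' b c L11 L12 sig X L11 ?F lam X h p'
    using L11_cont Fc L11_char h p'_cont p' h1 X'_in X_mem_iff
    by unfold_locales auto
  have d: "((\<lambda>s. ktrans L11 h (X s)) has_real_derivative
     ktrans ?F h z + ktrans L11 p' z - L11 z (-1) * (lam (-1) * h (-1)) + 0) (at (sig z) within {ra..rb})"
    using K.ktrans_chart_deriv[of "\<lambda>_. 0" "sig z"] sig_mem[OF z] L11_diag[of "- X s" for s] X_mem_iff by auto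
  have s: "(sig has_real_derivative 1 / lam z) (at z within {-1..1})"
  proof -
    have "max (-1) (min 1 z) = z" using z by auto
    then show ?thesis using sig'[of z] by (simp add: has_field_derivative_at_within)
  qed
  have "sig ` {-1..1} \<subseteq> {ra..rb}" using sig_mem by auto
  note D = DERIV_image_chain[OF has_field_derivative_subset[OF d this] s]
  have "ktrans ?F h z = - lam' z * ktrans L11 h z + (- c z) * ktrans L12 h z"
    using ktrans_lin[OF L11_cont L12_cont h, of "\<lambda>z. - lam' z" "\<lambda>z. - c z" z] by simp
  with D show ?thesis by (simp add: o_def)
qed

text \<open>The chart is \<open>z = - X s\<close>, whose velocity is
  \<open>- lam (X s) = - mu z\<close>. The moving edge is \<open>z = w\<close>; there
  \<open>refl'\<close> turns the quotient prescribed for \<open>L12\<close> into \<open>b\<close>.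
  The resulting term \<open>- b z * h z\<close> cancels the contribution of \<open>h\<close> itself
  to the coupling \<open>b z * phi z\<close> in \<open>M_deriv\<close>.\<close>

lemma ktrans_L12_deriv:
  assumes h: "continuous_on {-1..1} h" and p'_cont: "continuous_on {-1..1} p'"
    and p': "\<And>w. w \<in> {-1..1} \<Longrightarrow> ((\<lambda>w. lam w * h w) has_real_derivative p' w) (at w within {-1..1})"
    and h1: "h 1 = 0" and z: "z \<in> {-1..1}"
  shows "(ktrans L12 h has_real_derivative
     (b z * ktrans L11 h z - mu' z * ktrans L12 h z - ktrans L12 p' z + L12 z (-1) * (lam (-1) * h (-1))
       - b z * h z) / mu z) (at z within {-1..1})"
proof -
  let ?F = "\<lambda>z w. - b z * L11 z w + mu' z * L12 z w"
  have Fc: "continuous_on kernE (\<lambda>(z, w). ?F z w)"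
    using continuous_on_kernE_coeff[OF mu'_cont] continuous_on_kernE_coeff[OF b_cont] L11_cont L12_cont
    unfolding case_prod_unfold by (intro continuous_intros)
  have z1: "((\<lambda>s. - X s) has_real_derivative - mu (- X s)) (at s)" if "s \<in> {ra..rb}" for s
  proof -
    have "X s \<in> {-1..1}" using that X_mem_iff by blast
    then show ?thesis using DERIV_minus[OF X'_in[of s]] mu_eq[of "- X s"] by simp
  qed
  interpret K: kernel_chart lam lam' mu mu' b c L11 L12 sig X L12 ?F "\<lambda>z. - mu z" "\<lambda>s. - X s" h p'
    using L12_cont Fc L12_char h p'_cont p' h1 z1
    by unfold_locales auto
  have mz: "-z \<in> {-1..1}" using z by auto
  have bd: "refl' s * (L12 (- X s) (- X s) * (lam (- X s) * h (- X s))) = b (- X s) * h (- X s)"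
    if "s \<in> {ra..rb}" for s
  proof -
    have m: "X s \<in> {-1..1}" "- X s \<in> {-1..1}" using that X_mem_iff[of s] by auto
    have "lam (X s) > 0" "lam (- X s) > 0" using m lam_pos by blast+
    moreover have "L12 (- X s) (- X s) = b (- X s) / (lam (- X s) + lam (X s))"
      using L12_diag[OF m(2)] mu_eq[OF m(2)] by simp
    ultimately show ?thesis by (simp add: refl'_def field_simps)
  qed
  have bdc: "continuous_on {ra..rb} (\<lambda>s. b (- X s) * h (- X s))"
    using X_mem_iff by (intro continuous_intros continuous_on_compose2[OF b_cont] continuous_on_compose2[OF h] X_cont)
      (auto simp: minus_le_iff le_minus_iff)
  have d: "((\<lambda>s. ktrans L12 h (- X s)) has_real_derivative
     ktrans ?F h z + ktrans L12 p' z - L12 z (-1) * (lam (-1) * h (-1)) + b z * h z) (at (sig (- z)) within {ra..rb})"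
    using K.ktrans_chart_deriv[OF bdc bd sig_mem[OF mz]] by simp
  have s: "((\<lambda>z. sig (- z)) has_real_derivative - (1 / mu z)) (at z within {-1..1})"
  proof -
    have "max (-1) (min 1 (-z)) = -z" using z by auto
    then have "(sig has_real_derivative 1 / mu z) (at (-z))"
      using sig'[of "-z"] mu_eq[OF z] by simp
    then have "((\<lambda>z. sig (- z)) has_real_derivative 1 / mu z * (-1)) (at z)"
      by (rule DERIV_chain2[where g = uminus]) (auto intro!: derivative_eq_intros)
    then show ?thesis by (simp add: has_field_derivative_at_within)
  qed
  have "(\<lambda>z. sig (- z)) ` {-1..1} \<subseteq> {ra..rb}" using sig_mem by (auto simp: ra_def rb_def)
  note D = DERIV_image_chain[OF has_field_derivative_subset[OF d this] s]
  have eq: "ktrans ?F h z = - b z * ktrans L11 h z + mu' z * ktrans L12 h z"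
    using ktrans_lin[OF L11_cont L12_cont h, of "\<lambda>z. - b z" mu' z] by simp
  have D': "(ktrans L12 h has_real_derivative (ktrans ?F h z + ktrans L12 p' z
      - L12 z (-1) * (lam (-1) * h (-1)) + b z * h z) * - (1 / mu z)) (at z within {-1..1})"
    using D by (simp add: o_def)
  show ?thesis
    by (rule DERIV_cong[OF D']) (unfold eq, use mu_pos[OF z] in \<open>simp add: field_simps\<close>)
qed

end

text \<open>What the argument for \<alpha> sees of the closed loop: the first feedback law, and the
  equation for \<open>v\<close> tested with functions vanishing at both ends, as
  \<open>- ktrans L12 h\<close> does. In this form the original system and its reflection are both
  instances.\<close>

locale half_system = kernel_flow +
  fixes u v :: "real \<Rightarrow> real \<Rightarrow> real"
  assumes u_L2: "\<And>t. t \<ge> 0 \<Longrightarrow> L2_on_I (\<lambda>w. u w t)" and v_L2: "\<And>t. t \<ge> 0 \<Longrightarrow> L2_on_I (\<lambda>w. v w t)"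
    and u_cont: "\<And>t. t \<ge> 0 \<Longrightarrow> ((\<lambda>s. integral {-1..1} (\<lambda>w. (u w s - u w t)\<^sup>2)) \<longlongrightarrow> 0) (at t within {0..})"
    and v_cont: "\<And>t. t \<ge> 0 \<Longrightarrow> ((\<lambda>s. integral {-1..1} (\<lambda>w. (v w s - v w t)\<^sup>2)) \<longlongrightarrow> 0) (at t within {0..})"
    and weak_u: "\<And>phi phiw phit. test_fun phi phiw phit \<Longrightarrow> (\<And>t. phi 1 t = 0) \<Longrightarrow>
        integral {0..} (\<lambda>t. integral {-1..1} (\<lambda>w.
            u w t * (phit w t + lam' w * phi w t + lam w * phiw w t) + b w * v w t * phi w t))
        + integral {0..} (\<lambda>t. lam (-1) * U1_fb L11 L12 u v t * phi (-1) t) = 0"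
    and weak_v: "\<And>psi psiw psit. test_fun psi psiw psit \<Longrightarrow> (\<And>t. psi (-1) t = 0) \<Longrightarrow> (\<And>t. psi 1 t = 0) \<Longrightarrow>
        integral {0..} (\<lambda>t. integral {-1..1} (\<lambda>w.
            v w t * (psit w t - mu' w * psi w t - mu w * psiw w t) + c w * u w t * psi w t)) = 0"
begin

lemma uv_int: "t \<ge> 0 \<Longrightarrow> (\<lambda>w. u w t) absolutely_integrable_on {-1..1}"
  "t \<ge> 0 \<Longrightarrow> (\<lambda>w. v w t) absolutely_integrable_on {-1..1}"
  using u_L2 v_L2 L2_on_I_absolutely_integrable by auto

definition pu where "pu g t = integral {-1..1} (\<lambda>w. u w t * g w)"
definition pv where "pv g t = integral {-1..1} (\<lambda>w. v w t * g w)"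

lemma pu_lin: "t \<ge> 0 \<Longrightarrow> continuous_on {-1..1} f \<Longrightarrow> continuous_on {-1..1} g \<Longrightarrow>
   pu (\<lambda>w. x * f w + y * g w) t = x * pu f t + y * pu g t"
  and pv_lin: "t \<ge> 0 \<Longrightarrow> continuous_on {-1..1} f \<Longrightarrow> continuous_on {-1..1} g \<Longrightarrow>
   pv (\<lambda>w. x * f w + y * g w) t = x * pv f t + y * pv g t"
proof -
  assume a: "t \<ge> 0" "continuous_on {-1..1} f" "continuous_on {-1..1} g"
  have "integral {-1..1} (\<lambda>w. q w t * (x * f w + y * g w)) =
     x * integral {-1..1} (\<lambda>w. q w t * f w) + y * integral {-1..1} (\<lambda>w. q w t * g w)"
    if q: "(\<lambda>w. q w t) absolutely_integrable_on {-1..1}" for q :: "real \<Rightarrow> real \<Rightarrow> real"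
  proof -
    have "integral {-1..1} (\<lambda>w. q w t * (x * f w + y * g w)) =
      integral {-1..1} (\<lambda>w. x * (q w t * f w) + y * (q w t * g w))" by (simp add: algebra_simps)
    also have "\<dots> = integral {-1..1} (\<lambda>w. x * (q w t * f w)) + integral {-1..1} (\<lambda>w. y * (q w t * g w))"
      by (intro Henstock_Kurzweil_Integration.integral_add integrable_on_mult_right integrable_mult_continuous q a)
    finally show ?thesis by simp
  qed
  from this[OF uv_int(1)] this[OF uv_int(2)] a
  show "pu (\<lambda>w. x * f w + y * g w) t = x * pu f t + y * pu g t"
    "pv (\<lambda>w. x * f w + y * g w) t = x * pv f t + y * pv g t"
    by (simp_all add: pu_def pv_def)
qed

lemma pu_cong: "(\<And>w. w \<in> {-1..1} \<Longrightarrow> f w = g w) \<Longrightarrow> pu f t = pu g t"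
  and pv_cong: "(\<And>w. w \<in> {-1..1} \<Longrightarrow> f w = g w) \<Longrightarrow> pv f t = pv g t"
  unfolding pu_def pv_def by (auto intro!: integral_cong)

lemma pu_cont: "continuous_on {-1..1} g \<Longrightarrow> continuous_on {0..} (pu g)"
  and pv_cont: "continuous_on {-1..1} g \<Longrightarrow> continuous_on {0..} (pv g)"
  unfolding pu_def[abs_def] pv_def[abs_def]
  by (intro continuous_on_pairing u_L2 v_L2 u_cont v_cont; simp)+

lemma weak_u_product:
  assumes phi: "\<And>w. w \<in> {-1..1} \<Longrightarrow> (phi has_real_derivative phi' w) (at w within {-1..1})"
    and phi': "continuous_on {-1..1} phi'" and phi1: "phi 1 = 0"
    and k: "\<And>t. (k has_real_derivative k' t) (at t)" "continuous_on UNIV k'"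
    and ab: "0 < ta" "ta < tb" and k0: "\<And>t. t \<notin> {ta..tb} \<Longrightarrow> k t = 0"
  shows "integral {ta..tb} (\<lambda>t. k' t * pu phi t + k t * (pu (\<lambda>w. lam' w * phi w + lam w * phi' w) t
     + pv (\<lambda>w. b w * phi w) t)) + integral {ta..tb} (\<lambda>t. k t * (lam (-1) * phi (-1) * U1_fb L11 L12 u v t)) = 0"
proof -
  have phic: "continuous_on {-1..1} phi" using phi by (rule DERIV_continuous_on)
  obtain Phi where Phi: "\<And>w. w \<in> {-1..1} \<Longrightarrow> Phi w = phi w"
    and T: "test_fun (\<lambda>w t. Phi w * k t) (\<lambda>w t. phi' (max (-1) (min 1 w)) * k t) (\<lambda>w t. Phi w * k' t)"
    using product_test_fun[OF phi phi' k ab k0] by blast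
  let ?I = "\<lambda>t. integral {-1..1} (\<lambda>w. u w t * (Phi w * k' t + lam' w * (Phi w * k t) + lam w * (phi' (max (-1) (min 1 w)) * k t))
      + b w * v w t * (Phi w * k t))"
  let ?J = "\<lambda>t. lam (-1) * U1_fb L11 L12 u v t * (Phi (-1) * k t)"
  have k'0: "k' t = 0" if "t \<notin> {ta..tb}" for t by (rule deriv_zero_outside[OF k(1) k0 that])
  have "integral {0..} ?I + integral {0..} ?J = 0"
    by (rule weak_u[OF T]) (simp add: Phi phi1)
  moreover have "integral {0..} ?I = integral {ta..tb} ?I"
    using ab k0 k'0 by (intro integral_eq_on_support) auto
  moreover have "integral {0..} ?J = integral {ta..tb} ?J"
    using ab k0 by (intro integral_eq_on_support) auto
  moreover have "integral {ta..tb} ?I = integral {ta..tb} (\<lambda>t. k' t * pu phi t + k t * (pu (\<lambda>w. lam' w * phi w + lam w * phi' w) t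
     + pv (\<lambda>w. b w * phi w) t))"
  proof (rule integral_cong)
    fix t assume "t \<in> {ta..tb}"
    then have t: "t \<ge> 0" using ab by auto
    have c: "continuous_on {-1..1} (\<lambda>w. lam' w * phi w + lam w * phi' w)" "continuous_on {-1..1} (\<lambda>w. b w * phi w)"
      by (intro continuous_intros lam'_cont lam_cont phic phi' b_cont)+
    have "?I t = integral {-1..1} (\<lambda>w. u w t * (k' t * phi w + k t * (lam' w * phi w + lam w * phi' w))
       + v w t * (k t * (b w * phi w) + 0 * phi w))"
      by (rule integral_cong) (auto simp: Phi algebra_simps max_def min_def)
    also have "\<dots> = pu (\<lambda>w. k' t * phi w + k t * (lam' w * phi w + lam w * phi' w)) t + pv (\<lambda>w. k t * (b w * phi w) + 0 * phi w) t"
      unfolding pu_def pv_def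
      by (intro Henstock_Kurzweil_Integration.integral_add integrable_mult_continuous uv_int t continuous_intros c phic)
    finally show "?I t = k' t * pu phi t + k t * (pu (\<lambda>w. lam' w * phi w + lam w * phi' w) t + pv (\<lambda>w. b w * phi w) t)"
      unfolding pu_lin[OF t phic c(1)] pv_lin[OF t c(2) phic] by (simp add: algebra_simps)
  qed
  moreover have "integral {ta..tb} ?J = integral {ta..tb} (\<lambda>t. k t * (lam (-1) * phi (-1) * U1_fb L11 L12 u v t))"
    by (rule integral_cong) (simp add: Phi)
  ultimately show ?thesis by simp
qed

lemma weak_v_product:
  assumes psi: "\<And>w. w \<in> {-1..1} \<Longrightarrow> (psi has_real_derivative psi' w) (at w within {-1..1})"
    and psi': "continuous_on {-1..1} psi'" and psi1: "psi 1 = 0" "psi (-1) = 0"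
    and k: "\<And>t. (k has_real_derivative k' t) (at t)" "continuous_on UNIV k'"
    and ab: "0 < ta" "ta < tb" and k0: "\<And>t. t \<notin> {ta..tb} \<Longrightarrow> k t = 0"
  shows "integral {ta..tb} (\<lambda>t. k' t * pv psi t + k t * (pv (\<lambda>w. - mu' w * psi w - mu w * psi' w) t
     + pu (\<lambda>w. c w * psi w) t)) = 0"
proof -
  have psic: "continuous_on {-1..1} psi" using psi by (rule DERIV_continuous_on)
  obtain Psi where Psi: "\<And>w. w \<in> {-1..1} \<Longrightarrow> Psi w = psi w"
    and T: "test_fun (\<lambda>w t. Psi w * k t) (\<lambda>w t. psi' (max (-1) (min 1 w)) * k t) (\<lambda>w t. Psi w * k' t)"
    using product_test_fun[OF psi psi' k ab k0] by blast
  let ?I = "\<lambda>t. integral {-1..1} (\<lambda>w. v w t * (Psi w * k' t - mu' w * (Psi w * k t) - mu w * (psi' (max (-1) (min 1 w)) * k t))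
      + c w * u w t * (Psi w * k t))"
  have k'0: "k' t = 0" if "t \<notin> {ta..tb}" for t by (rule deriv_zero_outside[OF k(1) k0 that])
  have "integral {0..} ?I = 0"
    by (rule weak_v[OF T]) (simp_all add: Psi psi1)
  moreover have "integral {0..} ?I = integral {ta..tb} ?I"
    using ab k0 k'0 by (intro integral_eq_on_support) auto
  moreover have "integral {ta..tb} ?I = integral {ta..tb} (\<lambda>t. k' t * pv psi t + k t * (pv (\<lambda>w. - mu' w * psi w - mu w * psi' w) t
     + pu (\<lambda>w. c w * psi w) t))"
  proof (rule integral_cong)
    fix t assume "t \<in> {ta..tb}"
    then have t: "t \<ge> 0" using ab by auto
    have c: "continuous_on {-1..1} (\<lambda>w. - mu' w * psi w - mu w * psi' w)" "continuous_on {-1..1} (\<lambda>w. c w * psi w)"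
      by (intro continuous_intros mu'_cont mu_cont psic psi' c_cont)+
    have "?I t = integral {-1..1} (\<lambda>w. v w t * (k' t * psi w + k t * (- mu' w * psi w - mu w * psi' w))
       + u w t * (k t * (c w * psi w) + 0 * psi w))"
      by (rule integral_cong) (auto simp: Psi algebra_simps max_def min_def)
    also have "\<dots> = pv (\<lambda>w. k' t * psi w + k t * (- mu' w * psi w - mu w * psi' w)) t + pu (\<lambda>w. k t * (c w * psi w) + 0 * psi w) t"
      unfolding pu_def pv_def
      by (intro Henstock_Kurzweil_Integration.integral_add integrable_mult_continuous uv_int t continuous_intros c psic)
    finally show "?I t = k' t * pv psi t + k t * (pv (\<lambda>w. - mu' w * psi w - mu w * psi' w) t + pu (\<lambda>w. c w * psi w) t)"
      unfolding pv_lin[OF t psic c(1)] pu_lin[OF t c(2) psic] by (simp add: algebra_simps)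
  qed
  ultimately show ?thesis by simp
qed

text \<open>The pairing of \<open>h\<close> with the transformed state \<open>\<alpha>\<close>.\<close>

definition M where "M h t = pu (\<lambda>z. h z - ktrans L11 h z) t - pv (ktrans L12 h) t"

lemma M_cont: "continuous_on {-1..1} h \<Longrightarrow> continuous_on {0..} (M h)"
  unfolding M_def[abs_def]
  by (intro continuous_intros pu_cont pv_cont ktrans_continuous L11_cont L12_cont)

text \<open>The pair \<open>phi\<close>, \<open>psi\<close> solves the adjoint system, with
  \<open>p'\<close> the derivative of the product of \<open>lam\<close> and \<open>h\<close>, up to
  the kernel sections \<open>q * L11 z (-1)\<close> and \<open>q * L12 z (-1)\<close>. Paired with
  the state these give \<open>- q * U1\<close>, which cancels the boundary term of the weak
  formulation, because \<open>phi (-1) = h (-1)\<close>.\<close>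

lemma M_deriv:
  assumes h: "\<And>w. w \<in> {-1..1} \<Longrightarrow> (h has_real_derivative h' w) (at w within {-1..1})"
    and h': "continuous_on {-1..1} h'" and h1: "h 1 = 0" and t: "t > 0"
  shows "(M h has_real_derivative M (\<lambda>w. lam' w * h w + lam w * h' w) t) (at t)"
proof -
  define p' where "p' w = lam' w * h w + lam w * h' w" for w
  have hc: "continuous_on {-1..1} h" using h by (rule DERIV_continuous_on)
  have p'c: "continuous_on {-1..1} p'"
    unfolding p'_def by (intro continuous_intros lam'_cont lam_cont hc h')
  have p': "((\<lambda>w. lam w * h w) has_real_derivative p' w) (at w within {-1..1})" if "w \<in> {-1..1}" for w
    unfolding p'_def by (rule DERIV_cong[OF DERIV_mult[OF lam_C1[OF that] h[OF that]]]) simp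
  have Lend: "continuous_on {-1..1} (\<lambda>z. L11 z (-1))" "continuous_on {-1..1} (\<lambda>z. L12 z (-1))"
  proof -
    have "continuous_on {-1..1} (\<lambda>z. (\<lambda>(z, w). L11 z w) (z, -1))"
      by (intro continuous_on_compose2[OF L11_cont]) (auto intro!: continuous_intros simp: kernE_def)
    then show "continuous_on {-1..1} (\<lambda>z. L11 z (-1))" by simp
    have "continuous_on {-1..1} (\<lambda>z. (\<lambda>(z, w). L12 z w) (z, -1))"
      by (intro continuous_on_compose2[OF L12_cont]) (auto intro!: continuous_intros simp: kernE_def)
    then show "continuous_on {-1..1} (\<lambda>z. L12 z (-1))" by simp
  qed
  define q where "q = lam (-1) * h (-1)"
  define g1 where "g1 z = (- lam' z * ktrans L11 h z - c z * ktrans L12 h z + ktrans L11 p' z - L11 z (-1) * q) / lam z" for z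
  define g2 where "g2 z = (b z * ktrans L11 h z - mu' z * ktrans L12 h z - ktrans L12 p' z + L12 z (-1) * q - b z * h z) / mu z" for z
  have kc: "continuous_on {-1..1} (ktrans L11 h)" "continuous_on {-1..1} (ktrans L12 h)"
     "continuous_on {-1..1} (ktrans L11 p')" "continuous_on {-1..1} (ktrans L12 p')"
    by (intro ktrans_continuous L11_cont L12_cont hc p'c)+
  have ne: "lam z \<noteq> 0" "mu z \<noteq> 0" if "z \<in> {-1..1}" for z
    using lam_pos[OF that] mu_pos[OF that] by auto
  have g1: "(ktrans L11 h has_real_derivative g1 z) (at z within {-1..1})"
    and g2: "(ktrans L12 h has_real_derivative g2 z) (at z within {-1..1})" if "z \<in> {-1..1}" for z
    unfolding g1_def g2_def q_def
    using ktrans_L11_deriv[OF hc p'c p' h1 that] ktrans_L12_deriv[OF hc p'c p' h1 that] by blast+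
  have gc: "continuous_on {-1..1} g1" "continuous_on {-1..1} g2"
    unfolding g1_def g2_def using ne
    by (intro continuous_intros kc lam'_cont c_cont b_cont mu'_cont lam_cont mu_cont Lend hc; simp)+
  define phi where "phi z = h z - ktrans L11 h z" for z
  define phi' where "phi' z = h' z - g1 z" for z
  define psi where "psi z = - ktrans L12 h z" for z
  define psi' where "psi' z = - g2 z" for z
  have phi: "(phi has_real_derivative phi' z) (at z within {-1..1})"
    and psi: "(psi has_real_derivative psi' z) (at z within {-1..1})" if "z \<in> {-1..1}" for z
    unfolding phi_def phi'_def psi_def psi'_def
    by (intro derivative_intros h g1 g2 that)+
  have c': "continuous_on {-1..1} phi'" "continuous_on {-1..1} psi'" "continuous_on {-1..1} phi" "continuous_on {-1..1} psi"
    unfolding phi_def phi'_def psi_def psi'_def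
    by (intro continuous_intros h' gc hc kc)+
  have ends: "phi 1 = 0" "phi (-1) = h (-1)" "psi 1 = 0" "psi (-1) = 0"
    by (simp_all add: phi_def psi_def ktrans_end h1)
  have dual1: "lam' z * phi z + lam z * phi' z + c z * psi z = p' z - ktrans L11 p' z + q * L11 z (-1)"
    and dual2: "b z * phi z - mu' z * psi z - mu z * psi' z = - ktrans L12 p' z + q * L12 z (-1)"
    if "z \<in> {-1..1}" for z
    using ne[OF that] by (simp_all add: phi_def phi'_def psi_def psi'_def g1_def g2_def p'_def field_simps)
  have fb: "U1_fb L11 L12 u v t = - pu (\<lambda>z. L11 z (-1)) t - pv (\<lambda>z. L12 z (-1)) t" for t
    by (simp add: U1_fb_def pu_def pv_def)
  show ?thesis
    unfolding p'_def[symmetric]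
  proof (rule weak_derivative_imp_derivative[OF _ _ _ t])
    show "continuous_on {0<..} (M h)" "continuous_on {0<..} (M p')"
      using M_cont[OF hc] M_cont[OF p'c] by (auto intro: continuous_on_subset)
    fix k k' :: "real \<Rightarrow> real" and a b' :: real
    assume ab: "0 < a" "a < b'" and k: "\<And>t. (k has_real_derivative k' t) (at t)" "continuous_on UNIV k'"
      and k0: "\<And>t. t \<notin> {a..b'} \<Longrightarrow> k t = 0"
    let ?A = "\<lambda>t. k' t * pu phi t + k t * (pu (\<lambda>w. lam' w * phi w + lam w * phi' w) t + pv (\<lambda>w. b w * phi w) t)"
    let ?B = "\<lambda>t. k t * (lam (-1) * phi (-1) * U1_fb L11 L12 u v t)"
    let ?C = "\<lambda>t. k' t * pv psi t + k t * (pv (\<lambda>w. - mu' w * psi w - mu w * psi' w) t + pu (\<lambda>w. c w * psi w) t)"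
    have eqs: "integral {a..b'} ?A + integral {a..b'} ?B = 0" "integral {a..b'} ?C = 0"
      by (rule weak_u_product[OF phi c'(1) ends(1) k ab k0] weak_v_product[OF psi c'(2) ends(3,4) k ab k0]; assumption)+
    have kc': "continuous_on {a..b'} k" "continuous_on {a..b'} k'"
      using k by (meson DERIV_continuous_on has_field_derivative_at_within continuous_on_subset subset_UNIV)+
    have pc: "continuous_on {a..b'} (pu g)" "continuous_on {a..b'} (pv g)" if "continuous_on {-1..1} g" for g
      using pu_cont[OF that] pv_cont[OF that] ab by (auto intro: continuous_on_subset)
    have cc: "continuous_on {-1..1} (\<lambda>w. lam' w * phi w + lam w * phi' w)" "continuous_on {-1..1} (\<lambda>w. b w * phi w)"
       "continuous_on {-1..1} (\<lambda>w. - mu' w * psi w - mu w * psi' w)" "continuous_on {-1..1} (\<lambda>w. c w * psi w)"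
      by (intro continuous_intros lam'_cont lam_cont b_cont c_cont mu'_cont mu_cont c')+
    have i: "?A integrable_on {a..b'}" "?B integrable_on {a..b'}" "?C integrable_on {a..b'}"
      unfolding fb by (intro integrable_continuous_real continuous_intros kc' pc cc Lend c')+
    have "integral {a..b'} (\<lambda>t. k' t * M h t + k t * M p' t) = integral {a..b'} (\<lambda>t. ?A t + ?B t + ?C t)"
    proof (rule integral_cong)
      fix t assume "t \<in> {a..b'}"
      then have t: "t \<ge> 0" using ab by auto
      have m: "M h t = pu phi t + pv psi t"
      proof -
        have "pv psi t = pv (\<lambda>z. (-1) * ktrans L12 h z + 0 * ktrans L12 h z) t" by (simp add: psi_def[abs_def])
        also have "\<dots> = - pv (ktrans L12 h) t" by (subst pv_lin[OF t kc(2) kc(2)]) simp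
        finally show ?thesis by (simp add: M_def phi_def[abs_def])
      qed
      have 1: "pu (\<lambda>w. lam' w * phi w + lam w * phi' w) t + pu (\<lambda>w. c w * psi w) t =
          pu (\<lambda>z. p' z - ktrans L11 p' z) t + q * pu (\<lambda>z. L11 z (-1)) t"
      proof -
        have "pu (\<lambda>w. lam' w * phi w + lam w * phi' w) t + pu (\<lambda>w. c w * psi w) t =
           pu (\<lambda>w. 1 * (lam' w * phi w + lam w * phi' w) + 1 * (c w * psi w)) t"
          by (subst pu_lin[OF t cc(1) cc(4)]) simp
        also have "\<dots> = pu (\<lambda>z. 1 * (p' z - ktrans L11 p' z) + q * L11 z (-1)) t"
          using dual1 by (intro pu_cong) simp
        also have "\<dots> = pu (\<lambda>z. p' z - ktrans L11 p' z) t + q * pu (\<lambda>z. L11 z (-1)) t"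
          by (subst pu_lin[OF t _ Lend(1)]) (auto intro!: continuous_intros p'c kc)
        finally show ?thesis .
      qed
      have 2: "pv (\<lambda>w. - mu' w * psi w - mu w * psi' w) t + pv (\<lambda>w. b w * phi w) t =
          - pv (ktrans L12 p') t + q * pv (\<lambda>z. L12 z (-1)) t"
      proof -
        have "pv (\<lambda>w. - mu' w * psi w - mu w * psi' w) t + pv (\<lambda>w. b w * phi w) t =
           pv (\<lambda>w. 1 * (- mu' w * psi w - mu w * psi' w) + 1 * (b w * phi w)) t"
          by (subst pv_lin[OF t cc(3) cc(2)]) simp
        also have "\<dots> = pv (\<lambda>z. (-1) * ktrans L12 p' z + q * L12 z (-1)) t"
          using dual2 by (intro pv_cong) (simp add: algebra_simps)
        also have "\<dots> = - pv (ktrans L12 p') t + q * pv (\<lambda>z. L12 z (-1)) t"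
          by (subst pv_lin[OF t kc(4) Lend(2)]) simp
        finally show ?thesis .
      qed
      have "?A t + ?B t + ?C t = k' t * (pu phi t + pv psi t)
         + k t * ((pu (\<lambda>w. lam' w * phi w + lam w * phi' w) t + pu (\<lambda>w. c w * psi w) t)
           + (pv (\<lambda>w. - mu' w * psi w - mu w * psi' w) t + pv (\<lambda>w. b w * phi w) t) + q * U1_fb L11 L12 u v t)"
        by (simp add: algebra_simps q_def ends(2))
      also have "\<dots> = k' t * M h t + k t * M p' t"
        unfolding 1 2 m fb by (simp add: M_def algebra_simps)
      finally show "k' t * M h t + k t * M p' t = ?A t + ?B t + ?C t" ..
    qed
    also have "\<dots> = integral {a..b'} ?A + integral {a..b'} ?B + integral {a..b'} ?C"
      using i by (simp only: Henstock_Kurzweil_Integration.integral_add integrable_add)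
    finally show "integral {a..b'} (\<lambda>t. k' t * M h t + k t * M p' t) = 0" using eqs by simp
  qed
qed

end

section \<open>Transport of the transformed state\<close>

lemma compact_kernE: "compact kernE"
proof -
  have eq: "kernE = ({-1..1} \<times> {-1..1}) \<inter> {x. \<bar>fst x\<bar> \<le> \<bar>snd x\<bar>}"
    by (auto simp: kernE_def)
  have "closed {x :: real \<times> real. \<bar>fst x\<bar> \<le> \<bar>snd x\<bar>}"
    by (intro closed_Collect_le continuous_intros)
  then show ?thesis unfolding eq by (intro compact_Int_closed compact_Times compact_Icc)
qed

lemma kernel_bounded:
  fixes K :: "real \<Rightarrow> real \<Rightarrow> real"
  assumes "continuous_on kernE (\<lambda>(z, w). K z w)"
  obtains C where "C \<ge> 0" "\<And>z w. (z, w) \<in> kernE \<Longrightarrow> \<bar>K z w\<bar> \<le> C"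
proof -
  obtain C where C: "\<And>x. x \<in> kernE \<Longrightarrow> norm ((\<lambda>(z, w). K z w) x) \<le> C"
    using compact_imp_bounded[OF compact_continuous_image[OF assms compact_kernE]]
    unfolding bounded_iff by blast
  show ?thesis
  proof (rule that[of "max C 0"])
    show "\<bar>K z w\<bar> \<le> max C 0" if "(z, w) \<in> kernE" for z w
      using C[OF that] by simp
  qed simp
qed

lemma ktrans_cong:
  assumes "\<And>w. w \<in> {-1..1} \<Longrightarrow> h w = g w"
  shows "ktrans K h z = ktrans K g z"
proof -
  have "integral {\<bar>z\<bar>..1} (\<lambda>w. K z w * h w) = integral {\<bar>z\<bar>..1} (\<lambda>w. K z w * g w)"
    "integral {-1..-\<bar>z\<bar>} (\<lambda>w. K z w * h w) = integral {-1..-\<bar>z\<bar>} (\<lambda>w. K z w * g w)"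
    using assms by (intro integral_cong; auto)+
  then show ?thesis by (simp add: ktrans_def)
qed

lemma ktrans_lin_right:
  assumes K: "continuous_on kernE (\<lambda>(z, w). K z w)"
    and f: "continuous_on {-1..1} f" and g: "continuous_on {-1..1} g"
  shows "ktrans K (\<lambda>w. x * f w + y * g w) z = x * ktrans K f z + y * ktrans K g z"
proof -
  note i = ktrans_integrable[OF K f, of z] ktrans_integrable[OF K g, of z]
  have "integral S (\<lambda>w. K z w * (x * f w + y * g w)) =
     x * integral S (\<lambda>w. K z w * f w) + y * integral S (\<lambda>w. K z w * g w)"
    if "(\<lambda>w. K z w * f w) integrable_on S" "(\<lambda>w. K z w * g w) integrable_on S" for S
  proof -
    have "integral S (\<lambda>w. K z w * (x * f w + y * g w)) =
      integral S (\<lambda>w. x * (K z w * f w) + y * (K z w * g w))"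
      by (simp add: algebra_simps)
    also have "\<dots> = integral S (\<lambda>w. x * (K z w * f w)) + integral S (\<lambda>w. y * (K z w * g w))"
      using that by (intro Henstock_Kurzweil_Integration.integral_add integrable_on_mult_right)
    finally show ?thesis by simp
  qed
  then show ?thesis unfolding ktrans_def using i by (simp add: algebra_simps)
qed

lemma ktrans_bound:
  assumes K: "continuous_on kernE (\<lambda>(z, w). K z w)" and C: "\<And>z w. (z, w) \<in> kernE \<Longrightarrow> \<bar>K z w\<bar> \<le> C" "C \<ge> 0"
    and h: "continuous_on {-1..1} h" and r: "\<And>w. w \<in> {-1..1} \<Longrightarrow> \<bar>h w\<bar> \<le> r" and z: "z \<in> {-1..1}"
  shows "\<bar>ktrans K h z\<bar> \<le> 2 * C * r"
proof -
  have z1: "\<bar>z\<bar> \<le> 1" using z by auto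
  have b: "norm (K z w * h w) \<le> C * r" if "\<bar>z\<bar> \<le> \<bar>w\<bar>" "\<bar>w\<bar> \<le> 1" for w
    unfolding norm_mult using that C r
    by (intro mult_mono) (auto simp: kernE_iff abs_le_iff)
  have r0: "r \<ge> 0" using r[of 0] by auto
  have cont: "continuous_on S (\<lambda>w. K z w * h w)" if "S \<subseteq> {w. \<bar>z\<bar> \<le> \<bar>w\<bar> \<and> \<bar>w\<bar> \<le> 1}" for S
    using that by (intro continuous_intros kernel_section_continuous[OF K] continuous_on_subset[OF h])
      (force simp: abs_le_iff)+
  have "norm (integral {\<bar>z\<bar>..1} (\<lambda>w. K z w * h w)) \<le> C * r * (1 - \<bar>z\<bar>)"
    using z1 by (intro integral_bound cont b) auto
  moreover have "norm (integral {-1..-\<bar>z\<bar>} (\<lambda>w. K z w * h w)) \<le> C * r * (- \<bar>z\<bar> - (-1))"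
    using z1 by (intro integral_bound cont b) auto
  moreover have "C * r * (1 - \<bar>z\<bar>) \<le> C * r * 1"
    using C r0 by (intro mult_left_mono) auto
  ultimately show ?thesis
    using abs_triangle_ineq4[of "integral {\<bar>z\<bar>..1} (\<lambda>w. K z w * h w)" "integral {-1..-\<bar>z\<bar>} (\<lambda>w. K z w * h w)"]
    unfolding ktrans_def real_norm_def by (simp add: right_diff_distrib)
qed

context half_system
begin

lemma M_cong:
  assumes "\<And>w. w \<in> {-1..1} \<Longrightarrow> h w = g w"
  shows "M h t = M g t"
proof -
  have "ktrans K h = ktrans K g" for K :: "real \<Rightarrow> real \<Rightarrow> real"
    using assms by (intro ext ktrans_cong)
  then show ?thesis
    unfolding M_def using assms by (auto intro!: pu_cong)
qed

lemma M_lin: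
  assumes t: "t \<ge> 0" and f: "continuous_on {-1..1} f" and g: "continuous_on {-1..1} g"
  shows "M (\<lambda>w. x * f w + y * g w) t = x * M f t + y * M g t"
proof -
  note kc = ktrans_continuous[OF L11_cont f] ktrans_continuous[OF L11_cont g]
    ktrans_continuous[OF L12_cont f] ktrans_continuous[OF L12_cont g]
  have "pu (\<lambda>z. (x * f z + y * g z) - (x * ktrans L11 f z + y * ktrans L11 g z)) t =
     pu (\<lambda>z. x * (f z - ktrans L11 f z) + y * (g z - ktrans L11 g z)) t"
    by (simp add: algebra_simps)
  also have "\<dots> = x * pu (\<lambda>z. f z - ktrans L11 f z) t + y * pu (\<lambda>z. g z - ktrans L11 g z) t"
    by (intro pu_lin t continuous_intros f g kc)
  finally show ?thesis
    unfolding M_def ktrans_lin_right[OF L11_cont f g] ktrans_lin_right[OF L12_cont f g, abs_def]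
    using pv_lin[OF t kc(3,4)] by (simp add: algebra_simps)
qed

definition mass where "mass t = integral {-1..1} (\<lambda>w. \<bar>u w t\<bar>) + integral {-1..1} (\<lambda>w. \<bar>v w t\<bar>)"

lemma mass_nonneg: "t \<ge> 0 \<Longrightarrow> mass t \<ge> 0"
  unfolding mass_def
  by (intro add_nonneg_nonneg Henstock_Kurzweil_Integration.integral_nonneg absolutely_integrable_imp_abs_integrable uv_int) auto

lemma mass_eventually:
  assumes "t > 0"
  shows "\<forall>\<^sub>F s in nhds t. s > 0 \<and> mass s \<le> mass t + 2"
proof -
  have "\<forall>\<^sub>F s in at t within {0..}. mass s \<le> mass t + 2"
    using L1_eventually_bounded[OF u_L2 _ u_cont, of t] L1_eventually_bounded[OF v_L2 _ v_cont, of t] assms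
    by (auto simp: mass_def elim: eventually_elim2)
  moreover have "at t within {0..} = at t"
    using assms by (intro at_within_interior) auto
  ultimately have "\<forall>\<^sub>F s in at t. mass s \<le> mass t + 2" by simp
  then have "\<forall>\<^sub>F s in nhds t. mass s \<le> mass t + 2"
    by (auto simp: eventually_at_filter elim: eventually_mono)
  moreover have "\<forall>\<^sub>F s in nhds t. s > 0"
    using assms by (intro eventually_nhds_in_open[of "{0<..}", simplified]) auto
  ultimately show ?thesis by eventually_elim simp
qed

text \<open>The constant is independent of \<open>t\<close>, and \<open>h\<close> enters only
  through a bound of its values, so uniformly converging test functions can be paired with the state
  at varying times.\<close>

lemma M_bound:
  obtains C where "C \<ge> 0" "\<And>(h :: real \<Rightarrow> real) (r :: real) t. t \<ge> 0 \<Longrightarrow> continuous_on {-1..1} h \<Longrightarrow> (\<And>w. w \<in> {-1..1} \<Longrightarrow> \<bar>h w\<bar> \<le> r) \<Longrightarrow>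
     \<bar>M h t\<bar> \<le> C * r * mass t"
proof -
  obtain C1 where C1: "C1 \<ge> 0" "\<And>z w. (z, w) \<in> kernE \<Longrightarrow> \<bar>L11 z w\<bar> \<le> C1" using kernel_bounded[OF L11_cont] by blast
  obtain C2 where C2: "C2 \<ge> 0" "\<And>z w. (z, w) \<in> kernE \<Longrightarrow> \<bar>L12 z w\<bar> \<le> C2" using kernel_bounded[OF L12_cont] by blast
  define C where "C = 1 + 2 * C1 + 2 * C2"
  show ?thesis
  proof (rule that[of C])
    show "C \<ge> 0" using C1 C2 by (simp add: C_def)
    fix h :: "real \<Rightarrow> real" and r t :: real
    assume t: "t \<ge> 0" and h: "continuous_on {-1..1} h" and r: "\<And>w. w \<in> {-1..1} \<Longrightarrow> \<bar>h w\<bar> \<le> r"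
    have r0: "r \<ge> 0" using r[of 0] by auto
    have 1: "\<bar>pu (\<lambda>z. h z - ktrans L11 h z) t\<bar> \<le> C * r * integral {-1..1} (\<lambda>w. \<bar>u w t\<bar>)"
      unfolding pu_def
    proof (rule abs_integral_mult_le[OF uv_int(1)[OF t]])
      show "continuous_on {-1..1} (\<lambda>z. h z - ktrans L11 h z)"
        by (intro continuous_intros h ktrans_continuous L11_cont)
      fix z :: real assume z: "z \<in> {-1..1}"
      have "\<bar>h z - ktrans L11 h z\<bar> \<le> r + 2 * C1 * r"
        using r[OF z] ktrans_bound[OF L11_cont C1(2,1) h r z] by linarith
      also have "\<dots> \<le> C * r" using C2 r0 by (simp add: C_def algebra_simps)
      finally show "\<bar>h z - ktrans L11 h z\<bar> \<le> C * r" .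
    qed
    have 2: "\<bar>pv (ktrans L12 h) t\<bar> \<le> C * r * integral {-1..1} (\<lambda>w. \<bar>v w t\<bar>)"
      unfolding pv_def
    proof (rule abs_integral_mult_le[OF uv_int(2)[OF t]])
      show "continuous_on {-1..1} (ktrans L12 h)" by (intro h ktrans_continuous L12_cont)
      fix z :: real assume z: "z \<in> {-1..1}"
      have "\<bar>ktrans L12 h z\<bar> \<le> 2 * C2 * r"
        using ktrans_bound[OF L12_cont C2(2,1) h r z] by linarith
      also have "\<dots> \<le> C * r" using C1 r0 by (simp add: C_def algebra_simps)
      finally show "\<bar>ktrans L12 h z\<bar> \<le> C * r" .
    qed
    show "\<bar>M h t\<bar> \<le> C * r * mass t"
      using 1 2 unfolding M_def mass_def by (simp add: algebra_simps)
  qed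
qed

text \<open>In the travel time coordinate \<open>M (H P)\<close> satisfies \<open>d/dt M (H P) = M (H P')\<close>, i.e. evolving in time
  amounts to translating \<open>P\<close>.\<close>

definition H where "H P w = P (sig w) / lam w"

lemma H_cont:
  assumes "continuous_on UNIV P"
  shows "continuous_on {-1..1} (H P)"
proof -
  have "\<forall>w\<in>{-1..1}. lam w \<noteq> 0" using lam_pos by fastforce
  then show ?thesis
    unfolding H_def[abs_def]
    by (intro continuous_on_divide lam_cont continuous_on_compose2[OF assms] sig_cont) auto
qed

text \<open>For \<open>h = H P\<close> the product of \<open>lam\<close> and \<open>h\<close> is
  \<open>P\<close> composed with \<open>sig\<close>, and \<open>sig\<close> has slope
  \<open>1 / lam\<close>; hence \<open>lam' * h + lam * h'\<close> is \<open>H P'\<close>. The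
  condition on \<open>P\<close> gives \<open>h 1 = 0\<close>.\<close>

lemma M_H_deriv:
  assumes P: "\<And>s. (P has_real_derivative P' s) (at s)" and P': "continuous_on UNIV P'"
    and P0: "\<And>s. s \<ge> rb \<Longrightarrow> P s = 0" and t: "t > 0"
  shows "(M (H P) has_real_derivative M (H P') t) (at t)"
proof -
  have Pc: "continuous_on UNIV P"
    using P by (meson DERIV_continuous_on has_field_derivative_at_within)
  have pos: "lam w \<noteq> 0" if "w \<in> {-1..1}" for w using lam_pos[OF that] by simp
  define h' where "h' w = (P' (sig w) / lam w - P (sig w) / lam w * lam' w) / lam w" for w
  have h'c: "continuous_on {-1..1} h'"
    unfolding h'_def by (intro continuous_intros lam_cont lam'_cont continuous_on_compose2[OF Pc] continuous_on_compose2[OF P'] sig_cont)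
      (use pos in auto)
  have d: "(H P has_real_derivative h' w) (at w within {-1..1})"
    if w: "w \<in> {-1..1}" for w
  proof -
    have "max (-1) (min 1 w) = w" using w by auto
    then have "(sig has_real_derivative 1 / lam w) (at w)" using sig'[of w] by simp
    from DERIV_chain2[OF P this] have "((\<lambda>w. P (sig w)) has_real_derivative P' (sig w) * (1 / lam w)) (at w within {-1..1})"
      by (rule has_field_derivative_at_within)
    from DERIV_divide[OF this lam_C1[OF w] pos[OF w]] show ?thesis
      unfolding H_def[abs_def] by (rule DERIV_cong) (use pos[OF w] in \<open>simp add: h'_def field_simps\<close>)
  qed
  have "H P 1 = 0" using P0[of rb] by (simp add: H_def rb_def)
  from M_deriv[OF d h'c this t]
  have "(M (H P) has_real_derivative M (\<lambda>w. lam' w * H P w + lam w * h' w) t) (at t)" .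
  moreover have "M (\<lambda>w. lam' w * H P w + lam w * h' w) t = M (H P') t"
    by (rule M_cong) (use pos in \<open>simp add: H_def h'_def field_simps\<close>)
  ultimately show ?thesis by simp
qed

text \<open>Translation in time is traded for translation of \<open>P\<close>: the pairing
  \<open>f x\<close> of \<open>P\<close> shifted by \<open>x\<close> with the state at time
  \<open>t - x\<close> has derivative zero. At \<open>x = rb - ra\<close> the shifted
  \<open>P\<close> vanishes on \<open>{ra..rb}\<close>, and \<open>t > rb - ra\<close> keeps all
  times \<open>t - x\<close> positive, as \<open>M_deriv\<close> requires.\<close>

lemma M_zero:
  assumes P: "\<And>s. (P has_real_derivative P' s) (at s)" and P': "continuous_on UNIV P'"
    and P0: "\<And>s. s \<ge> rb \<Longrightarrow> P s = 0" and t: "t > rb - ra"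
  shows "M (H P) t = 0"
proof -
  let ?L = "rb - ra"
  have L: "?L > 0" using ra_less_rb by simp
  have Pc: "continuous_on UNIV P"
    using P by (meson DERIV_continuous_on has_field_derivative_at_within)
  define f where "f x = M (H (\<lambda>s. P (s + x))) (t - x)" for x
  have Pxc: "continuous_on UNIV (\<lambda>s. P (s + x))" "continuous_on UNIV (\<lambda>s. P' (s + x))" for x
    by (intro continuous_on_compose2[OF Pc] continuous_on_compose2[OF P'] continuous_intros; simp)+
  obtain C where C: "C \<ge> 0" "\<And>(h :: real \<Rightarrow> real) (r :: real) t. t \<ge> 0 \<Longrightarrow> continuous_on {-1..1} h \<Longrightarrow> (\<And>w. w \<in> {-1..1} \<Longrightarrow> \<bar>h w\<bar> \<le> r) \<Longrightarrow>
     \<bar>M h t\<bar> \<le> C * r * mass t"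
    using M_bound by blast
  obtain m where m: "m > 0" "\<And>w. w \<in> {-1..1} \<Longrightarrow> lam w \<ge> m"
  proof -
    obtain w0 where "w0 \<in> {-1..1::real}" "\<And>w. w \<in> {-1..1} \<Longrightarrow> lam w0 \<le> lam w"
      using continuous_attains_inf[OF compact_Icc _ lam_cont] by auto
    then show ?thesis using that[of "lam w0"] lam_pos by blast
  qed
  have f': "(f has_real_derivative 0) (at x)" if x: "x \<in> {0..?L}" for x
  proof -
    have tx: "t - x > 0" using x t by auto
    \<comment> \<open>The difference quotient of the translates. The quotient of \<open>f\<close>
      splits into the pairing of \<open>Q y\<close> at time \<open>t - y\<close>, which tends to
      that of the shifted \<open>P'\<close>, and the quotient in time for the fixed translate by
      \<open>x\<close>, which tends to its negative.\<close>
    define Q where "Q y s = (P (s + y) - P (s + x)) / (y - x)" for y s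
    have Qc: "continuous_on UNIV (Q y)" if "y \<noteq> x" for y
      unfolding Q_def[abs_def] using that by (intro continuous_intros Pxc) auto
    have B: "((\<lambda>y. (M (H (\<lambda>s. P (s + x))) (t - y) - M (H (\<lambda>s. P (s + x))) (t - x)) / (y - x)) \<longlongrightarrow>
        - M (H (\<lambda>s. P' (s + x))) (t - x)) (at x)"
    proof -
      have "(M (H (\<lambda>s. P (s + x))) has_real_derivative M (H (\<lambda>s. P' (s + x))) (t - x)) (at (t - x))"
      proof (rule M_H_deriv)
        show "((\<lambda>s. P (s + x)) has_real_derivative P' (s + x)) (at s)" for s
          using P[of "s + x"] by (simp add: DERIV_shift)
        show "P (s + x) = 0" if "s \<ge> rb" for s using that x by (intro P0) auto
      qed (use Pxc tx in auto)
      then have "((\<lambda>y. M (H (\<lambda>s. P (s + x))) (t - y)) has_real_derivative M (H (\<lambda>s. P' (s + x))) (t - x) * (-1)) (at x)"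
        by (rule DERIV_chain2[where g = "\<lambda>y. t - y"]) (auto intro!: derivative_eq_intros)
      then show ?thesis by (simp add: has_field_derivative_iff)
    qed
    have tend: "((\<lambda>y. t - y) \<longlongrightarrow> t - x) (at x)" by (intro tendsto_intros)
    have A1: "((\<lambda>y. M (H (\<lambda>s. P' (s + x))) (t - y)) \<longlongrightarrow> M (H (\<lambda>s. P' (s + x))) (t - x)) (at x)"
    proof (rule isCont_tendsto_compose[OF _ tend])
      have "continuous_on {0<..} (M (H (\<lambda>s. P' (s + x))))"
        using M_cont[OF H_cont[OF Pxc(2)]] by (rule continuous_on_subset) auto
      then show "isCont (M (H (\<lambda>s. P' (s + x)))) (t - x)"
        using tx by (auto simp: continuous_on_eq_continuous_at)
    qed
    \<comment> \<open>Test function and time vary together: \<open>Q y\<close> tends to the shifted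
      \<open>P'\<close> uniformly on \<open>{ra..rb}\<close>, while the mass of the state stays
      bounded near time \<open>t - x\<close>.\<close>
    have A2: "((\<lambda>y. M (H (Q y)) (t - y) - M (H (\<lambda>s. P' (s + x))) (t - y)) \<longlongrightarrow> 0) (at x)"
    proof (rule tendstoI)
      fix e :: real assume e: "e > 0"
      \<comment> \<open>\<open>K0\<close> bounds the factor supplied by \<open>M_bound\<close> at
        times near \<open>t - x\<close>; the added 1 in \<open>E\<close> covers
        \<open>K0 = 0\<close> and gives a strict inequality.\<close>
      define K0 where "K0 = C * (mass (t - x) + 2)"
      define E where "E = e / (K0 + 1)"
      have K0: "K0 \<ge> 0" using tx C(1) mass_nonneg[of "t - x"] by (simp add: K0_def)
      have E: "E > 0" using e K0 by (simp add: E_def)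
      \<comment> \<open>The margin 1 makes room for all intermediate points \<open>s + xi\<close>
        with \<open>\<bar>xi - x\<bar> < 1\<close>. The lower bound \<open>m\<close> of
        \<open>lam\<close> in the threshold \<open>E * m\<close> makes up for the division by
        \<open>lam\<close> in \<open>H\<close>.\<close>
      have "uniformly_continuous_on {ra + x - 1..rb + x + 1} P'"
        by (intro compact_uniformly_continuous continuous_on_subset[OF P']) auto
      then obtain d where d: "d > 0" "\<And>p q. p \<in> {ra + x - 1..rb + x + 1} \<Longrightarrow> q \<in> {ra + x - 1..rb + x + 1} \<Longrightarrow>
          \<bar>q - p\<bar> < d \<Longrightarrow> \<bar>P' q - P' p\<bar> < E * m"
        unfolding uniformly_continuous_on_def using E m(1) by (metis dist_real_def mult_pos_pos)
      have Qn: "\<bar>Q y s - P' (s + x)\<bar> \<le> E * m" if y: "y \<noteq> x" "\<bar>y - x\<bar> < min d 1" and s: "s \<in> {ra..rb}" for y s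
      proof -
        have *: "\<exists>xi. \<bar>xi - x\<bar> < \<bar>y - x\<bar> \<and> Q y s = P' (s + xi)"
        proof (cases "x < y")
          case True
          have "((\<lambda>r. P (s + r)) has_real_derivative P' (s + r)) (at r)" for r
            using P[of "r + s"] by (simp add: DERIV_shift add.commute)
          then obtain xi where "x < xi" "xi < y" "P (s + y) - P (s + x) = (y - x) * P' (s + xi)"
            using MVT2[OF True, of "\<lambda>r. P (s + r)" "\<lambda>r. P' (s + r)"] by blast
          then show ?thesis using True by (intro exI[of _ xi]) (simp add: Q_def)
        next
          case False
          then have yx: "y < x" using y by simp
          have "((\<lambda>r. P (s + r)) has_real_derivative P' (s + r)) (at r)" for r
            using P[of "r + s"] by (simp add: DERIV_shift add.commute)
          then obtain xi where "y < xi" "xi < x" "P (s + x) - P (s + y) = (x - y) * P' (s + xi)"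
            using MVT2[OF yx, of "\<lambda>r. P (s + r)" "\<lambda>r. P' (s + r)"] by blast
          then show ?thesis using yx by (intro exI[of _ xi]) (simp add: Q_def field_simps)
        qed
        then obtain xi where "\<bar>xi - x\<bar> < \<bar>y - x\<bar>" "Q y s = P' (s + xi)" by blast
        moreover from this y have "\<bar>xi - x\<bar> < d" "\<bar>xi - x\<bar> < 1" by linarith+
        ultimately show ?thesis
          using d(2)[of "s + x" "s + xi"] s by (simp add: abs_less_iff abs_le_iff)
      qed
      have "\<forall>\<^sub>F y in at x. \<bar>y - x\<bar> < min d 1"
        using d(1) by (auto simp: eventually_at dist_real_def intro!: exI[of _ "min d 1"])
      moreover have "\<forall>\<^sub>F y in at x. y \<noteq> x" by (simp add: eventually_at_filter)
      moreover have "\<forall>\<^sub>F y in at x. t - y > 0 \<and> mass (t - y) \<le> mass (t - x) + 2"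
        using filterlim_iff[THEN iffD1, OF tend, rule_format, OF mass_eventually[OF tx]] .
      ultimately show "\<forall>\<^sub>F y in at x. dist (M (H (Q y)) (t - y) - M (H (\<lambda>s. P' (s + x))) (t - y)) 0 < e"
      proof eventually_elim
        case (elim y)
        have diff: "M (H (Q y)) (t - y) - M (H (\<lambda>s. P' (s + x))) (t - y) =
           M (\<lambda>w. 1 * H (Q y) w + (-1) * H (\<lambda>s. P' (s + x)) w) (t - y)"
          using elim by (subst M_lin) (auto intro!: H_cont Qc Pxc)
        have "\<bar>M (\<lambda>w. 1 * H (Q y) w + (-1) * H (\<lambda>s. P' (s + x)) w) (t - y)\<bar> \<le> C * E * mass (t - y)"
        proof (rule C(2))
          show "continuous_on {-1..1} (\<lambda>w. 1 * H (Q y) w + (-1) * H (\<lambda>s. P' (s + x)) w)"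
            using elim by (intro continuous_intros H_cont Qc Pxc) auto
          fix w :: real assume w: "w \<in> {-1..1}"
          have "\<bar>Q y (sig w) - P' (sig w + x)\<bar> \<le> E * m" using elim sig_mem[OF w] by (intro Qn) auto
          also have "\<dots> \<le> E * lam w" using m(2)[OF w] E by simp
          finally have "\<bar>Q y (sig w) - P' (sig w + x)\<bar> / lam w \<le> E"
            using lam_pos[OF w] by (simp add: field_simps)
          then show "\<bar>1 * H (Q y) w + (-1) * H (\<lambda>s. P' (s + x)) w\<bar> \<le> E"
            using lam_pos[OF w] by (simp add: H_def abs_divide diff_divide_distrib[symmetric])
        qed (use elim in auto)
        also have "\<dots> \<le> C * E * (mass (t - x) + 2)"
          using elim C(1) E by (intro mult_left_mono mult_nonneg_nonneg) auto
        also have "\<dots> = K0 * E" by (simp add: K0_def)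
        also have "\<dots> < e" using e K0 by (simp add: E_def field_simps)
        finally show ?case unfolding dist_real_def diff by simp
      qed
    qed
    have "((\<lambda>y. M (H (Q y)) (t - y)) \<longlongrightarrow> M (H (\<lambda>s. P' (s + x))) (t - x)) (at x)"
      using tendsto_add[OF A2 A1] by simp
    from tendsto_add[OF this B]
    have lim: "((\<lambda>y. M (H (Q y)) (t - y) + (M (H (\<lambda>s. P (s + x))) (t - y) - M (H (\<lambda>s. P (s + x))) (t - x)) / (y - x)) \<longlongrightarrow> 0) (at x)"
      by simp
    have "\<forall>\<^sub>F y in at x. y \<noteq> x" by (simp add: eventually_at_filter)
    moreover have "\<forall>\<^sub>F y in at x. t - y > 0"
      using order_tendstoD(1)[OF tend tx] .
    ultimately have "\<forall>\<^sub>F y in at x. M (H (Q y)) (t - y) + (M (H (\<lambda>s. P (s + x))) (t - y) - M (H (\<lambda>s. P (s + x))) (t - x)) / (y - x)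
        = (f y - f x) / (y - x)"
    proof eventually_elim
      case (elim y)
      have "M (H (Q y)) (t - y) = M (\<lambda>w. (1 / (y - x)) * H (\<lambda>s. P (s + y)) w + (- 1 / (y - x)) * H (\<lambda>s. P (s + x)) w) (t - y)"
        using elim by (intro M_cong) (simp add: H_def Q_def diff_divide_distrib)
      also have "\<dots> = (1 / (y - x)) * M (H (\<lambda>s. P (s + y))) (t - y) + (- 1 / (y - x)) * M (H (\<lambda>s. P (s + x))) (t - y)"
        using elim by (intro M_lin H_cont Pxc) auto
      finally show ?case using elim by (simp add: f_def diff_divide_distrib add_divide_distrib)
    qed
    with lim have "((\<lambda>y. (f y - f x) / (y - x)) \<longlongrightarrow> 0) (at x)" by (rule Lim_transform_eventually)
    then show ?thesis by (simp add: has_field_derivative_iff)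
  qed
  have "f ?L = f 0"
  proof (rule DERIV_isconst_end[OF L])
    show "continuous_on {0..?L} f" using f' by (meson DERIV_continuous_on has_field_derivative_at_within)
    show "(f has_real_derivative 0) (at x)" if "0 < x" "x < ?L" for x using f' that by auto
  qed
  \<comment> \<open>Writing the zero function as a trivial combination lets \<open>M_lin\<close>
    evaluate its pairing.\<close>
  moreover have "f ?L = M (\<lambda>w. 0 * H P w + 0 * H P w) (t - ?L)"
    unfolding f_def
  proof (rule M_cong)
    fix w :: real assume "w \<in> {-1..1}"
    then show "H (\<lambda>s. P (s + ?L)) w = 0 * H P w + 0 * H P w"
      using sig_mem[of w] P0[of "sig w + ?L"] by (simp add: H_def)
  qed
  moreover have "M (\<lambda>w. 0 * H P w + 0 * H P w) (t - ?L) = 0"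
    using t by (subst M_lin) (auto intro!: H_cont Pc)
  ultimately show ?thesis by (simp add: f_def)
qed

end

section \<open>Vanishing of the transformed state\<close>

text \<open>A Dynkin system argument: half-lines are stable under intersection and generate the
  Borel sets, and \<open>I\<close> takes care of complements. A density whose integrals over all
  Borel sets vanish is zero almost everywhere.\<close>

lemma AE_zero_if_integral_lessThan_zero:
  fixes f :: "real \<Rightarrow> real"
  assumes f: "integrable lborel f" and I: "integral\<^sup>L lborel f = 0"
    and lt: "\<And>x. (LINT y:{..<x}|lborel. f y) = 0"
  shows "AE x in lborel. f x = 0"
proof (rule sigma_finite_measure.density_zero[OF sigma_finite_lborel f])
  fix A :: "real set" assume "A \<in> sets lborel"
  then have A: "A \<in> sigma_sets UNIV (range lessThan)"
    using borel_Iio[where ?'a = real] by (metis sets_lborel sets_measure_of top_greatest Pow_UNIV)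
  have sb: "B \<in> sets lborel" if "B \<in> sigma_sets UNIV (range lessThan)" for B :: "real set"
    using that borel_Iio[where ?'a = real] by (metis sets_lborel sets_measure_of top_greatest Pow_UNIV)
  have si: "set_integrable lborel B f" if "B \<in> sets lborel" for B
    unfolding set_integrable_def using that f by (rule integrable_mult_indicator)
  have "{..<x} \<inter> {..<y} = {..<min x y}" for x y :: real by auto
  then have "Int_stable (range lessThan :: real set set)" "range lessThan \<subseteq> Pow (UNIV :: real set)"
    by (auto simp: Int_stable_def)
  from this A show "(LINT x:A|lborel. f x) = 0"
  proof (induction rule: sigma_sets_induct_disjoint)
    case (basic A)
    then show ?case using lt by auto
  next
    case empty
    show ?case by (simp add: set_lebesgue_integral_def)
  next
    case (compl A)
    have "(LINT x:A \<union> (UNIV - A)|lborel. f x) = (LINT x:A|lborel. f x) + (LINT x:UNIV - A|lborel. f x)"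
      using compl sb by (intro set_integral_Un si sets.Diff) auto
    then show ?case using compl I by (simp add: set_lebesgue_integral_def)
  next
    case (union A)
    have m: "A i \<in> sets lborel" for i using union sb by auto
    have "(LINT x:(\<Union>i. A i)|lborel. f x) = (\<Sum>i. (LINT x:(A i)|lborel. f x))"
      using union m by (intro lebesgue_integral_countable_add si) (auto simp: disjoint_family_on_def)
    then show ?case using union by simp
  qed
qed

text \<open>The state is only Lebesgue measurable, while Fubini on the product of
  \<open>lborel\<close> with itself asks for Borel measurable functions.\<close>

lemma borel_representative:
  fixes f :: "real \<Rightarrow> real"
  assumes "f absolutely_integrable_on {a..b}"
  obtains g where "integrable lborel g" "\<And>x. x \<notin> {a..b} \<Longrightarrow> g x = 0" "negligible {x \<in> {a..b}. f x \<noteq> g x}"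
proof -
  let ?f = "\<lambda>x. indicator {a..b} x *\<^sub>R f x"
  have i: "integrable lebesgue ?f" using assms by (simp add: set_integrable_def)
  then obtain g where g: "g \<in> borel_measurable lborel" "AE x in lborel. ?f x = g x"
    using completion_ex_borel_measurable_real[of ?f lborel] borel_measurable_integrable by blast
  define h where "h x = indicator {a..b} x * g x" for x
  have hm: "h \<in> borel_measurable lborel" unfolding h_def using g(1) by measurable
  have ae: "AE x in lborel. ?f x = h x"
    using g(2)
  proof eventually_elim
    case (elim x)
    then show ?case by (cases "x \<in> {a..b}") (auto simp: h_def)
  qed
  then have ae': "AE x in lebesgue. ?f x = h x" by (rule AE_completion)
  have "integrable lebesgue h"
    by (rule integrable_cong_AE_imp[OF i _ ae'[THEN AE_mp]])
      (use hm in \<open>auto intro: measurable_completion\<close>)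
  then have hi: "integrable lborel h" using integrable_completion[OF hm] by simp
  from ae obtain N where N: "{x \<in> space lborel. \<not> ?f x = h x} \<subseteq> N" "N \<in> null_sets lborel"
    by (auto simp: eventually_ae_filter)
  have "negligible N" using N(2) by (simp add: negligible_iff_null_sets null_sets_completionI)
  then have "negligible {x \<in> {a..b}. f x \<noteq> h x}"
    by (rule negligible_subset) (use N(1) in auto)
  with hi show ?thesis by (intro that[of h]) (auto simp: h_def)
qed

lemma integral_eq_lborel:
  fixes G g :: "real \<Rightarrow> real"
  assumes G: "integrable lborel G" and N: "negligible N"
    and eq: "\<And>x. x \<notin> N \<Longrightarrow> G x = (if x \<in> S then g x else 0)"
  shows "integral S g = integral\<^sup>L lborel G"
proof -
  have "((\<lambda>x. if x \<in> S then g x else 0) has_integral integral\<^sup>L lborel G) UNIV"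
    by (rule has_integral_spike[OF N _ has_integral_integral_lborel[OF G]]) (use eq in auto)
  then show ?thesis
    by (simp add: has_integral_restrict_UNIV integral_unique)
qed

lemma integrable_mult_bounded:
  fixes f g :: "real \<Rightarrow> real"
  assumes f: "integrable lborel f" and g: "g \<in> borel_measurable borel" and B: "\<And>x. \<bar>g x\<bar> \<le> B"
  shows "integrable lborel (\<lambda>x. f x * g x)"
proof (rule Bochner_Integration.integrable_bound)
  show "integrable lborel (\<lambda>x. B * f x)" using f by simp
  show "(\<lambda>x. f x * g x) \<in> borel_measurable lborel" using f g by measurable
  have "norm (f x * g x) \<le> norm (B * f x)" for x
  proof -
    have "\<bar>f x\<bar> * \<bar>g x\<bar> \<le> \<bar>f x\<bar> * \<bar>B\<bar>" using B[of x] by (intro mult_left_mono) auto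
    then show ?thesis by (simp add: abs_mult mult.commute)
  qed
  then show "AE x in lborel. norm (f x * g x) \<le> norm (B * f x)" by simp
qed

text \<open>At \<open>w = 0\<close> the sign vanishes, which matches the cancellation of the two integrals in
  \<open>ktrans\<close> at \<open>z = w = 0\<close>.\<close>

definition kap :: "(real \<Rightarrow> real \<Rightarrow> real) \<Rightarrow> real \<Rightarrow> real \<Rightarrow> real" where
  "kap K z w = sgn w * (indicator kernE (z, w) * K z w)"

lemma kap_measurable:
  assumes "continuous_on kernE (\<lambda>(z, w). K z w)"
  shows "(\<lambda>(z, w). kap K z w) \<in> borel_measurable (lborel \<Otimes>\<^sub>M lborel)"
proof -
  have "(\<lambda>x. indicator kernE x *\<^sub>R (\<lambda>(z, w). K z w) x) \<in> borel_measurable borel"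
    using assms compact_imp_closed[OF compact_kernE] by (intro borel_measurable_continuous_on_indicator) auto
  then have 1: "(\<lambda>x. indicator kernE x *\<^sub>R (\<lambda>(z, w). K z w) x) \<in> borel_measurable (borel \<Otimes>\<^sub>M borel)"
    by (simp add: borel_prod)
  have "(\<lambda>x. sgn (snd x) * (indicator kernE x *\<^sub>R (\<lambda>(z, w). K z w) x)) \<in> borel_measurable (borel \<Otimes>\<^sub>M borel)"
    using 1 by measurable
  moreover have "(\<lambda>(z, w). kap K z w) = (\<lambda>x. sgn (snd x) * (indicator kernE x *\<^sub>R (\<lambda>(z, w). K z w) x))"
    by (auto simp: kap_def)
  moreover have "borel_measurable (lborel \<Otimes>\<^sub>M lborel) = borel_measurable (borel \<Otimes>\<^sub>M borel :: (real \<times> real) measure)"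
    by (intro measurable_cong_sets sets_pair_measure_cong) auto
  ultimately show ?thesis by simp
qed

lemma kap_bound:
  assumes "\<And>z w. (z, w) \<in> kernE \<Longrightarrow> \<bar>K z w\<bar> \<le> C" "C \<ge> 0"
  shows "\<bar>kap K z w\<bar> \<le> C * indicator {-\<bar>w\<bar>..\<bar>w\<bar>} z * indicator {-1..1} w"
  using assms(1)[of z w] assms(2)
  by (auto simp: kap_def indicator_def kernE_iff abs_mult sgn_if abs_le_iff)

lemma ktrans_eq_lborel:
  assumes K: "continuous_on kernE (\<lambda>(z, w). K z w)" and h: "continuous_on {-1..1} h"
  shows "ktrans K h z = (\<integral>w. kap K z w * (indicator {-1..1} w * h w) \<partial>lborel)"
proof -
  let ?g = "\<lambda>w. K z w * h w"
  have c: "continuous_on {\<bar>z\<bar>..1} ?g" "continuous_on {-1..-\<bar>z\<bar>} ?g"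
    by (intro continuous_intros kernel_section_continuous[OF K] continuous_on_subset[OF h]; auto)+
  have s: "set_integrable lborel {\<bar>z\<bar>..1} ?g" "set_integrable lborel {-1..-\<bar>z\<bar>} ?g"
    using c by (intro borel_integrable_atLeastAtMost'; simp)+
  have "ktrans K h z = (LINT w:{\<bar>z\<bar>..1}|lborel. ?g w) - (LINT w:{-1..-\<bar>z\<bar>}|lborel. ?g w)"
    unfolding ktrans_def using s by (simp add: set_borel_integral_eq_integral(2))
  also have "\<dots> = (\<integral>w. indicator {\<bar>z\<bar>..1} w *\<^sub>R ?g w - indicator {-1..-\<bar>z\<bar>} w *\<^sub>R ?g w \<partial>lborel)"
    using s unfolding set_lebesgue_integral_def set_integrable_def
    by (simp only: Bochner_Integration.integral_diff)
  also have "\<dots> = (\<integral>w. kap K z w * (indicator {-1..1} w * h w) \<partial>lborel)"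
  proof (rule Bochner_Integration.integral_cong)
    fix w :: real
    consider "w > 0" | "w = 0" | "w < 0" by linarith
    then show "indicator {\<bar>z\<bar>..1} w *\<^sub>R ?g w - indicator {-1..-\<bar>z\<bar>} w *\<^sub>R ?g w = kap K z w * (indicator {-1..1} w * h w)"
      by cases (auto simp: kap_def indicator_def kernE_iff)
  qed simp
  finally show ?thesis .
qed

text \<open>The double integral converges absolutely, because \<open>U\<close> is integrable and
  \<open>kap\<close> is bounded and vanishes for \<open>w\<close> outside \<open>{-1..1}\<close>.
  The exchange moves the kernel from the test function onto the state.\<close>

lemma kap_Fubini:
  fixes U phi :: "real \<Rightarrow> real"
  assumes K: "continuous_on kernE (\<lambda>(z, w). K z w)" and U: "integrable lborel U"
    and phi: "phi \<in> borel_measurable borel" and B: "\<And>w. \<bar>phi w\<bar> \<le> B"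
  shows "(\<integral>z. U z * (\<integral>w. kap K z w * phi w \<partial>lborel) \<partial>lborel) = (\<integral>w. phi w * (\<integral>z. kap K z w * U z \<partial>lborel) \<partial>lborel)"
    "integrable lborel (\<lambda>z. U z * (\<integral>w. kap K z w * phi w \<partial>lborel))"
    "integrable lborel (\<lambda>w. phi w * (\<integral>z. kap K z w * U z \<partial>lborel))"
proof -
  obtain C where C: "C \<ge> 0" "\<And>z w. (z, w) \<in> kernE \<Longrightarrow> \<bar>K z w\<bar> \<le> C" using kernel_bounded[OF K] by blast
  have B0: "B \<ge> 0" using B[of 0] by linarith
  note km[measurable] = kap_measurable[OF K]
  have Um[measurable]: "U \<in> borel_measurable lborel" using U by simp
  note phi[measurable]
  have kb: "\<bar>kap K z w * phi w\<bar> \<le> C * B * indicator {-1..1} w" for z w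
  proof -
    have "\<bar>kap K z w\<bar> * \<bar>phi w\<bar> \<le> (C * indicator {-1..1} w) * B"
    proof (intro mult_mono B)
      show "\<bar>kap K z w\<bar> \<le> C * indicator {-1..1} w"
        by (rule order_trans[OF kap_bound[of K C z w, OF C(2,1)]]) (use C(1) in \<open>auto split: split_indicator\<close>)
    qed (use C in auto)
    then show ?thesis by (simp add: abs_mult algebra_simps)
  qed
  have i1: "integrable lborel (\<lambda>w. C * B * indicator {-1..1::real} w)"
    by simp
  have kw: "(\<lambda>w. kap K z w) \<in> borel_measurable lborel" for z
    using measurable_Pair2[OF km, of z] by simp
  have kz: "(\<lambda>z. kap K z w) \<in> borel_measurable lborel" for w
    using measurable_Pair1[OF km, of w] by simp
  have ik: "integrable lborel (\<lambda>w. kap K z w * phi w)" for z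
    by (rule Bochner_Integration.integrable_bound[OF i1]) (use kb kw[of z] in \<open>auto intro!: AE_I2 order_trans[OF kb] \<close>)
  have meas: "(\<lambda>(z, w). U z * (kap K z w * phi w)) \<in> borel_measurable (lborel \<Otimes>\<^sub>M lborel)"
    using km by measurable
  have F: "integrable (lborel \<Otimes>\<^sub>M lborel) (\<lambda>(z, w). U z * (kap K z w * phi w))"
  proof (rule lborel_pair.Fubini_integrable[OF meas])
    show "AE z in lborel. integrable lborel (\<lambda>w. case (z, w) of (z, w) \<Rightarrow> U z * (kap K z w * phi w))"
      using ik by auto
    have nm: "(\<lambda>z. \<integral>w. norm (kap K z w * phi w) \<partial>lborel) \<in> borel_measurable lborel"
      using km by measurable
    have le: "\<bar>\<integral>w. norm (kap K z w * phi w) \<partial>lborel\<bar> \<le> 2 * C * B" for z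
    proof -
      have "(\<integral>w. norm (kap K z w * phi w) \<partial>lborel) \<le> (\<integral>w. C * B * indicator {-1..1::real} w \<partial>lborel)"
        using ik kb by (intro integral_mono i1) auto
      also have "\<dots> = 2 * C * B" by simp
      finally show ?thesis by simp
    qed
    have "integrable lborel (\<lambda>z. \<bar>U z\<bar> * (\<integral>w. norm (kap K z w * phi w) \<partial>lborel))"
      using nm by (intro integrable_mult_bounded[OF _ _ le]) (use U in auto)
    then show "integrable lborel (\<lambda>z. \<integral>w. norm (case (z, w) of (z, w) \<Rightarrow> U z * (kap K z w * phi w)) \<partial>lborel)"
      by (simp add: abs_mult)
  qed
  have e1: "(\<integral>w. U z * (kap K z w * phi w) \<partial>lborel) = U z * (\<integral>w. kap K z w * phi w \<partial>lborel)" for z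
    by simp
  have e2: "(\<integral>z. U z * (kap K z w * phi w) \<partial>lborel) = phi w * (\<integral>z. kap K z w * U z \<partial>lborel)" for w
  proof -
    have "(\<lambda>z. U z * (kap K z w * phi w)) = (\<lambda>z. phi w * (kap K z w * U z))" by (simp add: algebra_simps)
    then show ?thesis by simp
  qed
  show "(\<integral>z. U z * (\<integral>w. kap K z w * phi w \<partial>lborel) \<partial>lborel) = (\<integral>w. phi w * (\<integral>z. kap K z w * U z \<partial>lborel) \<partial>lborel)"
    using lborel_pair.Fubini_integral[OF F] unfolding e1 e2 by simp
  show "integrable lborel (\<lambda>z. U z * (\<integral>w. kap K z w * phi w \<partial>lborel))"
    using lborel_pair.integrable_fst[OF F] unfolding e1 .
  show "integrable lborel (\<lambda>w. phi w * (\<integral>z. kap K z w * U z \<partial>lborel))"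
    using lborel_pair.integrable_snd[OF F] unfolding e2 .
qed

text \<open>Squaring removes the corner of the positive part; this makes the approximations of
  half-line indicators below admissible as \<open>P\<close>.\<close>

lemma pos_part_square_deriv: "((\<lambda>x::real. (max 0 x)\<^sup>2) has_real_derivative 2 * max 0 x) (at x)"
proof (cases x "0::real" rule: linorder_cases)
  case less
  have "((\<lambda>_. 0) has_real_derivative 0) (at x)" by simp
  then have "((\<lambda>x::real. (max 0 x)\<^sup>2) has_real_derivative 0) (at x)"
    by (rule has_field_derivative_transform_within_open[of _ _ _ "{..<0}"]) (use less in auto)
  then show ?thesis using less by simp
next
  case greater
  have "((\<lambda>x. x\<^sup>2) has_real_derivative 2 * x) (at x)" by (auto intro!: derivative_eq_intros)
  then have "((\<lambda>x::real. (max 0 x)\<^sup>2) has_real_derivative 2 * x) (at x)"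
    by (rule has_field_derivative_transform_within_open[of _ _ _ "{0<..}"]) (use greater in auto)
  then show ?thesis using greater by simp
next
  case equal
  have "((\<lambda>h::real. max 0 h) \<longlongrightarrow> 0) (at 0)" by (rule tendsto_eq_intros | simp)+
  then have "((\<lambda>h::real. (max 0 h)\<^sup>2 / h) \<longlongrightarrow> 0) (at 0)"
    by (rule Lim_transform_eventually) (auto simp: eventually_at_filter max_def power2_eq_square intro!: always_eventually)
  then show ?thesis using equal by (simp add: has_field_derivative_iff)
qed

section \<open>From the pairings back to the state\<close>

context half_system
begin

text \<open>In the travel time coordinate the admissible \<open>P\<close> approximate indicators of
  half-lines boundedly and pointwise. By dominated convergence the integrals of
  \<open>f / lam\<close> over half-lines vanish.\<close>

lemma AE_zero_if_orthogonal:
  assumes f: "integrable lborel f" and f0: "\<And>w. w \<notin> {-1..1} \<Longrightarrow> f w = 0"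
    and orth: "\<And>P P'. (\<And>s. (P has_real_derivative P' s) (at s)) \<Longrightarrow> continuous_on UNIV P' \<Longrightarrow>
       (\<And>s. s \<ge> rb \<Longrightarrow> P s = 0) \<Longrightarrow> (\<integral>w. f w * (indicator {-1..1} w * H P w) \<partial>lborel) = 0"
  shows "AE w in lborel. f w = 0"
proof -
  have lamc: "lam w \<noteq> 0" if "w \<in> {-1..1}" for w using lam_pos[OF that] by simp
  have cl: "continuous_on {-1..1} (\<lambda>w. 1 / lam w)"
    by (intro continuous_on_divide lam_cont continuous_on_const ballI lamc)
  have im: "(\<lambda>w. indicator {-1..1} w * (1 / lam w)) \<in> borel_measurable borel"
    using borel_measurable_continuous_on_indicator[OF _ cl] by simp
  obtain B where B: "B \<ge> 0" "\<And>w. w \<in> {-1..1} \<Longrightarrow> \<bar>1 / lam w\<bar> \<le> B"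
    using continuous_on_Icc_bounded[OF cl] by blast
  define g where "g w = f w * (indicator {-1..1} w * (1 / lam w))" for w
  have gi: "integrable lborel g"
    unfolding g_def
  proof (rule integrable_mult_bounded[OF f im])
    show "\<bar>indicator {-1..1} w * (1 / lam w)\<bar> \<le> B" for w
      using B(1) B(2)[of w] by (auto simp: indicator_def)
  qed
  have gm[measurable]: "g \<in> borel_measurable borel" using gi by auto
  have lt: "(LINT w:{..<X x}|lborel. g w) = 0" if x: "x \<le> rb" for x
  proof -
    \<comment> \<open>\<open>C\<^sup>1\<close> functions increasing to the indicator function of \<open>{..<x}\<close>\<close>
    define P where "P n s = 1 - exp (- (real n * (max 0 (x - s))\<^sup>2))" for n s
    define P' where "P' n s = - (exp (- (real n * (max 0 (x - s))\<^sup>2)) * (real n * (2 * max 0 (x - s))))" for n s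
    have P: "(P n has_real_derivative P' n s) (at s)" for n s
    proof -
      have "((\<lambda>s. (max 0 (x - s))\<^sup>2) has_real_derivative 2 * max 0 (x - s) * (-1)) (at s)"
        by (rule DERIV_chain2[OF pos_part_square_deriv, where g = "\<lambda>s. x - s"]) (auto intro!: derivative_eq_intros)
      moreover have "((\<lambda>s. 1 - exp (- (k * q s))) has_real_derivative exp (- (k * q s)) * (k * d)) (at s)"
        if "(q has_real_derivative d) (at s)" for q :: "real \<Rightarrow> real" and d k
        using that by (auto intro!: derivative_eq_intros)
      ultimately have "((\<lambda>s. 1 - exp (- (real n * (max 0 (x - s))\<^sup>2))) has_real_derivative
          exp (- (real n * (max 0 (x - s))\<^sup>2)) * (real n * (2 * max 0 (x - s) * (-1)))) (at s)"
        by blast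
      then show ?thesis unfolding P_def P'_def by simp
    qed
    have Pc: "continuous_on UNIV (P' n)" for n unfolding P'_def by (intro continuous_intros)
    have P0: "P n s = 0" if "s \<ge> rb" for n s using that x by (simp add: P_def)
    have z: "(\<integral>w. g w * P n (sig w) \<partial>lborel) = 0" for n
    proof -
      have "g w * P n (sig w) = f w * (indicator {-1..1} w * H (P n) w)" for w
        by (simp add: g_def H_def)
      then show ?thesis using orth[OF P Pc P0, of n] by simp
    qed
    have sm[measurable]: "sig \<in> borel_measurable borel" using sig_cont by (rule borel_measurable_continuous_onI)
    have "(\<lambda>n. \<integral>w. g w * P n (sig w) \<partial>lborel) \<longlonglongrightarrow> (\<integral>w. g w * indicator {..<X x} w \<partial>lborel)"
    proof (rule integral_dominated_convergence[where w = "\<lambda>w. norm (g w)"])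
      show "(\<lambda>w. g w * indicator {..<X x} w) \<in> borel_measurable lborel" by measurable
      show "(\<lambda>w. g w * P n (sig w)) \<in> borel_measurable lborel" for n unfolding P_def by measurable
      show "integrable lborel (\<lambda>w. norm (g w))" using gi by simp
      have "\<bar>P n s\<bar> \<le> 1" for n s by (simp add: P_def)
      then show "AE w in lborel. norm (g w * P n (sig w)) \<le> norm (g w)" for n
        by (auto simp: abs_mult intro!: mult_left_le)
      have "(\<lambda>n. P n (sig w)) \<longlonglongrightarrow> indicator {..<X x} w" for w
      proof (cases "w < X x")
        case True
        then have "sig w < x" using sig_less_iff[of w "X x"] by simp
        then have "max 0 (x - sig w) = x - sig w" "(x - sig w)\<^sup>2 > 0" by auto
        then have "(\<lambda>n. 1 - exp (- (real n * (max 0 (x - sig w))\<^sup>2))) \<longlonglongrightarrow> 1 - 0"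
          by (intro tendsto_intros filterlim_compose[OF exp_at_bot] filterlim_compose[OF filterlim_uminus_at_bot_at_top]
              filterlim_at_top_mult_tendsto_pos[OF tendsto_const _ filterlim_real_sequentially, THEN filterlim_cong[THEN iffD1, rotated -1]])
            (auto simp: mult.commute)
        then show ?thesis using True by (simp add: P_def)
      next
        case False
        then have "x \<le> sig w" using sig_le_iff[of "X x" w] by simp
        then show ?thesis using False by (simp add: P_def)
      qed
      then show "AE w in lborel. (\<lambda>n. g w * P n (sig w)) \<longlonglongrightarrow> g w * indicator {..<X x} w"
        by (intro AE_I2 tendsto_mult tendsto_const)
    qed
    then have "(\<integral>w. g w * indicator {..<X x} w \<partial>lborel) = 0"
      unfolding z by (simp add: LIMSEQ_const_iff)
    then show ?thesis by (simp add: set_lebesgue_integral_def mult.commute)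
  qed
  \<comment> \<open>Since the approximations have to vanish from \<open>rb\<close> on, only
    half-lines ending at or before 1 are reached directly. The others follow because
    \<open>g\<close> vanishes outside \<open>{-1..1}\<close> and the point 1 has measure
    zero.\<close>
  have lt1: "(LINT w:{..<y}|lborel. g w) = 0" if "y \<le> 1" for y
    using lt[of "sig y"] that by (simp add: rb_def)
  have g0: "g w = 0" if "w \<notin> {-1..1}" for w using that by (simp add: g_def)
  have lt2: "(\<integral>w. g w \<partial>lborel) = 0"
  proof -
    have "(\<integral>w. g w \<partial>lborel) = (LINT w:{..<1}|lborel. g w)"
      unfolding set_lebesgue_integral_def
      by (rule integral_cong_AE)
        (use AE_lborel_singleton[of "1::real"] g0 in \<open>auto simp: indicator_def elim!: eventually_mono\<close>)
    then show ?thesis using lt1 by simp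
  qed
  have lt3: "(LINT w:{..<y}|lborel. g w) = 0" for y
  proof (cases "y \<le> 1")
    case False
    have "(LINT w:{..<y}|lborel. g w) = (\<integral>w. g w \<partial>lborel)"
      unfolding set_lebesgue_integral_def
      by (rule Bochner_Integration.integral_cong) (use False g0 in \<open>auto simp: indicator_def\<close>)
    then show ?thesis using lt2 by simp
  qed (rule lt1)
  have "AE w in lborel. g w = 0"
    by (rule AE_zero_if_integral_lessThan_zero[OF gi lt2 lt3])
  then show ?thesis
    by eventually_elim (use f0 lamc in \<open>auto simp: g_def indicator_def split: if_splits\<close>)
qed

text \<open>By \<open>M_zero\<close> and Fubini a Borel version \<open>al\<close> of \<alpha> at
  time \<open>t\<close> is orthogonal to every admissible \<open>H P\<close>, hence zero almost
  everywhere. Then \<open>u\<close> equals its Volterra integral, and \<open>kap\<close> is bounded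
  and supported in \<open>\<bar>z\<bar> \<le> \<bar>w\<bar>\<close>.\<close>

lemma state_bound:
  assumes t: "t > rb - ra"
  obtains N C where "negligible N" "C \<ge> 0"
    "\<And>w. w \<in> {-1..1} - N \<Longrightarrow> \<bar>u w t\<bar> \<le> C * integral {-\<bar>w\<bar>..\<bar>w\<bar>} (\<lambda>z. \<bar>u z t\<bar> + \<bar>v z t\<bar>)"
proof -
  have t0: "t \<ge> 0" using t ra_less_rb by simp
  obtain U where U: "integrable lborel U" "\<And>x. x \<notin> {-1..1} \<Longrightarrow> U x = 0" "negligible {x \<in> {-1..1}. u x t \<noteq> U x}"
    using borel_representative[OF uv_int(1)[OF t0]] by blast
  obtain V where V: "integrable lborel V" "\<And>x. x \<notin> {-1..1} \<Longrightarrow> V x = 0" "negligible {x \<in> {-1..1}. v x t \<noteq> V x}"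
    using borel_representative[OF uv_int(2)[OF t0]] by blast
  have pair: "integral {-1..1} (\<lambda>w. f w * g w) = (\<integral>w. F w * (indicator {-1..1} w * g w) \<partial>lborel)"
    "integrable lborel (\<lambda>w. F w * (indicator {-1..1} w * g w))"
    if F: "integrable lborel F" "negligible {x \<in> {-1..1}. f x \<noteq> F x}" and g: "continuous_on {-1..1} g" for f F g :: "real \<Rightarrow> real"
  proof -
    obtain B where B: "B \<ge> 0" "\<And>x. x \<in> {-1..1} \<Longrightarrow> \<bar>g x\<bar> \<le> B"
      using continuous_on_Icc_bounded[OF g] by blast
    show i: "integrable lborel (\<lambda>w. F w * (indicator {-1..1} w * g w))"
    proof (rule integrable_mult_bounded[OF F(1)])
      show "(\<lambda>w. indicator {-1..1} w * g w) \<in> borel_measurable borel"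
        using borel_measurable_continuous_on_indicator[OF _ g] by simp
      show "\<bar>indicator {-1..1} w * g w\<bar> \<le> B" for w using B(1) B(2)[of w] by (auto simp: indicator_def)
    qed
    show "integral {-1..1} (\<lambda>w. f w * g w) = (\<integral>w. F w * (indicator {-1..1} w * g w) \<partial>lborel)"
      by (rule integral_eq_lborel[OF i F(2)]) (auto simp: indicator_def)
  qed
  define al where "al w = U w - (\<integral>z. kap L11 z w * U z \<partial>lborel) - (\<integral>z. kap L12 z w * V z \<partial>lborel)" for w
  have k1: "integrable lborel (\<lambda>w. \<integral>z. kap L11 z w * U z \<partial>lborel)"
    using kap_Fubini(3)[OF L11_cont U(1), of "\<lambda>_. 1" 1] by simp
  have k2: "integrable lborel (\<lambda>w. \<integral>z. kap L12 z w * V z \<partial>lborel)"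
    using kap_Fubini(3)[OF L12_cont V(1), of "\<lambda>_. 1" 1] by simp
  have kz: "kap K z w = 0" if "w \<notin> {-1..1}" for K z w
    using that by (auto simp: kap_def kernE_iff)
  have "AE w in lborel. al w = 0"
  proof (rule AE_zero_if_orthogonal)
    show "integrable lborel al" unfolding al_def using U(1) k1 k2 by simp
    show "al w = 0" if "w \<notin> {-1..1}" for w
      using that U(2) kz by (simp add: al_def)
    fix P P' assume P: "\<And>s. (P has_real_derivative P' s) (at s)" "continuous_on UNIV P'"
       "\<And>s. s \<ge> rb \<Longrightarrow> P s = 0"
    have Pc: "continuous_on UNIV P"
      using P by (meson DERIV_continuous_on has_field_derivative_at_within)
    define h where "h = H P"
    have h: "continuous_on {-1..1} h" unfolding h_def by (rule H_cont[OF Pc])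
    obtain B where B: "B \<ge> 0" "\<And>x. x \<in> {-1..1} \<Longrightarrow> \<bar>h x\<bar> \<le> B"
      using continuous_on_Icc_bounded[OF h] by blast
    let ?phi = "\<lambda>w. indicator {-1..1} w * h w"
    have pm: "?phi \<in> borel_measurable borel"
      using borel_measurable_continuous_on_indicator[OF _ h] by simp
    have pb: "\<bar>?phi w\<bar> \<le> B" for w using B(1) B(2)[of w] by (auto simp: indicator_def)
    note F1 = kap_Fubini[OF L11_cont U(1) pm pb] and F2 = kap_Fubini[OF L12_cont V(1) pm pb]
    have kc: "continuous_on {-1..1} (ktrans L11 h)" "continuous_on {-1..1} (ktrans L12 h)"
      by (intro ktrans_continuous L11_cont L12_cont h)+
    have UI: "U w * indicator {-1..1} w = U w" "V w * indicator {-1..1} w = V w" for w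
      using U(2)[of w] V(2)[of w] by (auto simp: indicator_def)
    have "0 = M h t" unfolding h_def using M_zero[OF P t] by simp
    also have "\<dots> = pu h t - pu (ktrans L11 h) t - pv (ktrans L12 h) t"
      unfolding M_def using pu_lin[OF t0 h kc(1), of 1 "-1"] by simp
    also have "pu h t = (\<integral>w. U w * ?phi w \<partial>lborel)"
      unfolding pu_def by (rule pair(1)[OF U(1,3) h])
    also have "pu (ktrans L11 h) t = (\<integral>w. ?phi w * (\<integral>z. kap L11 z w * U z \<partial>lborel) \<partial>lborel)"
    proof -
      have "pu (ktrans L11 h) t = (\<integral>w. U w * (indicator {-1..1} w * ktrans L11 h w) \<partial>lborel)"
        unfolding pu_def by (rule pair(1)[OF U(1,3) kc(1)])
      also have "\<dots> = (\<integral>w. U w * (\<integral>x. kap L11 w x * ?phi x \<partial>lborel) \<partial>lborel)"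
        unfolding ktrans_eq_lborel[OF L11_cont h, symmetric]
        by (simp only: mult.assoc[symmetric] UI)
      finally show ?thesis using F1(1) by simp
    qed
    also have "pv (ktrans L12 h) t = (\<integral>w. ?phi w * (\<integral>z. kap L12 z w * V z \<partial>lborel) \<partial>lborel)"
    proof -
      have "pv (ktrans L12 h) t = (\<integral>w. V w * (indicator {-1..1} w * ktrans L12 h w) \<partial>lborel)"
        unfolding pv_def by (rule pair(1)[OF V(1,3) kc(2)])
      also have "\<dots> = (\<integral>w. V w * (\<integral>x. kap L12 w x * ?phi x \<partial>lborel) \<partial>lborel)"
        unfolding ktrans_eq_lborel[OF L12_cont h, symmetric]
        by (simp only: mult.assoc[symmetric] UI)
      finally show ?thesis using F2(1) by simp
    qed
    also have "(\<integral>w. U w * ?phi w \<partial>lborel) - (\<integral>w. ?phi w * (\<integral>z. kap L11 z w * U z \<partial>lborel) \<partial>lborel)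
        - (\<integral>w. ?phi w * (\<integral>z. kap L12 z w * V z \<partial>lborel) \<partial>lborel) = (\<integral>w. al w * ?phi w \<partial>lborel)"
    proof -
      have "(\<lambda>w. al w * ?phi w) = (\<lambda>w. U w * ?phi w - ?phi w * (\<integral>z. kap L11 z w * U z \<partial>lborel)
          - ?phi w * (\<integral>z. kap L12 z w * V z \<partial>lborel))"
        by (simp add: al_def algebra_simps)
      then show ?thesis
        using pair(2)[OF U(1,3) h] F1(3) F2(3) by (simp only: Bochner_Integration.integral_diff Bochner_Integration.integrable_diff)
    qed
    finally show "(\<integral>w. al w * (indicator {-1..1} w * H P w) \<partial>lborel) = 0" by (simp add: h_def)
  qed
  then obtain N0 where N0: "{w. al w \<noteq> 0} \<subseteq> N0" "N0 \<in> null_sets lborel"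
    by (auto simp: eventually_ae_filter)
  obtain C1 where C1: "C1 \<ge> 0" "\<And>z w. (z, w) \<in> kernE \<Longrightarrow> \<bar>L11 z w\<bar> \<le> C1" using kernel_bounded[OF L11_cont] by blast
  obtain C2 where C2: "C2 \<ge> 0" "\<And>z w. (z, w) \<in> kernE \<Longrightarrow> \<bar>L12 z w\<bar> \<le> C2" using kernel_bounded[OF L12_cont] by blast
  define C where "C = max C1 C2"
  have C: "C \<ge> 0" "\<And>z w. (z, w) \<in> kernE \<Longrightarrow> \<bar>L11 z w\<bar> \<le> C" "\<And>z w. (z, w) \<in> kernE \<Longrightarrow> \<bar>L12 z w\<bar> \<le> C"
    using C1 C2 by (auto simp: C_def le_max_iff_disj)
  define N where "N = N0 \<union> {x \<in> {-1..1}. u x t \<noteq> U x}"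
  have "negligible N"
    unfolding N_def
    by (intro negligible_Un U(3)) (use N0(2) in \<open>simp add: negligible_iff_null_sets null_sets_completionI\<close>)
  moreover have "\<bar>u w t\<bar> \<le> C * integral {-\<bar>w\<bar>..\<bar>w\<bar>} (\<lambda>z. \<bar>u z t\<bar> + \<bar>v z t\<bar>)" if w: "w \<in> {-1..1} - N" for w
  proof -
    have "al w = 0" "u w t = U w" using w N0(1) by (auto simp: N_def)
    then have eq: "u w t = (\<integral>z. kap L11 z w * U z \<partial>lborel) + (\<integral>z. kap L12 z w * V z \<partial>lborel)"
      by (simp add: al_def)
    let ?S = "{-\<bar>w\<bar>..\<bar>w\<bar>}"
    have est: "\<bar>\<integral>z. kap K z w * G z \<partial>lborel\<bar> \<le> C * (\<integral>z. indicator ?S z * \<bar>G z\<bar> \<partial>lborel)"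
      if Kc: "continuous_on kernE (\<lambda>(z, w). K z w)" and K: "\<And>z w. (z, w) \<in> kernE \<Longrightarrow> \<bar>K z w\<bar> \<le> C"
        and G: "integrable lborel G" for K :: "real \<Rightarrow> real \<Rightarrow> real" and G :: "real \<Rightarrow> real"
    proof -
      have i: "integrable lborel (\<lambda>z. C * (indicator ?S z * \<bar>G z\<bar>))"
        using integrable_mult_indicator[of ?S lborel "\<lambda>z. \<bar>G z\<bar>"] G by simp
      have m: "(\<lambda>z. kap K z w) \<in> borel_measurable borel"
        using measurable_Pair1[OF kap_measurable[OF Kc], of w] by simp
      have b: "\<bar>kap K z w\<bar> \<le> C * indicator ?S z" for z
        using kap_bound[of K C z w, OF K C(1)] w by simp
      have b': "\<bar>kap K z w * G z\<bar> \<le> C * (indicator ?S z * \<bar>G z\<bar>)" for z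
        using mult_right_mono[OF b[of z], of "\<bar>G z\<bar>"] by (simp add: abs_mult mult.assoc)
      have i2: "integrable lborel (\<lambda>z. kap K z w * G z)"
      proof -
        have "\<bar>kap K z w\<bar> \<le> C" for z
          by (rule order_trans[OF b]) (use C(1) in \<open>auto split: split_indicator\<close>)
        then show ?thesis using integrable_mult_bounded[OF G m, of C] by (simp add: mult.commute)
      qed
      have "\<bar>\<integral>z. kap K z w * G z \<partial>lborel\<bar> \<le> (\<integral>z. \<bar>kap K z w * G z\<bar> \<partial>lborel)"
        by (rule integral_abs_bound)
      also have "\<dots> \<le> (\<integral>z. C * (indicator ?S z * \<bar>G z\<bar>) \<partial>lborel)"
        using i2 by (intro integral_mono i b') auto
      finally show ?thesis by simp
    qed
    have iS: "integrable lborel (\<lambda>z. indicator ?S z * \<bar>G z\<bar>)" if "integrable lborel G" for G :: "real \<Rightarrow> real"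
      using integrable_mult_indicator[of ?S lborel "\<lambda>z. \<bar>G z\<bar>"] that by simp
    have "integral ?S (\<lambda>z. \<bar>u z t\<bar> + \<bar>v z t\<bar>) = (\<integral>z. indicator ?S z * \<bar>U z\<bar> + indicator ?S z * \<bar>V z\<bar> \<partial>lborel)"
    proof (rule integral_eq_lborel)
      show "integrable lborel (\<lambda>z. indicator ?S z * \<bar>U z\<bar> + indicator ?S z * \<bar>V z\<bar>)"
        by (intro Bochner_Integration.integrable_add iS U(1) V(1))
      show "negligible ({x \<in> {-1..1}. u x t \<noteq> U x} \<union> {x \<in> {-1..1}. v x t \<noteq> V x})"
        using U(3) V(3) by (rule negligible_Un)
      have sub: "z \<in> {-1..1}" if "z \<in> ?S" for z using that w by auto
      show "indicator ?S x * \<bar>U x\<bar> + indicator ?S x * \<bar>V x\<bar> = (if x \<in> ?S then \<bar>u x t\<bar> + \<bar>v x t\<bar> else 0)"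
        if "x \<notin> {x \<in> {-1..1}. u x t \<noteq> U x} \<union> {x \<in> {-1..1}. v x t \<noteq> V x}" for x
        using that sub[of x] by (cases "x \<in> ?S") auto
    qed
    also have "\<dots> = (\<integral>z. indicator ?S z * \<bar>U z\<bar> \<partial>lborel) + (\<integral>z. indicator ?S z * \<bar>V z\<bar> \<partial>lborel)"
      by (intro Bochner_Integration.integral_add iS U(1) V(1))
    finally have "C * integral ?S (\<lambda>z. \<bar>u z t\<bar> + \<bar>v z t\<bar>) =
        C * (\<integral>z. indicator ?S z * \<bar>U z\<bar> \<partial>lborel) + C * (\<integral>z. indicator ?S z * \<bar>V z\<bar> \<partial>lborel)"
      by (simp add: algebra_simps)
    then show ?thesis
      using est[OF L11_cont C(2) U(1)] est[OF L12_cont C(3) V(1)] unfolding eq by linarith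
  qed
  ultimately show ?thesis using that C(1) by blast
qed

end

section \<open>Injectivity of the transformation and finite-time extinction\<close>

lemma volterra_integral_zero:
  fixes f :: "real \<Rightarrow> real"
  assumes f: "f integrable_on {-1..1}" and f0: "\<And>w. w \<in> {-1..1} \<Longrightarrow> f w \<ge> 0" and C: "C \<ge> 0"
    and le: "\<And>w. w \<in> {-1..1} \<Longrightarrow> f w \<le> C * integral {-\<bar>w\<bar>..\<bar>w\<bar>} f"
  shows "integral {-1..1} f = 0"
proof -
  define m where "m r = integral {-r..r} f" for r
  \<comment> \<open>If the mass of \<open>f\<close> on \<open>{-r..r}\<close> is zero, it is zero on \<open>{-(r + d)..r + d}\<close> too, as \<open>2 * C * d < 1\<close>.\<close>
  define d where "d = 1 / (2 * C + 1)"
  have d: "d > 0" "2 * C * d < 1" using C by (auto simp: d_def field_simps)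
  have int: "f integrable_on {a..b}" if "-1 \<le> a" "b \<le> 1" for a b
    by (rule integrable_on_subinterval[OF f]) (use that in auto)
  have mono: "m r \<le> m r'" if "0 \<le> r" "r \<le> r'" "r' \<le> 1" for r r'
    unfolding m_def using that by (auto intro!: integral_subset_le int f0)
  have m0: "m r \<ge> 0" if "r \<le> 1" for r
    unfolding m_def using that by (intro Henstock_Kurzweil_Integration.integral_nonneg int f0) auto
  have part: "integral {a..b} f \<le> C * m r * (b - a)"
    if "-r \<le> a" "a \<le> b" "b \<le> r" "r \<le> 1" for a b r
  proof -
    have "integral {a..b} f \<le> integral {a..b} (\<lambda>_. C * m r)"
    proof (rule integral_le)
      fix w assume w: "w \<in> {a..b}"
      then have "f w \<le> C * m \<bar>w\<bar>" unfolding m_def using that by (intro le) auto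
      also have "\<dots> \<le> C * m r" using w that C by (intro mult_left_mono mono) auto
      finally show "f w \<le> C * m r" .
    qed (use that in \<open>auto intro!: int\<close>)
    then show ?thesis using that by (simp add: algebra_simps)
  qed
  have "m (min 1 (real n * d)) = 0" for n
  proof (induction n)
    case 0
    show ?case by (simp add: m_def integral_unique[OF has_integral_null_real] content_real_eq_0)
  next
    case (Suc n)
    define r0 where "r0 = min 1 (real n * d)"
    define r1 where "r1 = min 1 (real (Suc n) * d)"
    have r: "0 \<le> r0" "r0 \<le> r1" "r1 \<le> 1" "r1 - r0 \<le> d"
      using d by (auto simp: r0_def r1_def algebra_simps)
    \<comment> \<open>The inner interval has mass zero by induction, and each of the two outer
      strips has width at most \<open>d\<close>, so
      \<open>m r1 \<le> 2 * C * d * m r1\<close>.\<close>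
    have "m r1 = integral {-r1..-r0} f + (integral {-r0..r0} f + integral {r0..r1} f)"
      unfolding m_def using r
      by (simp add: Henstock_Kurzweil_Integration.integral_combine int)
    also have "integral {-r0..r0} f = 0" using Suc by (simp add: m_def r0_def)
    also have "integral {-r1..-r0} f + (0 + integral {r0..r1} f) \<le> C * m r1 * (r1 - r0) + C * m r1 * (r1 - r0)"
      using part[of r1 "-r1" "-r0"] part[of r1 r0 r1] r by simp
    also have "\<dots> \<le> C * m r1 * d + C * m r1 * d"
      using r C m0[of r1] by (intro add_mono mult_left_mono mult_nonneg_nonneg) auto
    finally have "m r1 * (1 - 2 * C * d) \<le> 0" by (simp add: algebra_simps)
    then have "m r1 \<le> 0" using d by (simp add: mult_le_0_iff)
    then show ?case using m0[of r1] r by (simp add: r1_def)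
  qed
  moreover obtain n where "1 \<le> real n * d"
    using reals_Archimedean3[OF d(1)] by (metis less_imp_le)
  ultimately have "m 1 = 0" by (metis min.absorb1)
  then show ?thesis by (simp add: m_def)
qed

text \<open>Redefining \<open>f\<close> as zero on \<open>N\<close> makes the estimate hold
  everywhere without changing any integral. Once the total integral is zero, the estimate itself
  gives the value at each point outside \<open>N\<close>.\<close>

lemma volterra_AE_zero:
  fixes f :: "real \<Rightarrow> real"
  assumes f: "f integrable_on {-1..1}" and f0: "\<And>w. f w \<ge> 0" and C: "C \<ge> 0" and N: "negligible N"
    and le: "\<And>w. w \<in> {-1..1} - N \<Longrightarrow> f w \<le> C * integral {-\<bar>w\<bar>..\<bar>w\<bar>} f"
    and w: "w \<in> {-1..1} - N"
  shows "f w = 0"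
proof -
  define g where "g w = (if w \<in> N then 0 else f w)" for w
  have eq: "integral S g = integral S f" for S
    by (rule integral_spike[OF N]) (auto simp: g_def)
  have g: "g integrable_on {-1..1}"
    by (rule integrable_spike[OF f N]) (auto simp: g_def)
  have "integral {-1..1} g = 0"
  proof (rule volterra_integral_zero[OF g _ C])
    have "integral {-\<bar>w\<bar>..\<bar>w\<bar>} f \<ge> 0" if "w \<in> {-1..1}" for w
      using that by (intro Henstock_Kurzweil_Integration.integral_nonneg integrable_on_subinterval[OF f] f0) auto
    then show "g w \<le> C * integral {-\<bar>w\<bar>..\<bar>w\<bar>} g" if "w \<in> {-1..1}" for w
      using le[of w] that C unfolding eq by (auto simp: g_def)
  qed (auto simp: g_def f0)
  then have "integral {-1..1} f = 0" by (simp add: eq)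
  moreover have "integral {-\<bar>w\<bar>..\<bar>w\<bar>} f \<le> integral {-1..1} f"
    using w f0 by (intro integral_subset_le integrable_on_subinterval[OF f]) (use f in auto)
  ultimately have "C * integral {-\<bar>w\<bar>..\<bar>w\<bar>} f \<le> 0" using C by (simp add: mult_nonneg_nonpos)
  then show ?thesis using le[OF w] f0[of w] by linarith
qed

section \<open>Invariance of kernels, test functions and states under reflection\<close>

lemma char_sol_reflect:
  assumes "char_sol fz fw F L"
  shows "char_sol (\<lambda>z. fz (- z)) (\<lambda>w. fw (- w)) (\<lambda>z w. F (- z) (- w)) (\<lambda>z w. - L (- z) (- w))"
  unfolding char_sol_def
proof (intro allI impI ballI)
  fix a b s :: real and gz gw
  assume ab: "a < b" and s: "s \<in> {a..b}"
    and g: "\<forall>s\<in>{a..b}. (gz s, gw s) \<in> kernE \<and>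
      (gz has_real_derivative fz (- gz s)) (at s within {a..b}) \<and>
      (gw has_real_derivative fw (- gw s)) (at s within {a..b})"
  have img: "uminus ` {-b..-a} = {a..b}" "uminus ` {a..b} = {-b..-a}" by auto
  have refl: "((\<lambda>s. - q (- s)) has_real_derivative q') (at s within {-b..-a})"
    if "(q has_real_derivative q') (at (- s) within {a..b})" for q q' and s :: real
  proof -
    have "(uminus has_real_derivative -1) (at s within {-b..-a})" by (auto intro!: derivative_eq_intros)
    from DERIV_image_chain[OF _ this, of q q'] that
    have "((\<lambda>s. q (- s)) has_real_derivative - q') (at s within {-b..-a})" by (simp add: img o_def)
    from DERIV_minus[OF this] show ?thesis by simp
  qed
  \<comment> \<open>Negating the curve alone would reverse its velocity, so the parameter is
    reversed as well and a characteristic of the original equation results. The reversal changes the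
    sign of the derivative of \<open>L\<close>, which the minus sign in front of the reflected
    kernel absorbs.\<close>
  have "\<forall>s\<in>{-b..-a}. (- gz (- s), - gw (- s)) \<in> kernE \<and>
      ((\<lambda>s. - gz (- s)) has_real_derivative fz (- gz (- s))) (at s within {-b..-a}) \<and>
      ((\<lambda>s. - gw (- s)) has_real_derivative fw (- gw (- s))) (at s within {-b..-a})"
  proof
    fix s assume s: "s \<in> {-b..-a}"
    then have "- s \<in> {a..b}" by auto
    with g refl[of gz _ s] refl[of gw _ s]
    show "(- gz (- s), - gw (- s)) \<in> kernE \<and>
      ((\<lambda>s. - gz (- s)) has_real_derivative fz (- gz (- s))) (at s within {-b..-a}) \<and>
      ((\<lambda>s. - gw (- s)) has_real_derivative fw (- gw (- s))) (at s within {-b..-a})"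
      by (auto simp: kernE_iff)
  qed
  then have "\<forall>s\<in>{-b..-a}. ((\<lambda>s. L (- gz (- s)) (- gw (- s))) has_real_derivative F (- gz (- s)) (- gw (- s))) (at s within {-b..-a})"
    using assms[unfolded char_sol_def, THEN spec, of "-b", THEN spec, of "-a", THEN spec, of "\<lambda>s. - gz (- s)",
        THEN spec, of "\<lambda>s. - gw (- s)"] ab by (elim mp[rotated]) simp
  moreover have "- s \<in> {-b..-a}" using s by auto
  ultimately have d: "((\<lambda>s. L (- gz (- s)) (- gw (- s))) has_real_derivative F (- gz s) (- gw s)) (at (- s) within {-b..-a})"
    by fastforce
  have "(uminus has_real_derivative -1) (at s within {a..b})" by (auto intro!: derivative_eq_intros)
  from DERIV_image_chain[OF _ this, of "\<lambda>s. L (- gz (- s)) (- gw (- s))"] d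
  have "((\<lambda>s. L (- gz s) (- gw s)) has_real_derivative - F (- gz s) (- gw s)) (at s within {a..b})"
    by (simp add: img o_def)
  from DERIV_minus[OF this]
  show "((\<lambda>s. - L (- gz s) (- gw s)) has_real_derivative F (- gz s) (- gw s)) (at s within {a..b})" by simp
qed

lemma test_fun_reflect:
  assumes "test_fun phi phiw phit"
  shows "test_fun (\<lambda>w. phi (- w)) (\<lambda>w t. - phiw (- w) t) (\<lambda>w. phit (- w))"
proof -
  note T = assms[unfolded test_fun_def]
  have c: "continuous_on UNIV (\<lambda>(w, t). phiw w t)" "continuous_on UNIV (\<lambda>(w, t). phit w t)"
    using T by auto
  have 1: "((\<lambda>w. phi (- w) t) has_real_derivative - phiw (- w) t) (at w)" for w t
  proof -
    have "((\<lambda>w. phi w t) has_real_derivative phiw (- w) t) (at (- w))" using T by blast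
    then have "((\<lambda>w. phi (- w) t) has_real_derivative phiw (- w) t * (-1)) (at w)"
      by (rule DERIV_chain2[where g = uminus]) (auto intro!: derivative_eq_intros)
    then show ?thesis by simp
  qed
  have "continuous_on UNIV (\<lambda>x. (\<lambda>(w, t). phiw w t) (- fst x, snd x))"
    by (intro continuous_on_compose2[OF c(1)] continuous_intros) auto
  then have 2: "continuous_on UNIV (\<lambda>(w, t). - phiw (- w) t)"
    unfolding case_prod_unfold by (intro continuous_intros) (simp add: case_prod_unfold)
  have "continuous_on UNIV (\<lambda>x. (\<lambda>(w, t). phit w t) (- fst x, snd x))"
    by (intro continuous_on_compose2[OF c(2)] continuous_intros) auto
  then have 3: "continuous_on UNIV (\<lambda>(w, t). phit (- w) t)"
    by (simp add: case_prod_unfold)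
  show ?thesis unfolding test_fun_def using T 1 2 3 by blast
qed

lemma integral_reflect_I: "integral {-1..1::real} (\<lambda>w. f (- w)) = integral {-1..1} (f :: real \<Rightarrow> real)"
  using Henstock_Kurzweil_Integration.integral_reflect_real[of 1 "-1" f] by simp

lemma L2_on_I_reflect:
  assumes "L2_on_I f"
  shows "L2_on_I (\<lambda>w. f (- w))"
proof -
  have "(\<lambda>w. f (- w)) absolutely_integrable_on {-1..1}"
    using L2_on_I_absolutely_integrable[OF assms] absolutely_integrable_reflect_real[of 1 "-1" f] by simp
  then have "(\<lambda>w. f (- w)) measurable_on {-1..1}"
    by (simp add: measurable_on_iff_borel_measurable absolutely_integrable_imp_borel_measurable)
  moreover have "(\<lambda>w. (f (- w))\<^sup>2) integrable_on {-1..1}"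
    using assms Henstock_Kurzweil_Integration.integrable_reflect_real[where f = "\<lambda>w. (f w)\<^sup>2" and a = "-1" and b = 1] by (simp add: L2_on_I_def)
  ultimately show ?thesis by (simp add: L2_on_I_def)
qed

lemma has_derivative_reflect_I:
  assumes "(f has_real_derivative f') (at (- x) within {-1..1})"
  shows "((\<lambda>w. f (- w)) has_real_derivative - f') (at x within {-1..1::real})"
proof -
  have img: "uminus ` {-1..1} = {-1..1::real}" by auto
  have "(uminus has_real_derivative -1) (at x within {-1..1})" by (auto intro!: derivative_eq_intros)
  from DERIV_image_chain[OF _ this, of f f'] assms show ?thesis by (simp add: img o_def)
qed

lemma continuous_on_reflect_I:
  fixes f :: "real \<Rightarrow> real"
  assumes "continuous_on {-1..1} f"
  shows "continuous_on {-1..1} (\<lambda>w. f (- w))"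
  by (intro continuous_on_compose2[OF assms] continuous_intros) auto

lemma kernel_reflect_continuous:
  fixes K :: "real \<Rightarrow> real \<Rightarrow> real"
  assumes "continuous_on kernE (\<lambda>(z, w). K z w)"
  shows "continuous_on kernE (\<lambda>(z, w). - K (- z) (- w))"
proof -
  have "continuous_on kernE (\<lambda>x. (\<lambda>(z, w). K z w) (- fst x, - snd x))"
    by (intro continuous_on_compose2[OF assms] continuous_intros) (auto simp: kernE_iff)
  then show ?thesis by (simp add: case_prod_unfold continuous_on_minus)
qed

theorem theorem2:
  fixes lam lam' mu mu' b c u0 v0 :: "real \<Rightarrow> real"
    and L11 L12 L21 L22 u v :: "real \<Rightarrow> real \<Rightarrow> real"
  assumes lam_C1: "\<forall>x\<in>{-1..1}. (lam has_real_derivative lam' x) (at x within {-1..1})"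
      and lam'_cont: "continuous_on {-1..1} lam'"
      and mu_C1: "\<forall>x\<in>{-1..1}. (mu has_real_derivative mu' x) (at x within {-1..1})"
      and mu'_cont: "continuous_on {-1..1} mu'"
      and lam_pos: "\<forall>x\<in>{-1..1}. lam x > 0"
      and mu_pos: "\<forall>x\<in>{-1..1}. mu x > 0"
      and sym: "\<forall>w\<in>{-1..1}. lam w = mu (-w)"
      and b_cont: "continuous_on {-1..1} b"
      and c_cont: "continuous_on {-1..1} c"
      and kernels: "kernel_eqs lam lam' mu mu' b c L11 L12 L21 L22"
      and u0_L2: "L2_on_I u0"
      and v0_L2: "L2_on_I v0"
      and sol: "closed_loop_sol lam lam' mu mu' b c L11 L12 L21 L22 u0 v0 u v"
  shows "\<exists>T\<ge>0. \<forall>t\<ge>T. integral {-1..1} (\<lambda>w. (u w t)\<^sup>2) = 0 \<and> integral {-1..1} (\<lambda>w. (v w t)\<^sup>2) = 0"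
proof -
  note K = kernels[unfolded kernel_eqs_def]
  note S = sol[unfolded closed_loop_sol_def]
  have L2: "L2_on_I (\<lambda>w. u w t)" "L2_on_I (\<lambda>w. v w t)" if "t \<ge> 0" for t
    using S that by auto
  have ct: "((\<lambda>s. integral {-1..1} (\<lambda>w. (u w s - u w t)\<^sup>2)) \<longlongrightarrow> 0) (at t within {0..})"
     "((\<lambda>s. integral {-1..1} (\<lambda>w. (v w s - v w t)\<^sup>2)) \<longlongrightarrow> 0) (at t within {0..})" if "t \<ge> 0" for t
    using S that by auto
  have wu: "integral {0..} (\<lambda>t. integral {-1..1} (\<lambda>w.
            u w t * (phit w t + lam' w * phi w t + lam w * phiw w t) + b w * v w t * phi w t))
        + integral {0..} (\<lambda>t. lam (-1) * U1_fb L11 L12 u v t * phi (-1) t) = 0"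
    if "test_fun phi phiw phit" "\<And>t. phi 1 t = 0" for phi phiw phit
    using S that by blast
  have wv: "integral {0..} (\<lambda>t. integral {-1..1} (\<lambda>w.
            v w t * (psit w t - mu' w * psi w t - mu w * psiw w t) + c w * u w t * psi w t))
        + integral {0..} (\<lambda>t. mu 1 * U2_fb L21 L22 u v t * psi 1 t) = 0"
    if "test_fun psi psiw psit" "\<And>t. psi (-1) t = 0" for psi psiw psit
    using S that by blast
  have lam_c: "continuous_on {-1..1} lam"
    using lam_C1 by (intro DERIV_continuous_on[of _ lam lam']) auto
  have mu_refl: "mu x = lam (- x)" if "x \<in> {-1..1}" for x
    using sym[rule_format, of "- x"] that by simp
  obtain sig X where flow: "\<And>x. (sig has_real_derivative 1 / lam (max (-1) (min 1 x))) (at x)"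
    "\<And>s. (X has_real_derivative lam (max (-1) (min 1 (X s)))) (at s)"
    "\<And>s. sig (X s) = s" "\<And>x. X (sig x) = x"
    using flow_exists[OF lam_c] lam_pos by blast
  interpret A: half_system lam lam' mu mu' b c L11 L12 sig X u v
  proof unfold_locales
    show "integral {0..} (\<lambda>t. integral {-1..1} (\<lambda>w.
            v w t * (psit w t - mu' w * psi w t - mu w * psiw w t) + c w * u w t * psi w t)) = 0"
      if "test_fun psi psiw psit" "\<And>t. psi (-1) t = 0" "\<And>t. psi 1 t = 0" for psi psiw psit
      using wv[OF that(1,2)] that(3) by simp
  qed (use lam_C1 lam'_cont mu_C1 mu'_cont lam_pos mu_refl b_cont c_cont K flow L2 ct wu in \<open>simp_all\<close>)
  have mu_eq_lam: "mu (- x) = lam x" if "x \<in> {-1..1}" for x using sym that by simp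
  have clamp: "max (-1) (min 1 x) \<in> {-1..1}" for x :: real by auto
  \<comment> \<open>The reflection \<open>w \<mapsto> -w\<close> exchanges \<open>u\<close> and \<open>v\<close> and turns the second pair of kernels into the first one.\<close>
  interpret B: half_system "\<lambda>w. mu (- w)" "\<lambda>w. - mu' (- w)" "\<lambda>w. lam (- w)" "\<lambda>w. - lam' (- w)"
    "\<lambda>w. c (- w)" "\<lambda>w. b (- w)" "\<lambda>z w. - L22 (- z) (- w)" "\<lambda>z w. - L21 (- z) (- w)" sig X
    "\<lambda>w. v (- w)" "\<lambda>w. u (- w)"
  proof unfold_locales
    fix x :: real assume x: "x \<in> {-1..1}"
    then have mx: "- x \<in> {-1..1}" by auto
    show "((\<lambda>w. mu (- w)) has_real_derivative - mu' (- x)) (at x within {-1..1})"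
      using mu_C1 mx by (intro has_derivative_reflect_I) auto
    show "((\<lambda>w. lam (- w)) has_real_derivative - lam' (- x)) (at x within {-1..1})"
      using lam_C1 mx by (intro has_derivative_reflect_I) auto
    show "0 < mu (- x)" using mu_pos mx by blast
    show "lam (- x) = mu (- (- x))" using mu_refl[OF x] by simp
    show "- L22 (- (- x)) (- x) = 0" using K mx by (metis neg_0_equal_iff_equal)
    have "L21 (- x) (- x) = - c (- x) / (lam (- x) + mu (- x))" using K mx by blast
    then show "- L21 (- x) (- x) = c (- x) / (mu (- x) + lam (- x))" by (simp add: add.commute)
  next
    show "continuous_on {-1..1} (\<lambda>w. - mu' (- w))" "continuous_on {-1..1} (\<lambda>w. - lam' (- w))"
      "continuous_on {-1..1} (\<lambda>w. c (- w))" "continuous_on {-1..1} (\<lambda>w. b (- w))"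
      by (intro continuous_on_minus continuous_on_reflect_I mu'_cont lam'_cont b_cont c_cont)+
    show "continuous_on kernE (\<lambda>(z, w). - L22 (- z) (- w))" "continuous_on kernE (\<lambda>(z, w). - L21 (- z) (- w))"
      using K by (auto intro!: kernel_reflect_continuous)
    have "char_sol (\<lambda>z. mu (- z)) (\<lambda>w. mu (- w)) (\<lambda>z w. b (- z) * L21 (- z) (- w) - mu' (- z) * L22 (- z) (- w))
       (\<lambda>z w. - L22 (- z) (- w))"
      using K char_sol_reflect[of mu mu "\<lambda>z w. b z * L21 z w - mu' z * L22 z w" L22] by blast
    then show "char_sol (\<lambda>w. mu (- w)) (\<lambda>w. mu (- w))
       (\<lambda>z w. - (- mu' (- z)) * (- L22 (- z) (- w)) - b (- z) * (- L21 (- z) (- w))) (\<lambda>z w. - L22 (- z) (- w))"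
      by (simp add: algebra_simps)
    have "char_sol (\<lambda>z. - lam (- z)) (\<lambda>w. mu (- w)) (\<lambda>z w. lam' (- z) * L21 (- z) (- w) + c (- z) * L22 (- z) (- w))
       (\<lambda>z w. - L21 (- z) (- w))"
      using K char_sol_reflect[of "\<lambda>z. - lam z" mu "\<lambda>z w. lam' z * L21 z w + c z * L22 z w" L21] by blast
    then show "char_sol (\<lambda>z. - lam (- z)) (\<lambda>w. mu (- w))
       (\<lambda>z w. - c (- z) * (- L22 (- z) (- w)) + - lam' (- z) * (- L21 (- z) (- w))) (\<lambda>z w. - L21 (- z) (- w))"
      by (simp add: algebra_simps)
    \<comment> \<open>The reflected speed \<open>mu (- w)\<close> is \<open>lam w\<close>, so the
      flow of the first half serves again.\<close>
    show "(sig has_real_derivative 1 / mu (- max (-1) (min 1 x))) (at x)" for x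
      unfolding mu_eq_lam[OF clamp] by (rule flow)
    show "(X has_real_derivative mu (- max (-1) (min 1 (X s)))) (at s)" for s
      unfolding mu_eq_lam[OF clamp] by (rule flow)
    show "sig (X s) = s" "X (sig x) = x" for s x by (simp_all add: flow)
  next
    fix t :: real assume t: "t \<ge> 0"
    show "L2_on_I (\<lambda>w. v (- w) t)" "L2_on_I (\<lambda>w. u (- w) t)"
      by (intro L2_on_I_reflect L2 t)+
    show "((\<lambda>s. integral {-1..1} (\<lambda>w. (v (- w) s - v (- w) t)\<^sup>2)) \<longlongrightarrow> 0) (at t within {0..})"
      using ct(2)[OF t] integral_reflect_I[of "\<lambda>w. (v w s - v w t)\<^sup>2" for s] by simp
    show "((\<lambda>s. integral {-1..1} (\<lambda>w. (u (- w) s - u (- w) t)\<^sup>2)) \<longlongrightarrow> 0) (at t within {0..})"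
      using ct(1)[OF t] integral_reflect_I[of "\<lambda>w. (u w s - u w t)\<^sup>2" for s] by simp
  next
    fix phi phiw phit assume T: "test_fun phi phiw phit" and p1: "\<And>t. phi 1 t = 0"
    \<comment> \<open>The minus signs of the reflected kernels cancel those in \<open>U1_fb\<close>,
      so the first feedback law of the reflected system is the second one of the original.\<close>
    have fb: "U1_fb (\<lambda>z w. - L22 (- z) (- w)) (\<lambda>z w. - L21 (- z) (- w)) (\<lambda>w. v (- w)) (\<lambda>w. u (- w)) t = U2_fb L21 L22 u v t" for t
      unfolding U1_fb_def U2_fb_def
      using integral_reflect_I[of "\<lambda>z. v z t * L22 z 1"] integral_reflect_I[of "\<lambda>z. u z t * L21 z 1"] by simp
    have "integral {-1..1} (\<lambda>w. v (- w) t * (phit w t + - mu' (- w) * phi w t + mu (- w) * phiw w t)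
        + c (- w) * u (- w) t * phi w t) =
      integral {-1..1} (\<lambda>w. v w t * (phit (- w) t - mu' w * phi (- w) t - mu w * - phiw (- w) t) + c w * u w t * phi (- w) t)" for t
      by (subst integral_reflect_I[symmetric]) (simp add: algebra_simps)
    then show "integral {0..} (\<lambda>t. integral {-1..1} (\<lambda>w. v (- w) t * (phit w t + - mu' (- w) * phi w t + mu (- w) * phiw w t)
        + c (- w) * u (- w) t * phi w t)) +
       integral {0..} (\<lambda>t. mu (- (-1)) * U1_fb (\<lambda>z w. - L22 (- z) (- w)) (\<lambda>z w. - L21 (- z) (- w)) (\<lambda>w. v (- w)) (\<lambda>w. u (- w)) t * phi (-1) t) = 0"
      using wv[OF test_fun_reflect[OF T]] p1 unfolding fb by simp
  next
    fix psi psiw psit assume T: "test_fun psi psiw psit" and p1: "\<And>t. psi (-1) t = 0" "\<And>t. psi 1 t = 0"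
    have "integral {-1..1} (\<lambda>w. u (- w) t * (psit w t - - lam' (- w) * psi w t - lam (- w) * psiw w t)
        + b (- w) * v (- w) t * psi w t) =
      integral {-1..1} (\<lambda>w. u w t * (psit (- w) t + lam' w * psi (- w) t + lam w * - psiw (- w) t) + b w * v w t * psi (- w) t)" for t
      by (subst integral_reflect_I[symmetric]) (simp add: algebra_simps)
    then show "integral {0..} (\<lambda>t. integral {-1..1} (\<lambda>w. u (- w) t * (psit w t - - lam' (- w) * psi w t - lam (- w) * psiw w t)
        + b (- w) * v (- w) t * psi w t)) = 0"
      using wu[OF test_fun_reflect[OF T]] p1 by simp
  qed
  \<comment> \<open>The added 1 makes every \<open>t \<ge> T\<close> strictly exceed the travel
    time, as \<open>state_bound\<close> requires.\<close>
  define T where "T = max 0 (sig 1 - sig (-1)) + 1"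
  show ?thesis
  proof (intro exI[of _ T] conjI allI impI)
    show "T \<ge> 0" by (simp add: T_def)
    fix t assume "t \<ge> T"
    then have t: "t > sig 1 - sig (-1)" "t \<ge> 0" unfolding T_def by linarith+
    obtain N1 C1 where 1: "negligible N1" "C1 \<ge> 0"
      "\<And>w. w \<in> {-1..1} - N1 \<Longrightarrow> \<bar>u w t\<bar> \<le> C1 * integral {-\<bar>w\<bar>..\<bar>w\<bar>} (\<lambda>z. \<bar>u z t\<bar> + \<bar>v z t\<bar>)"
      using A.state_bound[of t] t by (auto simp: A.ra_def A.rb_def)
    obtain N2 C2 where 2: "negligible N2" "C2 \<ge> 0"
      "\<And>w. w \<in> {-1..1} - N2 \<Longrightarrow> \<bar>v (- w) t\<bar> \<le> C2 * integral {-\<bar>w\<bar>..\<bar>w\<bar>} (\<lambda>z. \<bar>v (- z) t\<bar> + \<bar>u (- z) t\<bar>)"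
      using B.state_bound[of t] t by (auto simp: B.ra_def B.rb_def)
    define f where "f w = \<bar>u w t\<bar> + \<bar>v w t\<bar>" for w
    \<comment> \<open>\<open>N2\<close> belongs to the reflected coordinate and has to be reflected
      back.\<close>
    define N where "N = N1 \<union> uminus ` N2"
    have N: "negligible N"
      unfolding N_def using 1(1) 2(1) by (intro negligible_Un negligible_differentiable_image_negligible)
        (auto intro!: derivative_intros)
    have zero: "f w = 0" if w: "w \<in> {-1..1} - N" for w
    proof (rule volterra_AE_zero[OF _ _ _ N _ w])
      show "f integrable_on {-1..1}"
        unfolding f_def by (intro integrable_add absolutely_integrable_imp_abs_integrable
          L2_on_I_absolutely_integrable L2 t)
      show "f w \<le> (C1 + C2) * integral {-\<bar>w\<bar>..\<bar>w\<bar>} f" if "w \<in> {-1..1} - N" for w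
      proof -
        \<comment> \<open>The interval is symmetric, so the estimates of both halves have the same
          integral of \<open>f\<close> on the right and can be added.\<close>
        have "integral {-\<bar>w\<bar>..\<bar>w\<bar>} (\<lambda>z. \<bar>v (- z) t\<bar> + \<bar>u (- z) t\<bar>) = integral {-\<bar>w\<bar>..\<bar>w\<bar>} f"
          using Henstock_Kurzweil_Integration.integral_reflect_real[of "\<bar>w\<bar>" "-\<bar>w\<bar>" f]
          by (simp add: f_def add.commute)
        moreover have "- w \<in> {-1..1} - N2" using that by (force simp: N_def)
        ultimately have "\<bar>v w t\<bar> \<le> C2 * integral {-\<bar>w\<bar>..\<bar>w\<bar>} f" using 2(3)[of "- w"] by simp
        moreover have "\<bar>u w t\<bar> \<le> C1 * integral {-\<bar>w\<bar>..\<bar>w\<bar>} f" using 1(3)[of w] that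
          by (simp add: N_def f_def[abs_def])
        ultimately show ?thesis by (simp add: f_def algebra_simps)
      qed
    qed (use 1(2) 2(2) in \<open>auto simp: f_def\<close>)
    have uv0: "u w t = 0" "v w t = 0" if "w \<in> {-1..1} - N" for w
      using zero[OF that] by (auto simp: f_def)
    have "integral {-1..1} (\<lambda>w. (g w)\<^sup>2) = integral {-1..1} (\<lambda>w :: real. 0)"
      if "\<And>w. w \<in> {-1..1} - N \<Longrightarrow> g w = 0" for g :: "real \<Rightarrow> real"
      by (rule integral_spike[OF N]) (use that in auto)
    from this[of "\<lambda>w. u w t"] this[of "\<lambda>w. v w t"] uv0
    show "integral {-1..1} (\<lambda>w. (u w t)\<^sup>2) = 0" "integral {-1..1} (\<lambda>w. (v w t)\<^sup>2) = 0"
      by simp_all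
  qed
qed

end
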